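(* If $L:M\to CP^2_1(4)$ is a minimal flat slant surface in the Lorentzian complex projective plane $CP^2_1(4)$, then $L$ is Lagrangian. Moreover, the immersion $L$ is congruent to $\pi\circ\tilde L$, where $$\tilde L(x,y)=\frac1{\sqrt3}\Big(\sqrt2\,e^{\frac{\mathrm i}{2a}(x-a^2y)}\sinh\big(\tfrac{\sqrt3}{2a}(x+a^2y)\big),\;e^{\frac{\mathrm i}{a}(a^2y-x)},\;\sqrt2\,e^{\frac{\mathrm i}{2a}(x-a^2y)}\cosh\big(\tfrac{\sqrt3}{2a}(x+a^2y)\big)\Big),$$ $a$ is a nonzero real number and $\pi:S^5_2(1)\to CP^2_1(4)$ is the Hopf fibration.
   Context: $\mathbf C^3_1$ is $\mathbf C^3$ with the metric $\mathrm{Re}\,b$, where $b(z,w)=-\bar z_1w_1+\bar z_2w_2+\bar z_3w_3$. $S^5_2(1)=\{z\in\mathbf C^3_1: b(z,z)=1\}$, with the induced pseudo-Riemannian metric (constant sectional curvature $1$). $CP^2_1(4)$ is the set of complex lines $z\cdot\mathbf C^*$ with $z\in S^5_2(1)$, with its natural complex structure and the unique pseudo-Riemannian metric of complex index one making the Hopf fibration $\pi:S^5_2(1)\to CP^2_1(4)$, $z\mapsto z\cdot\mathbf C^*$, a (pseudo-)Riemannian submersion; it is a Lorentzian complex space form of constant holomorphic sectional curvature $4$. A Lorentzian surface is an immersed real surface whose induced metric has signature $(1,1)$; it is minimal if its mean curvature vector $H=\frac12\operatorname{trace}h$ ($h$ the second fundamental form) vanishes identically, and flat if the induced metric is flat.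 On a Lorentzian surface take a local tangent frame $\{e_1,e_2\}$ with $\langle e_1,e_1\rangle=\langle e_2,e_2\rangle=0$, $\langle e_1,e_2\rangle=-1$; writing $PX$ for the tangential component of $JX$ ($J$ the complex structure), one has $Pe_1=(\sinh\alpha)e_1$, $Pe_2=-(\sinh\alpha)e_2$ for a function $\alpha$, the Wirtinger angle. A Lorentzian surface is slant if $\alpha$ is constant, and it is Lagrangian if and only if $\alpha=0$. Two surfaces are congruent if, up to reparametrization, they differ by a holomorphic isometry of the ambient space. *)

theory Defs
  imports "HOL-Analysis.Analysis"
begin

section \<open>Smooth maps between open subsets of normed spaces\<close>

text \<open>Meant for open \<open>S\<close> and finite-dimensional domain, where directional derivatives in all
  directions suffice to express membership in $C^k$.\<close>

primrec C_k_on :: "nat \<Rightarrow> 'a::real_normed_vector set \<Rightarrow> ('a \<Rightarrow> 'b::real_normed_vector) \<Rightarrow> bool" where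
  "C_k_on 0 S f \<longleftrightarrow> continuous_on S f"
| "C_k_on (Suc k) S f \<longleftrightarrow> (\<forall>x\<in>S. f differentiable (at x)) \<and>
     (\<forall>v. C_k_on k S (\<lambda>x. frechet_derivative f (at x) v))"

definition smooth_on :: "'a::real_normed_vector set \<Rightarrow> ('a \<Rightarrow> 'b::real_normed_vector) \<Rightarrow> bool" where
  "smooth_on S f \<longleftrightarrow> (\<forall>k. C_k_on k S f)"


section \<open>Pseudo-Riemannian geometry in coordinates\<close>

text \<open>A metric on a coordinate domain is a map \<open>g\<close>, where \<open>g x u v\<close> is the product
  $\langle u,v\rangle$ at the point \<open>x\<close>.\<close>

type_synonym 'a metric_field = "'a \<Rightarrow> 'a \<Rightarrow> 'a \<Rightarrow> real"

text \<open>The Christoffel symbols $\Gamma_x(u,v)=\nabla_u v$ of the Levi-Civita connection, for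
  constant vector fields \<open>u\<close>, \<open>v\<close>; the defining equation is the Koszul formula.\<close>

definition christoffel :: "'a::euclidean_space metric_field \<Rightarrow> 'a \<Rightarrow> 'a \<Rightarrow> 'a \<Rightarrow> 'a" where
  "christoffel g x u v = (THE c. \<forall>w. 2 * g x c w =
      frechet_derivative (\<lambda>y. g y v w) (at x) u
    + frechet_derivative (\<lambda>y. g y u w) (at x) v
    - frechet_derivative (\<lambda>y. g y u v) (at x) w)"

text \<open>$R(u,v)w=\nabla_u\nabla_v w-\nabla_v\nabla_u w$ for constant (hence commuting) fields.\<close>

definition riemann_curvature :: "'a::euclidean_space metric_field \<Rightarrow> 'a \<Rightarrow> 'a \<Rightarrow> 'a \<Rightarrow> 'a \<Rightarrow> 'a" where
  "riemann_curvature g x u v w =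
      frechet_derivative (\<lambda>y. christoffel g y v w) (at x) u
    - frechet_derivative (\<lambda>y. christoffel g y u w) (at x) v
    + christoffel g x u (christoffel g x v w)
    - christoffel g x v (christoffel g x u w)"

definition pullback_metric ::
  "'b metric_field \<Rightarrow> ('a::real_normed_vector \<Rightarrow> 'b::real_normed_vector) \<Rightarrow> 'a metric_field" where
  "pullback_metric g f x u v =
     g (f x) (frechet_derivative f (at x) u) (frechet_derivative f (at x) v)"

text \<open>Gauss formula: $h(u,v)=\tilde\nabla_u f_*v-f_*(\nabla_u v)$, with \<open>\<nabla>\<close> the Levi-Civita
  connection of the induced metric.\<close>

definition second_fundamental_form ::
  "'b::euclidean_space metric_field \<Rightarrow> ('a::euclidean_space \<Rightarrow> 'b) \<Rightarrow> 'a \<Rightarrow> 'a \<Rightarrow> 'a \<Rightarrow> 'b" where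
  "second_fundamental_form g f x u v =
      frechet_derivative (\<lambda>y. frechet_derivative f (at y) v) (at x) u
    + christoffel g (f x) (frechet_derivative f (at x) u) (frechet_derivative f (at x) v)
    - frechet_derivative f (at x) (christoffel (pullback_metric g f) x u v)"

definition mean_curvature ::
  "'b::euclidean_space metric_field \<Rightarrow> (real^2 \<Rightarrow> 'b) \<Rightarrow> real^2 \<Rightarrow> 'b" where
  "mean_curvature g f x =
     (let G = (\<chi> i j. pullback_metric g f x (axis i 1) (axis j 1)) :: real^2^2
      in (1/2) *\<^sub>R (\<Sum>i\<in>UNIV. \<Sum>j\<in>UNIV. matrix_inv G $ i $ j *\<^sub>R
            second_fundamental_form g f x (axis i 1) (axis j 1)))"

text \<open>The tangential component of an ambient vector \<open>\<xi>\<close> along \<open>f\<close>, as a vector of the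
  coordinate domain.\<close>

definition tangential ::
  "'b::real_normed_vector metric_field \<Rightarrow> ('a::real_normed_vector \<Rightarrow> 'b) \<Rightarrow> 'a \<Rightarrow> 'b \<Rightarrow> 'a" where
  "tangential g f x \<xi> = (THE u. \<forall>v.
     g (f x) (\<xi> - frechet_derivative f (at x) u) (frechet_derivative f (at x) v) = 0)"


section \<open>The Lorentzian complex projective plane\<close>

definition b_form :: "complex^3 \<Rightarrow> complex^3 \<Rightarrow> complex" where
  "b_form z w = - cnj (z$1) * w$1 + cnj (z$2) * w$2 + cnj (z$3) * w$3"

definition S52 :: "(complex^3) set" where
  "S52 = {z. b_form z z = 1}"

definition hopf :: "complex^3 \<Rightarrow> (complex^3) set" where
  "hopf z = {c *s z | c. c \<noteq> 0}"

definition CP21 :: "(complex^3) set set" where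
  "CP21 = hopf ` S52"

text \<open>The complex (and smooth) structure of \<open>CP21\<close> is given by its three affine charts
  $[z]\mapsto(z_i/z_k)_{i\neq k}$, so that \<open>J\<close> is multiplication by \<open>\<i>\<close> in each chart.\<close>

definition affine_coords :: "3 \<Rightarrow> complex^3 \<Rightarrow> complex^2" where
  "affine_coords k z =
     (if k = 1 then vector [z$2 / z$1, z$3 / z$1]
      else if k = 2 then vector [z$1 / z$2, z$3 / z$2]
      else vector [z$1 / z$3, z$2 / z$3])"

definition cp_domain :: "3 \<Rightarrow> (complex^3) set set" where
  "cp_domain k = hopf ` {z \<in> S52. z$k \<noteq> 0}"

definition cp_chart :: "3 \<Rightarrow> (complex^3) set \<Rightarrow> complex^2" where
  "cp_chart k l = the_elem (affine_coords k ` l)"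

text \<open>Tangent vectors of \<open>S52\<close> at \<open>z\<close> that are orthogonal to the Hopf fibre
  $t\mapsto e^{it}z$.\<close>

definition horizontal :: "complex^3 \<Rightarrow> (complex^3) set" where
  "horizontal z = {w. Re (b_form z w) = 0 \<and> Re (b_form (\<i> *s z) w) = 0}"

text \<open>The metric of \<open>CP21\<close> in the chart \<open>k\<close>: the unique one for which the Hopf fibration is
  isometric on horizontal spaces, i.e. a pseudo-Riemannian submersion.\<close>

definition cp_metric :: "3 \<Rightarrow> (complex^2) metric_field" where
  "cp_metric k \<zeta> = (THE g. \<forall>z\<in>S52. z$k \<noteq> 0 \<and> affine_coords k z = \<zeta> \<longrightarrow>
     (\<forall>v\<in>horizontal z. \<forall>w\<in>horizontal z.
        g (frechet_derivative (affine_coords k) (at z) v)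
          (frechet_derivative (affine_coords k) (at z) w) = Re (b_form v w)))"

definition holomorphic_isometry :: "((complex^3) set \<Rightarrow> (complex^3) set) \<Rightarrow> bool" where
  "holomorphic_isometry A \<longleftrightarrow> bij_betw A CP21 CP21 \<and>
     (\<forall>k l. let D = cp_chart k ` {p \<in> cp_domain k. A p \<in> cp_domain l};
                F = cp_chart l \<circ> A \<circ> inv_into (cp_domain k) (cp_chart k)
            in open D \<and> smooth_on D F \<and>
               (\<forall>\<zeta>\<in>D. \<forall>v w.
                  frechet_derivative F (at \<zeta>) (\<i> *s v) = \<i> *s frechet_derivative F (at \<zeta>) v \<and>
                  pullback_metric (cp_metric l) F \<zeta> v w = cp_metric k \<zeta> v w))"


section \<open>Smooth surfaces and their immersions\<close>

text \<open>A chart \<open>(V, \<phi>)\<close> consists of its domain and its coordinate map. The surface is the whole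
  type \<open>'m\<close>; the atlas need not be maximal.\<close>

type_synonym 'm surface_atlas = "('m set \<times> ('m \<Rightarrow> real^2)) set"

definition smooth_surface :: "'m::topological_space surface_atlas \<Rightarrow> bool" where
  "smooth_surface \<A> \<longleftrightarrow> (\<Union>(V, \<phi>)\<in>\<A>. V) = UNIV \<and>
     (\<forall>(V, \<phi>)\<in>\<A>. open V \<and> open (\<phi> ` V) \<and> (\<exists>\<phi>'. homeomorphism V (\<phi> ` V) \<phi> \<phi>')) \<and>
     (\<forall>(V, \<phi>)\<in>\<A>. \<forall>(W, \<psi>)\<in>\<A>. smooth_on (\<phi> ` (V \<inter> W)) (\<psi> \<circ> inv_into V \<phi>))"

text \<open>\<open>in_coords \<A> L Q\<close>: in every chart of the surface and every affine chart of \<open>CP21\<close>, \<open>Q\<close> holds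
  of the ambient metric, the coordinate representation of \<open>L\<close> and the domain of the latter.\<close>

definition in_coords :: "'m surface_atlas \<Rightarrow> ('m \<Rightarrow> (complex^3) set) \<Rightarrow>
    ((complex^2) metric_field \<Rightarrow> (real^2 \<Rightarrow> complex^2) \<Rightarrow> (real^2) set \<Rightarrow> bool) \<Rightarrow> bool" where
  "in_coords \<A> L Q \<longleftrightarrow> (\<forall>(V, \<phi>)\<in>\<A>. \<forall>k.
     Q (cp_metric k) (cp_chart k \<circ> L \<circ> inv_into V \<phi>) (\<phi> ` {p \<in> V. L p \<in> cp_domain k}))"

definition cp_immersion :: "'m surface_atlas \<Rightarrow> ('m \<Rightarrow> (complex^3) set) \<Rightarrow> bool" where
  "cp_immersion \<A> L \<longleftrightarrow> range L \<subseteq> CP21 \<and>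
     in_coords \<A> L (\<lambda>g f D. open D \<and> smooth_on D f \<and> (\<forall>x\<in>D. inj (frechet_derivative f (at x))))"

definition lorentzian :: "'m surface_atlas \<Rightarrow> ('m \<Rightarrow> (complex^3) set) \<Rightarrow> bool" where
  "lorentzian \<A> L \<longleftrightarrow> in_coords \<A> L (\<lambda>g f D. \<forall>x\<in>D. \<exists>u v.
     pullback_metric g f x u u = 1 \<and> pullback_metric g f x v v = -1 \<and> pullback_metric g f x u v = 0)"

definition minimal_immersion :: "'m surface_atlas \<Rightarrow> ('m \<Rightarrow> (complex^3) set) \<Rightarrow> bool" where
  "minimal_immersion \<A> L \<longleftrightarrow> in_coords \<A> L (\<lambda>g f D. \<forall>x\<in>D. mean_curvature g f x = 0)"

definition flat_immersion :: "'m surface_atlas \<Rightarrow> ('m \<Rightarrow> (complex^3) set) \<Rightarrow> bool" where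
  "flat_immersion \<A> L \<longleftrightarrow> in_coords \<A> L (\<lambda>g f D. \<forall>x\<in>D. \<forall>u v w.
     riemann_curvature (pullback_metric g f) x u v w = 0)"

definition null_frame_on :: "(real^2) set \<Rightarrow> (real^2) metric_field \<Rightarrow>
    (real^2 \<Rightarrow> real^2) \<Rightarrow> (real^2 \<Rightarrow> real^2) \<Rightarrow> bool" where
  "null_frame_on U g e1 e2 \<longleftrightarrow> smooth_on U e1 \<and> smooth_on U e2 \<and>
     (\<forall>x\<in>U. g x (e1 x) (e1 x) = 0 \<and> g x (e2 x) (e2 x) = 0 \<and> g x (e1 x) (e2 x) = -1)"

definition wirtinger_angle_on :: "(real^2) set \<Rightarrow> (complex^2) metric_field \<Rightarrow>
    (real^2 \<Rightarrow> complex^2) \<Rightarrow> (real^2 \<Rightarrow> real^2) \<Rightarrow> (real^2 \<Rightarrow> real^2) \<Rightarrow> (real^2 \<Rightarrow> real) \<Rightarrow> bool" where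
  "wirtinger_angle_on U g f e1 e2 \<alpha> \<longleftrightarrow>
     (let P = (\<lambda>x u. tangential g f x (\<i> *s frechet_derivative f (at x) u))
      in \<forall>x\<in>U. P x (e1 x) = sinh (\<alpha> x) *\<^sub>R e1 x \<and> P x (e2 x) = - (sinh (\<alpha> x)) *\<^sub>R e2 x)"

text \<open>Interchanging the two null directions changes the sign of the Wirtinger angle, so on a
  connected surface constancy of the angle means that around every point there is a frame for which
  it equals one global constant.\<close>

definition slant :: "'m surface_atlas \<Rightarrow> ('m \<Rightarrow> (complex^3) set) \<Rightarrow> bool" where
  "slant \<A> L \<longleftrightarrow> (\<exists>\<theta>. in_coords \<A> L (\<lambda>g f D. \<forall>x\<in>D. \<exists>U e1 e2. open U \<and> x \<in> U \<and> U \<subseteq> D \<and>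
     null_frame_on U (pullback_metric g f) e1 e2 \<and> wirtinger_angle_on U g f e1 e2 (\<lambda>_. \<theta>)))"

text \<open>\<open>J\<close> maps tangent vectors to normal vectors.\<close>

definition lagrangian :: "'m surface_atlas \<Rightarrow> ('m \<Rightarrow> (complex^3) set) \<Rightarrow> bool" where
  "lagrangian \<A> L \<longleftrightarrow> in_coords \<A> L (\<lambda>g f D. \<forall>x\<in>D. \<forall>u v.
     g (f x) (\<i> *s frechet_derivative f (at x) u) (frechet_derivative f (at x) v) = 0)"

text \<open>\<open>F\<close> is a surface parametrized by the plane. One holomorphic isometry \<open>A\<close> serves the whole
  surface, while the reparametrizations are local: \<open>(W, \<psi>)\<close> is a local coordinate system compatible
  with the smooth structure. A global change of parameter need not exist (e.g. when \<open>F\<close> factors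
  through a cylinder and the surface is that cylinder).\<close>

definition congruent_to ::
  "'m::topological_space surface_atlas \<Rightarrow> ('m \<Rightarrow> (complex^3) set) \<Rightarrow> (real^2 \<Rightarrow> (complex^3) set) \<Rightarrow> bool" where
  "congruent_to \<A> L F \<longleftrightarrow> (\<exists>A. holomorphic_isometry A \<and>
     (\<forall>p. \<exists>W \<psi>. p \<in> W \<and> smooth_surface (insert (W, \<psi>) \<A>) \<and> (\<forall>q\<in>W. L q = A (F (\<psi> q)))))"

definition L_tilde :: "real \<Rightarrow> real^2 \<Rightarrow> complex^3" where
  "L_tilde a p = (let x = p$1; y = p$2 in complex_of_real (1 / sqrt 3) *s vector
     [ of_real (sqrt 2) * exp (\<i> / of_real (2*a) * of_real (x - a^2*y))
         * of_real (sinh (sqrt 3 / (2*a) * (x + a^2*y))),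
       exp (\<i> / of_real a * of_real (a^2*y - x)),
       of_real (sqrt 2) * exp (\<i> / of_real (2*a) * of_real (x - a^2*y))
         * of_real (cosh (sqrt 3 / (2*a) * (x + a^2*y))) ])"

end

theory Submission
  imports Defs
begin

text \<open>The proof is a moving frame argument in $\mathbf C^3$. Near a point, represent $L$ in an affine
  chart and let $Z$ be the normalised homogeneous lift to $S^5_2(1)$. Take the null frame
  $e_1,e_2$ that comes with the slant hypothesis, its dual forms $\theta_1,\theta_2$, and let $H_i$
  be the horizontal lift of $L_*e_i$. Both $H_i$ are null for $b$ and $\beta=b(H_1,H_2)$ has real
  part $-1$, so $Z,H_1,H_2$ is a complex basis of $\mathbf C^3$ along the surface; slantness says
  precisely that $\beta=-1-i\sinh\alpha$ is constant, so the basis has a constant Gram matrix.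
  Minimality is $h(e_1,e_2)=0$. Together with the constant Gram matrix it leaves only
  $$dZ=aZ+\theta_1H_1+\theta_2H_2,\quad dH_1=(a+\omega)H_1+p\,\theta_1H_2-\bar\beta\theta_2Z,\quad
    dH_2=(a-\omega)H_2+q\,\theta_2H_1-\beta\theta_1Z,$$
  where $\omega$ is the connection form of the induced metric, $a$ is imaginary, and $p\beta$,
  $q\bar\beta$ are imaginary (lemmas \<open>dZ'\<close>, \<open>dH1\<close>, \<open>dH2\<close>, \<open>Hl_II\<close>).

  Now compare mixed second derivatives. With $d\omega=0$ (flatness) the equation for $H_1$ gives
  $\beta-2\bar\beta=pq$. Since $pq|\beta|^2$ is real, the left side is real, which forces
  $\beta=-1$: the surface is Lagrangian, and $pq=1$ (\<open>beta_eq\<close>, \<open>p_q\<close>). The remaining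
  equations say $dp=3p\,\omega$. Hence replacing $e_1,e_2$ by $\lambda e_1,\lambda^{-1}e_2$ with the
  real cube root $\lambda$ that turns $p$ into $i$ also makes the frame parallel, and the
  system has constant coefficients. It is diagonalised by the three cube roots $\mu$ of $i$: each
  $W_\mu=Z+\lambda\mu^{-1}H_1+\mu\lambda^{-1}H_2$ satisfies $dW_\mu=\sigma_\mu W_\mu$ with a scalar
  form $\sigma_\mu$, so it is a scalar function $w_\mu$ times a constant vector. As the three roots
  sum to $0$, as do their inverses, $3Z=\sum_\mu W_\mu$. The logarithm of a quotient of two of the
  $w_\mu$ provides flat null coordinates, the constant Gram matrix of the $W_\mu$ determines the third
  function from it, and $Z$ becomes a unitary image of a multiple of \<open>L_tilde 1\<close> in these coordinates
  (\<open>normal_form\<close>). The value $a=1$ suffices because $(x,y)\mapsto(ax,y/a)$ absorbs the parameter.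

  The isometry found this way depends on the point. In the coordinates $P=z_3+z_1$, $Q=z_3-z_1$, $R=z_2$
  the model surface is contained in $P\bar Q=2R\bar R$. If two local normal forms overlap, the isometry
  relating them maps an open piece of the model into this surface; comparing coefficients of an
  exponential polynomial shows that it is diagonal in these coordinates, or exchanges
  $P$ and $Q$, and such an isometry acts on the whole model by an affine change of parameters
  (\<open>model_stabilizer\<close>). So the sets of points at which a given isometry works are open and pairwise
  equal or disjoint, and connectedness leaves only one of them (\<open>has_model_chart_global\<close>).\<close>

section \<open>Calculus of smooth maps\<close>

abbreviation dd :: "('a::real_normed_vector \<Rightarrow> 'b::real_normed_vector) \<Rightarrow> 'a \<Rightarrow> 'a \<Rightarrow> 'b" where
  "dd F x \<equiv> frechet_derivative F (at x)"

lemma frechet_derivative_eqI: "(f has_derivative f') (at x) \<Longrightarrow> dd f x = f'"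
  using frechet_derivative_at by metis

lemma frechet_derivative_cong_open:
  assumes "open S" "x \<in> S" "\<And>y. y \<in> S \<Longrightarrow> f y = g y"
  shows "dd f x = dd g x"
proof -
  have "(f has_derivative D) (at x) \<longleftrightarrow> (g has_derivative D) (at x)" for D
    using has_derivative_transform_within_open[of _ D x UNIV S] assms by metis
  then show ?thesis unfolding frechet_derivative_def by simp
qed

lemma differentiable_cong_open:
  assumes "open S" "x \<in> S" "\<And>y. y \<in> S \<Longrightarrow> f y = g y" "f differentiable (at x)"
  shows "g differentiable (at x)"
  using has_derivative_transform_within_open[of f _ x UNIV S g] assms unfolding differentiable_def by metis

lemma C_k_on_cong:
  assumes "open S" "\<And>x. x \<in> S \<Longrightarrow> f x = g x" "C_k_on k S f"
  shows "C_k_on k S g"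
  using assms(2,3)
proof (induction k arbitrary: f g)
  case 0
  then show ?case by (auto cong: continuous_on_cong)
next
  case (Suc k)
  show ?case unfolding C_k_on.simps
  proof (intro conjI ballI allI)
    fix x assume "x \<in> S"
    then show "g differentiable (at x)"
      using Suc.prems differentiable_cong_open[OF assms(1) \<open>x \<in> S\<close>, of f g] by simp
  next
    fix v
    have "C_k_on k S (\<lambda>x. dd f x v)" using Suc.prems by simp
    then show "C_k_on k S (\<lambda>x. dd g x v)"
      by (rule Suc.IH[rotated]) (simp add: frechet_derivative_cong_open[OF assms(1) _ Suc.prems(1)])
  qed
qed

lemma C_k_on_SucI:
  assumes "open S" "\<And>x. x \<in> S \<Longrightarrow> (f has_derivative f' x) (at x)"
    "\<And>v. C_k_on k S (\<lambda>x. f' x v)"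
  shows "C_k_on (Suc k) S f"
  unfolding C_k_on.simps
proof (intro conjI ballI allI)
  fix x assume "x \<in> S" then show "f differentiable (at x)" using assms(2) differentiable_def by blast
next
  fix v show "C_k_on k S (\<lambda>x. dd f x v)"
    by (rule C_k_on_cong[OF assms(1) _ assms(3)[of v]]) (simp add: frechet_derivative_eqI[OF assms(2)])
qed

lemma C_k_on_Suc_has_derivative:
  "C_k_on (Suc k) S f \<Longrightarrow> x \<in> S \<Longrightarrow> (f has_derivative dd f x) (at x)"
  using frechet_derivative_works by auto

lemma C_k_on_SucD: "C_k_on (Suc k) S f \<Longrightarrow> C_k_on k S f"
proof (induction k arbitrary: f)
  case 0
  then show ?case
    by (auto intro!: continuous_at_imp_continuous_on differentiable_imp_continuous_within)
next
  case (Suc k)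
  then show ?case by simp
qed

lemma C_k_on_subset: "C_k_on k S f \<Longrightarrow> T \<subseteq> S \<Longrightarrow> C_k_on k T f"
  by (induction k arbitrary: f) (auto intro: continuous_on_subset)

lemma C_k_on_const: "open S \<Longrightarrow> C_k_on k S (\<lambda>x. c)"
proof (induction k arbitrary: c)
  case (Suc k) then show ?case by (auto intro!: C_k_on_SucI derivative_eq_intros)
qed auto

lemma C_k_on_bounded_linear_compose:
  assumes "bounded_linear l"
  shows "open S \<Longrightarrow> C_k_on k S f \<Longrightarrow> C_k_on k S (\<lambda>x. l (f x))"
proof (induction k arbitrary: f)
  case 0 then show ?case by (auto intro: bounded_linear.continuous_on[OF assms])
next
  case (Suc k)
  show ?case
  proof (rule C_k_on_SucI[OF Suc.prems(1)])
    fix x assume "x \<in> S"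
    then show "((\<lambda>x. l (f x)) has_derivative (\<lambda>v. l (dd f x v))) (at x)"
      using C_k_on_Suc_has_derivative[OF Suc.prems(2)] bounded_linear.has_derivative[OF assms] by blast
  qed (use Suc in auto)
qed

lemma C_k_on_bounded_linear:
  assumes "bounded_linear l" "open S" shows "C_k_on k S l"
proof (cases k)
  case 0 then show ?thesis using assms by (auto intro: linear_continuous_on)
next
  case (Suc m)
  show ?thesis unfolding Suc
    by (rule C_k_on_SucI[OF assms(2), of l "\<lambda>_. l" m])
      (auto intro: bounded_linear_imp_has_derivative C_k_on_const assms)
qed

lemma C_k_on_add:
  assumes "open S" shows "C_k_on k S f \<Longrightarrow> C_k_on k S g \<Longrightarrow> C_k_on k S (\<lambda>x. f x + g x)"
proof (induction k arbitrary: f g)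
  case 0 then show ?case by (auto intro: continuous_intros)
next
  case (Suc k)
  have "((\<lambda>x. f x + g x) has_derivative (\<lambda>v. dd f x v + dd g x v)) (at x)"
    if "x \<in> S" for x
    by (intro has_derivative_add C_k_on_Suc_has_derivative[OF Suc.prems(1) that] C_k_on_Suc_has_derivative[OF Suc.prems(2) that])
  then show ?case
    by (rule C_k_on_SucI[OF assms]) (use Suc in simp_all)
qed

lemma C_k_on_sum:
  assumes "open S" shows "finite I \<Longrightarrow> (\<And>i. i \<in> I \<Longrightarrow> C_k_on k S (f i)) \<Longrightarrow> C_k_on k S (\<lambda>x. \<Sum>i\<in>I. f i x)"
  by (induction I rule: finite_induct) (auto intro!: C_k_on_add C_k_on_const assms)

lemma C_k_on_bilinear:
  assumes "bounded_bilinear B" "open S"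
  shows "C_k_on k S f \<Longrightarrow> C_k_on k S g \<Longrightarrow> C_k_on k S (\<lambda>x. B (f x) (g x))"
proof (induction k arbitrary: f g)
  case 0 then show ?case by (auto intro: bounded_bilinear.continuous_on[OF assms(1)])
next
  case (Suc k)
  show ?case
  proof (rule C_k_on_SucI[OF assms(2)])
    fix x assume "x \<in> S"
    then show "((\<lambda>x. B (f x) (g x)) has_derivative
        (\<lambda>v. B (f x) (dd g x v) + B (dd f x v) (g x))) (at x)"
      by (intro bounded_bilinear.FDERIV[OF assms(1)] C_k_on_Suc_has_derivative[OF Suc.prems(1)] C_k_on_Suc_has_derivative[OF Suc.prems(2)])
  next
    fix v
    have "C_k_on k S (\<lambda>x. dd f x v)" "C_k_on k S (\<lambda>x. dd g x v)"
      using Suc.prems by simp_all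
    then show "C_k_on k S (\<lambda>x. B (f x) (dd g x v) + B (dd f x v) (g x))"
      by (intro C_k_on_add[OF assms(2)] Suc.IH C_k_on_SucD[OF Suc.prems(1)] C_k_on_SucD[OF Suc.prems(2)])
  qed
qed

text \<open>The derivative $g'(f(x))(f'(x)v)$ must be split into maps of the form
  "differentiable function of $f(x)$ times function of $x$" for the induction to apply, which is why $f$ takes values
  in a Euclidean space: expand $f'(x)v$ in its basis.\<close>

lemma C_k_on_compose:
  fixes f :: "'a::real_normed_vector \<Rightarrow> 'b::euclidean_space" and g :: "'b \<Rightarrow> 'c::real_normed_vector"
  assumes "open S" "f ` S \<subseteq> T"
  shows "C_k_on k S f \<Longrightarrow> C_k_on k T g \<Longrightarrow> C_k_on k S (\<lambda>x. g (f x))"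
proof (induction k arbitrary: g)
  case 0 then show ?case using assms by (auto intro: continuous_on_compose2)
next
  case (Suc k)
  let ?f = "\<lambda>x. dd f x" and ?g = "\<lambda>x. dd g x"
  show ?case
  proof (rule C_k_on_SucI[OF assms(1), where f' = "\<lambda>x v. \<Sum>b\<in>Basis. (?f x v \<bullet> b) *\<^sub>R ?g (f x) b"])
    fix x assume x: "x \<in> S"
    have g: "(g has_derivative ?g (f x)) (at (f x))"
      using C_k_on_Suc_has_derivative[OF Suc.prems(2)] x assms by blast
    have "((\<lambda>x. g (f x)) has_derivative (\<lambda>v. ?g (f x) (?f x v))) (at x)"
      using has_derivative_compose[OF C_k_on_Suc_has_derivative[OF Suc.prems(1) x] g] .
    moreover have eq: "?g (f x) w = (\<Sum>b\<in>Basis. (w \<bullet> b) *\<^sub>R ?g (f x) b)" for w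
    proof -
      have "?g (f x) w = ?g (f x) (\<Sum>b\<in>Basis. (w \<bullet> b) *\<^sub>R b)" by (simp add: euclidean_representation)
      then show ?thesis
        by (simp only: linear_sum[OF has_derivative_linear[OF g]] linear_cmul[OF has_derivative_linear[OF g]])
    qed
    ultimately show "((\<lambda>x. g (f x)) has_derivative (\<lambda>v. \<Sum>b\<in>Basis. (?f x v \<bullet> b) *\<^sub>R ?g (f x) b)) (at x)"
      unfolding eq[symmetric] by simp
  next
    fix v
    have 1: "C_k_on k S (\<lambda>x. ?f x v)" "C_k_on k S f" and 2: "\<And>w. C_k_on k T (\<lambda>x. ?g x w)"
      using Suc.prems C_k_on_SucD[OF Suc.prems(1)] by simp_all
    show "C_k_on k S (\<lambda>x. \<Sum>b\<in>Basis. (?f x v \<bullet> b) *\<^sub>R ?g (f x) b)"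
      by (intro C_k_on_sum C_k_on_bilinear[OF bounded_bilinear_scaleR] assms finite_Basis
          C_k_on_bounded_linear_compose[OF bounded_linear_inner_left] 1 Suc.IH 2)
  qed
qed

lemma C_k_on_inverse:
  fixes f :: "'a::real_normed_vector \<Rightarrow> 'b::real_normed_field"
  assumes "open S" "\<And>x. x \<in> S \<Longrightarrow> f x \<noteq> 0"
  shows "C_k_on k S f \<Longrightarrow> C_k_on k S (\<lambda>x. inverse (f x))"
proof (induction k)
  case 0 then show ?case using assms by (auto intro: continuous_intros)
next
  case (Suc k)
  note mult = C_k_on_bilinear[OF bounded_bilinear_mult assms(1)]
  have "C_k_on k S f" "\<And>v. C_k_on k S (\<lambda>x. dd f x v)"
    using C_k_on_SucD[OF Suc.prems] Suc.prems by simp_all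
  moreover have "C_k_on k S (\<lambda>x. inverse (f x))" using Suc.IH[OF C_k_on_SucD[OF Suc.prems]] .
  ultimately have "C_k_on k S (\<lambda>x. - (inverse (f x) * dd f x v * inverse (f x)))" for v
    by (intro C_k_on_bounded_linear_compose[OF bounded_linear_minus[OF bounded_linear_ident] assms(1)] mult)
  moreover have "((\<lambda>x. inverse (f x)) has_derivative
      (\<lambda>v. - (inverse (f x) * dd f x v * inverse (f x)))) (at x)" if "x \<in> S" for x
    by (intro Deriv.has_derivative_inverse assms(2) C_k_on_Suc_has_derivative[OF Suc.prems] that)
  ultimately show ?case by (intro C_k_on_SucI[OF assms(1)])
qed

lemma C_k_on_powr: "C_k_on k {0<..} (\<lambda>x::real. c * x powr a)"
proof (induction k arbitrary: c a)
  case 0 then show ?case by (auto intro!: continuous_intros)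
next
  case (Suc k)
  show ?case
  proof (rule C_k_on_SucI[where f' = "\<lambda>x v. (v * c * a) * x powr (a - 1)"])
    fix x::real assume "x \<in> {0<..}"
    then have "((\<lambda>x. c * x powr a) has_real_derivative (c * a) * x powr (a - 1)) (at x)"
      by (auto intro!: derivative_eq_intros)
    then show "((\<lambda>x. c * x powr a) has_derivative (\<lambda>v. (v * c * a) * x powr (a - 1))) (at x)"
      unfolding has_field_derivative_def by (rule has_derivative_eq_rhs) (auto simp: mult_ac)
  qed (use Suc in auto)
qed

lemma smooth_on_C_k: "smooth_on S f \<Longrightarrow> C_k_on k S f"
  by (simp add: smooth_on_def)

lemma smooth_on_has_derivative:
  "smooth_on S f \<Longrightarrow> x \<in> S \<Longrightarrow> (f has_derivative dd f x) (at x)"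
  using C_k_on_Suc_has_derivative smooth_on_C_k by blast

lemma smooth_on_frechet_derivative: "smooth_on S f \<Longrightarrow> smooth_on S (\<lambda>x. dd f x v)"
  unfolding smooth_on_def
proof
  fix k assume "\<forall>k. C_k_on k S f"
  then have "C_k_on (Suc k) S f" ..
  then show "C_k_on k S (\<lambda>x. dd f x v)" by simp
qed

lemma smooth_on_continuous_on: "smooth_on S f \<Longrightarrow> continuous_on S f"
  using smooth_on_C_k C_k_on.simps(1) by blast

text \<open>Smoothness from a formula for the derivative: this is how smoothness of functions that are only given by
  a differential equation is obtained.\<close>

lemma smooth_onI_derivative:
  assumes "open S" "\<And>x. x \<in> S \<Longrightarrow> (f has_derivative f' x) (at x)" "\<And>v. smooth_on S (\<lambda>x. f' x v)"
  shows "smooth_on S f"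
  unfolding smooth_on_def
proof
  fix k show "C_k_on k S f"
    by (rule C_k_on_SucD, rule C_k_on_SucI[OF assms(1,2)], assumption, rule smooth_on_C_k[OF assms(3)])
qed

lemma smooth_on_cong: "open S \<Longrightarrow> (\<And>x. x \<in> S \<Longrightarrow> f x = g x) \<Longrightarrow> smooth_on S f \<Longrightarrow> smooth_on S g"
  unfolding smooth_on_def using C_k_on_cong by blast

lemma smooth_on_subset: "smooth_on S f \<Longrightarrow> T \<subseteq> S \<Longrightarrow> smooth_on T f"
  unfolding smooth_on_def using C_k_on_subset by blast

lemma smooth_on_bounded_linear_compose:
  "bounded_linear l \<Longrightarrow> open S \<Longrightarrow> smooth_on S f \<Longrightarrow> smooth_on S (\<lambda>x. l (f x))"
  unfolding smooth_on_def using C_k_on_bounded_linear_compose by blast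

lemma smooth_on_bounded_linear: "bounded_linear l \<Longrightarrow> open S \<Longrightarrow> smooth_on S l"
  unfolding smooth_on_def using C_k_on_bounded_linear by blast

lemma smooth_on_const: "open S \<Longrightarrow> smooth_on S (\<lambda>x. c)"
  unfolding smooth_on_def using C_k_on_const by blast

lemma smooth_on_add: "open S \<Longrightarrow> smooth_on S f \<Longrightarrow> smooth_on S g \<Longrightarrow> smooth_on S (\<lambda>x. f x + g x)"
  unfolding smooth_on_def using C_k_on_add by blast

lemma smooth_on_minus: "open S \<Longrightarrow> smooth_on S f \<Longrightarrow> smooth_on S (\<lambda>x. - f x)"
  by (rule smooth_on_bounded_linear_compose[OF bounded_linear_minus[OF bounded_linear_ident]])

lemma smooth_on_diff: "open S \<Longrightarrow> smooth_on S f \<Longrightarrow> smooth_on S g \<Longrightarrow> smooth_on S (\<lambda>x. f x - g x)"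
  using smooth_on_add[of S f "\<lambda>x. - g x"] smooth_on_minus[of S g] by simp

lemma smooth_on_sum:
  "open S \<Longrightarrow> finite I \<Longrightarrow> (\<And>i. i \<in> I \<Longrightarrow> smooth_on S (f i)) \<Longrightarrow> smooth_on S (\<lambda>x. \<Sum>i\<in>I. f i x)"
  unfolding smooth_on_def using C_k_on_sum by blast

lemma smooth_on_bilinear:
  "bounded_bilinear B \<Longrightarrow> open S \<Longrightarrow> smooth_on S f \<Longrightarrow> smooth_on S g \<Longrightarrow> smooth_on S (\<lambda>x. B (f x) (g x))"
  unfolding smooth_on_def using C_k_on_bilinear by blast

lemmas smooth_on_mult = smooth_on_bilinear[OF bounded_bilinear_mult]
lemmas smooth_on_scaleR = smooth_on_bilinear[OF bounded_bilinear_scaleR]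

lemma smooth_on_compose:
  fixes f :: "'a::real_normed_vector \<Rightarrow> 'b::euclidean_space" and g :: "'b \<Rightarrow> 'c::real_normed_vector"
  assumes "open S" "f ` S \<subseteq> T" "smooth_on S f" "smooth_on T g"
  shows "smooth_on S (\<lambda>x. g (f x))"
  using assms C_k_on_compose unfolding smooth_on_def by blast

lemma smooth_on_inverse:
  fixes f :: "'a::real_normed_vector \<Rightarrow> 'b::real_normed_field"
  shows "open S \<Longrightarrow> (\<And>x. x \<in> S \<Longrightarrow> f x \<noteq> 0) \<Longrightarrow> smooth_on S f \<Longrightarrow> smooth_on S (\<lambda>x. inverse (f x))"
  unfolding smooth_on_def using C_k_on_inverse by blast

lemma smooth_on_divide:
  fixes f :: "'a::real_normed_vector \<Rightarrow> 'b::real_normed_field"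
  shows "open S \<Longrightarrow> (\<And>x. x \<in> S \<Longrightarrow> g x \<noteq> 0) \<Longrightarrow> smooth_on S f \<Longrightarrow> smooth_on S g \<Longrightarrow> smooth_on S (\<lambda>x. f x / g x)"
  unfolding divide_inverse by (intro smooth_on_mult smooth_on_inverse)

lemma smooth_on_powr:
  fixes f :: "'a::real_normed_vector \<Rightarrow> real"
  assumes "open S" "\<And>x. x \<in> S \<Longrightarrow> 0 < f x" "smooth_on S f"
  shows "smooth_on S (\<lambda>x. f x powr a)"
proof -
  have "smooth_on {0<..} (\<lambda>x::real. x powr a)" 
    using C_k_on_powr[of _ 1 a] unfolding smooth_on_def by simp
  then show ?thesis using assms by (auto intro: smooth_on_compose[of S f "{0<..}" "\<lambda>x. x powr a"])
qed

text \<open>The second difference is symmetric in $u$ and $v$, and two applications of the mean value theorem turn it into a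
  mixed second derivative at a nearby point. Doing this in both orders and letting $t\to0$ proves
  the symmetry of mixed second derivatives.\<close>

lemma second_difference_mvt:
  fixes f :: "'a::real_normed_vector \<Rightarrow> real"
  assumes S: "ball x r \<subseteq> S" and f: "C_k_on 2 S f" and t: "0 < t" "t * norm u + t * norm v < r"
  shows "\<exists>p\<in>ball x r. f (x + t *\<^sub>R u + t *\<^sub>R v) - f (x + t *\<^sub>R u) - f (x + t *\<^sub>R v) + f x
     = t * t * frechet_derivative (\<lambda>y. dd f y u) (at p) v"
proof -
  have inb: "x + s *\<^sub>R u + s' *\<^sub>R v \<in> ball x r" if "0 \<le> s" "s \<le> t" "0 \<le> s'" "s' \<le> t" for s s'
  proof -
    have "norm (s *\<^sub>R u + s' *\<^sub>R v) \<le> s * norm u + s' * norm v"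
      using norm_triangle_ineq[of "s *\<^sub>R u" "s' *\<^sub>R v"] that by simp
    also have "\<dots> \<le> t * norm u + t * norm v"
      using that by (intro add_mono mult_right_mono) auto
    finally have "norm (s *\<^sub>R u + s' *\<^sub>R v) < r" using t(2) by simp
    moreover have "dist x (x + s *\<^sub>R u + s' *\<^sub>R v) = norm (s *\<^sub>R u + s' *\<^sub>R v)"
      by (metis add.assoc add_diff_cancel_left' dist_norm dist_commute)
    ultimately show ?thesis by simp
  qed
  have f2: "C_k_on (Suc (Suc 0)) S f" using f by (simp add: numeral_2_eq_2)
  have df: "(f has_derivative dd f y) (at y)" if "y \<in> S" for y
    using C_k_on_Suc_has_derivative[OF f2 that] .
  let ?g = "\<lambda>y. dd f y u"
  have dg: "(?g has_derivative dd ?g y) (at y)" if "y \<in> S" for y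
  proof -
    have "C_k_on (Suc 0) S ?g" using f2 by simp
    from C_k_on_Suc_has_derivative[OF this that] show ?thesis .
  qed
  have lin: "dd f y (s *\<^sub>R w) = s * dd f y w" if "y \<in> S" for y s w
    using linear_cmul[OF has_derivative_linear[OF df[OF that]]] by simp
  have ling: "dd ?g y (s *\<^sub>R w) = s * dd ?g y w" if "y \<in> S" for y s w
    using linear_cmul[OF has_derivative_linear[OF dg[OF that]]] by simp
  define \<phi> where "\<phi> s = f (x + s *\<^sub>R u + t *\<^sub>R v) - f (x + s *\<^sub>R u)" for s
  have "DERIV \<phi> s :> ?g (x + s *\<^sub>R u + t *\<^sub>R v) - ?g (x + s *\<^sub>R u)" if "0 \<le> s" "s \<le> t" for s
  proof -
    have m: "x + s *\<^sub>R u + t *\<^sub>R v \<in> S" "x + s *\<^sub>R u \<in> S"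
      using inb[of s t] inb[of s 0] that S t(1) by auto
    have "((\<lambda>s. f (x + s *\<^sub>R u + t *\<^sub>R v)) has_derivative (\<lambda>h. frechet_derivative f (at (x + s *\<^sub>R u + t *\<^sub>R v)) (h *\<^sub>R u))) (at s)"
      by (rule has_derivative_compose[where f="\<lambda>s. x + s *\<^sub>R u + t *\<^sub>R v" and x=s, OF _ df[OF m(1)]]) (auto intro!: derivative_eq_intros)
    moreover have "((\<lambda>s. f (x + s *\<^sub>R u)) has_derivative (\<lambda>h. frechet_derivative f (at (x + s *\<^sub>R u)) (h *\<^sub>R u))) (at s)"
      by (rule has_derivative_compose[where f="\<lambda>s. x + s *\<^sub>R u" and x=s, OF _ df[OF m(2)]]) (auto intro!: derivative_eq_intros)
    ultimately have "(\<phi> has_derivative (\<lambda>h. h * (?g (x + s *\<^sub>R u + t *\<^sub>R v)) - h * (?g (x + s *\<^sub>R u)))) (at s)"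
      unfolding \<phi>_def by (simp only: lin[OF m(1)] lin[OF m(2)] has_derivative_diff)
    then show ?thesis unfolding has_field_derivative_def
      by (rule has_derivative_eq_rhs) (auto simp: algebra_simps)
  qed
  from MVT2[OF t(1) this] obtain \<sigma> where \<sigma>: "0 < \<sigma>" "\<sigma> < t"
    "\<phi> t - \<phi> 0 = t * (?g (x + \<sigma> *\<^sub>R u + t *\<^sub>R v) - ?g (x + \<sigma> *\<^sub>R u))" by auto
  have "DERIV (\<lambda>s. ?g (x + \<sigma> *\<^sub>R u + s *\<^sub>R v)) s :> frechet_derivative ?g (at (x + \<sigma> *\<^sub>R u + s *\<^sub>R v)) v"
    if "0 \<le> s" "s \<le> t" for s
  proof -
    have m: "x + \<sigma> *\<^sub>R u + s *\<^sub>R v \<in> S" using inb[of \<sigma> s] that S \<sigma> by auto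
    have "((\<lambda>s. ?g (x + \<sigma> *\<^sub>R u + s *\<^sub>R v)) has_derivative (\<lambda>h. frechet_derivative ?g (at (x + \<sigma> *\<^sub>R u + s *\<^sub>R v)) (h *\<^sub>R v))) (at s)"
      by (rule has_derivative_compose[where f="\<lambda>s. x + \<sigma> *\<^sub>R u + s *\<^sub>R v" and x=s, OF _ dg[OF m]]) (auto intro!: derivative_eq_intros)
    then show ?thesis unfolding has_field_derivative_def
      by (rule has_derivative_eq_rhs) (auto simp: ling[OF m])
  qed
  from MVT2[OF t(1) this] obtain \<tau> where \<tau>: "0 < \<tau>" "\<tau> < t"
    "?g (x + \<sigma> *\<^sub>R u + t *\<^sub>R v) - ?g (x + \<sigma> *\<^sub>R u) = t * frechet_derivative ?g (at (x + \<sigma> *\<^sub>R u + \<tau> *\<^sub>R v)) v"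
    by auto
  have "x + \<sigma> *\<^sub>R u + \<tau> *\<^sub>R v \<in> ball x r" using inb \<sigma> \<tau> by simp
  moreover have "f (x + t *\<^sub>R u + t *\<^sub>R v) - f (x + t *\<^sub>R u) - f (x + t *\<^sub>R v) + f x = \<phi> t - \<phi> 0"
    unfolding \<phi>_def by simp
  ultimately show ?thesis using \<sigma>(3) \<tau>(3) by (intro bexI) simp_all
qed

lemma symmetric_second_derivative_real:
  fixes f :: "'a::real_normed_vector \<Rightarrow> real"
  assumes S: "open S" "x \<in> S" and f: "C_k_on 2 S f"
  shows "frechet_derivative (\<lambda>y. dd f y v) (at x) u
       = frechet_derivative (\<lambda>y. dd f y u) (at x) v" (is "?A x = ?B x")
proof (rule ccontr)
  assume neq: "?A x \<noteq> ?B x"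
  define e where "e = \<bar>?A x - ?B x\<bar> / 2"
  have e: "e > 0" using neq by (simp add: e_def)
  have "continuous_on S ?A" "continuous_on S ?B" using f by (simp_all add: numeral_2_eq_2)
  then have "continuous (at x) ?A" "continuous (at x) ?B"
    using S continuous_on_eq_continuous_at by blast+
  note c = this[unfolded continuous_at_eps_delta, THEN spec, THEN mp, OF e]
  obtain d1 where d1: "d1 > 0" "\<And>y. dist y x < d1 \<Longrightarrow> dist (?A y) (?A x) < e"
    using c(1) by blast
  obtain d2 where d2: "d2 > 0" "\<And>y. dist y x < d2 \<Longrightarrow> dist (?B y) (?B x) < e"
    using c(2) by blast
  note d = d1 d2
  obtain d3 where d3: "d3 > 0" "ball x d3 \<subseteq> S" using S open_contains_ball by blast
  define r where "r = min d1 (min d2 d3)"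
  have r: "r > 0" "ball x r \<subseteq> S" using d d3 by (auto simp: r_def)
  define t where "t = r / (2 * (norm u + norm v + 1))"
  have t0: "t > 0" unfolding t_def using r by (simp add: add_nonneg_pos)
  have "t * (norm u + norm v + 1) = r / 2" unfolding t_def 
    by (simp add: field_simps add_nonneg_eq_0_iff) 
  then have t1: "t * norm u + t * norm v < r" using t0 r by (simp add: distrib_left)
  then have t2: "t * norm v + t * norm u < r" by simp
  obtain p where p: "p \<in> ball x r" "f (x + t *\<^sub>R u + t *\<^sub>R v) - f (x + t *\<^sub>R u) - f (x + t *\<^sub>R v) + f x = t * t * ?B p"
    using second_difference_mvt[OF r(2) f t0 t1] by blast
  obtain q where q: "q \<in> ball x r" "f (x + t *\<^sub>R v + t *\<^sub>R u) - f (x + t *\<^sub>R v) - f (x + t *\<^sub>R u) + f x = t * t * ?A q"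
    using second_difference_mvt[OF r(2) f t0 t2] by blast
  have comm: "x + t *\<^sub>R v + t *\<^sub>R u = x + t *\<^sub>R u + t *\<^sub>R v" by simp
  have "t * t * ?B p = t * t * ?A q"
    using p(2) q(2) unfolding comm by linarith
  then have "?B p = ?A q" using t0 by simp
  moreover have "dist (?A q) (?A x) < e" "dist (?B p) (?B x) < e"
    using d p(1) q(1) by (auto simp: r_def dist_commute)
  ultimately show False unfolding e_def dist_real_def by (simp add: abs_if split: if_splits)
qed

lemma symmetric_second_derivative:
  fixes f :: "'a::real_normed_vector \<Rightarrow> 'b::euclidean_space"
  assumes S: "open S" "x \<in> S" and f: "smooth_on S f"
  shows "frechet_derivative (\<lambda>y. dd f y v) (at x) u
       = frechet_derivative (\<lambda>y. dd f y u) (at x) v"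
proof (rule euclidean_eqI)
  fix b :: 'b assume "b \<in> Basis"
  have comp: "frechet_derivative (\<lambda>y. g y \<bullet> b) (at y) w = dd g y w \<bullet> b"
    if "smooth_on S g" "y \<in> S" for g :: "'a \<Rightarrow> 'b" and y w
    using frechet_derivative_eqI[OF has_derivative_inner_left[OF smooth_on_has_derivative[OF that]]]
    by metis
  have 2: "frechet_derivative (\<lambda>y. frechet_derivative (\<lambda>y. f y \<bullet> b) (at y) w) (at x) w'
     = frechet_derivative (\<lambda>y. dd f y w) (at x) w' \<bullet> b" for w w'
  proof -
    have "frechet_derivative (\<lambda>y. frechet_derivative (\<lambda>y. f y \<bullet> b) (at y) w) (at x)
      = frechet_derivative (\<lambda>y. dd f y w \<bullet> b) (at x)"
      by (rule frechet_derivative_cong_open[OF S]) (simp add: comp f)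
    then show ?thesis using comp[OF smooth_on_frechet_derivative[OF f] S(2)] by simp
  qed
  have "C_k_on 2 S (\<lambda>y. f y \<bullet> b)"
    by (intro smooth_on_C_k smooth_on_bounded_linear_compose[OF bounded_linear_inner_left] S f)
  from symmetric_second_derivative_real[OF S this, of v u]
  show "frechet_derivative (\<lambda>y. dd f y v) (at x) u \<bullet> b
       = frechet_derivative (\<lambda>y. dd f y u) (at x) v \<bullet> b"
    unfolding 2 .
qed

text \<open>The hypothesis supplies the pointwise inverse $K$ of the derivative as a smooth
  field. In the application $K$ is an explicit frame, and with it smoothness of
  the inverse $g$ follows from $g'(y)w=K(g(y))w$ by induction on the order of differentiability,
  without any analysis of matrix inversion.\<close>

lemma smooth_inverse_function:
  fixes f :: "'a::euclidean_space \<Rightarrow> 'a"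
  assumes U: "open U" "x0 \<in> U" and f: "smooth_on U f"
    and K: "\<And>w. smooth_on U (\<lambda>x. K x w)" "\<And>x w. x \<in> U \<Longrightarrow> dd f x (K x w) = w"
  obtains U' V g where "open U'" "U' \<subseteq> U" "x0 \<in> U'" "open V" "homeomorphism U' V f g" "smooth_on V g"
proof -
  let ?F = "\<lambda>x. dd f x"
  have blF: "bounded_linear (?F x)" if "x \<in> U" for x
    using smooth_on_has_derivative[OF f that] has_derivative_bounded_linear by blast
  define F' where "F' x = Blinfun (?F x)" for x
  have F': "blinfun_apply (F' x) = ?F x" if "x \<in> U" for x
    unfolding F'_def using bounded_linear_Blinfun_apply[OF blF[OF that]] .
  have surjF: "surj (?F x)" if "x \<in> U" for x using K(2)[OF that] by (metis surjI)
  then have injF: "inj (?F x)" if "x \<in> U" for x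
    using linear_surjective_imp_injective blF that bounded_linear.linear by blast
  have cont: "continuous_on U F'"
  proof (rule continuous_on_blinfun_componentwise)
    fix i :: 'a
    have "continuous_on U (\<lambda>x. ?F x i)"
      by (intro smooth_on_continuous_on smooth_on_frechet_derivative f)
    then show "continuous_on U (\<lambda>x. blinfun_apply (F' x) i)"
      using F' by (simp cong: continuous_on_cong)
  qed
  obtain h where h: "linear h" "h \<circ> ?F x0 = id"
    using linear_injective_left_inverse[OF bounded_linear.linear[OF blF[OF U(2)]] injF[OF U(2)]] by blast
  have "Blinfun h o\<^sub>L F' x0 = id_blinfun"
  proof (rule blinfun_eqI)
    fix i
    have "blinfun_apply (Blinfun h) = h"
      using h(1) linear_conv_bounded_linear bounded_linear_Blinfun_apply by blast
    then show "blinfun_apply (Blinfun h o\<^sub>L F' x0) i = blinfun_apply id_blinfun i"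
      using fun_cong[OF h(2), of i] F'[OF U(2)] by simp
  qed
  then obtain U' V g g' where g: "open U'" "U' \<subseteq> U" "x0 \<in> U'" "open V" "homeomorphism U' V f g"
    "\<And>y. y \<in> V \<Longrightarrow> (g has_derivative (g' y)) (at y)"
    "\<And>y. y \<in> V \<Longrightarrow> g' y = inv (blinfun_apply (F' (g y)))"
    using inverse_function_theorem[OF U(1) _ cont U(2)] F' smooth_on_has_derivative[OF f] by metis
  have gV: "g y \<in> U" if "y \<in> V" for y using g(2,5) that unfolding homeomorphism_def by blast
  have g'K: "g' y w = K (g y) w" if "y \<in> V" for y w
    unfolding g(7)[OF that] F'[OF gV[OF that]]
    using inv_f_eq[OF injF[OF gV[OF that]] K(2)[OF gV[OF that]]] .
  have "C_k_on k V g" for k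
  proof (induction k)
    case 0 show ?case using g(5) by (simp add: homeomorphism_def)
  next
    case (Suc k)
    show ?case
    proof (rule C_k_on_SucI[OF g(4,6)])
      fix w
      have "C_k_on k V (\<lambda>y. K (g y) w)"
        by (rule C_k_on_compose[OF g(4) _ Suc smooth_on_C_k[OF K(1)]]) (use gV in auto)
      then show "C_k_on k V (\<lambda>y. g' y w)"
        by (rule C_k_on_cong[OF g(4), rotated]) (simp add: g'K)
    qed
  qed
  then show ?thesis using that g(1-5) by (simp add: smooth_on_def)
qed

section \<open>Affine charts of the projective plane and the Fubini-Study form\<close>

lemma b_form_simps [simp]:
  "b_form (x + y) z = b_form x z + b_form y z"
  "b_form x (y + z) = b_form x y + b_form x z"
  "b_form (x - y) z = b_form x z - b_form y z"
  "b_form x (y - z) = b_form x y - b_form x z"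
  "b_form (- x) z = - b_form x z"
  "b_form x (- z) = - b_form x z"
  "b_form (c *s x) z = cnj c * b_form x z"
  "b_form x (c *s z) = c * b_form x z"
  "b_form 0 z = 0" "b_form x 0 = 0"
  by (simp_all add: b_form_def algebra_simps)

lemma b_form_cnj: "cnj (b_form x y) = b_form y x"
  by (simp add: b_form_def algebra_simps)

lemma Im_b_form_self [simp]: "Im (b_form z z) = 0"
  by (simp add: b_form_def)

lemma b_form_self: "b_form z z = of_real (Re (b_form z z))"
  by (simp add: complex_eq_iff)

lemma b_form_eq_0: assumes "\<And>w. b_form d w = 0" shows "d = 0"
  using assms[of "axis 1 1"] assms[of "axis 2 1"] assms[of "axis 3 1"]
  by (auto simp: b_form_def vec_eq_iff forall_3 axis_def)

lemma scaleR_eq_smult: "r *\<^sub>R (z::complex^'n) = of_real r *s z"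
  by (simp add: vec_eq_iff scaleR_conv_of_real[symmetric])

lemma bounded_bilinear_b_form: "bounded_bilinear b_form"
proof -
  have 1: "b_form z w = (- cnj (z$1)) * w$1 + cnj (z$2) * w$2 + cnj (z$3) * w$3" for z w
    by (simp add: b_form_def)
  have "norm (b_form z w) \<le> norm z * norm w * 3" for z w
  proof -
    have "norm (b_form z w) \<le> norm (z$1) * norm (w$1) + norm (z$2) * norm (w$2) + norm (z$3) * norm (w$3)"
      unfolding 1 by (intro order_trans[OF norm_triangle_ineq] add_mono) (auto simp: norm_mult)
    also have "\<dots> \<le> norm z * norm w + norm z * norm w + norm z * norm w"
      by (intro add_mono mult_mono) (auto simp: Finite_Cartesian_Product.norm_nth_le)
    finally show ?thesis by (simp add: mult_ac)
  qed
  then show ?thesis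
    by (intro bounded_bilinear.intro) (auto simp: scaleR_eq_smult scaleR_conv_of_real)
qed

lemma bounded_bilinear_smult: "bounded_bilinear ((*s) :: complex \<Rightarrow> complex^'n \<Rightarrow> complex^'n)"
proof -
  have "norm (a *s b) \<le> norm a * norm b * 1" for a and b :: "complex^'n"
    by (simp add: norm_vec_def L2_set_def norm_mult power_mult_distrib sum_distrib_left[symmetric] real_sqrt_mult)
  moreover have "r *\<^sub>R a *s b = r *\<^sub>R (a *s b)" "a *s (r *\<^sub>R b) = r *\<^sub>R (a *s b)" for a r and b :: "complex^'n"
    by (simp_all add: vec_eq_iff)
  ultimately show ?thesis
    by (intro bounded_bilinear.intro exI[of _ 1] allI) (auto simp: vector_sadd_rdistrib vector_add_ldistrib)
qed

text \<open>\<open>ins k\<close> and \<open>del k\<close> insert a $0$ at, and remove, the $k$-th coordinate. They let one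
  treat the three affine charts at once: $\zeta$ is the chart value of the line through \<open>homog k \<zeta>\<close>, and
  \<open>ins k\<close> is the derivative of \<open>homog k\<close>.\<close>

definition ins :: "3 \<Rightarrow> complex^2 \<Rightarrow> complex^3" where
  "ins k v = (if k = 1 then vector [0, v$1, v$2] else if k = 2 then vector [v$1, 0, v$2] else vector [v$1, v$2, 0])"

definition del :: "3 \<Rightarrow> complex^3 \<Rightarrow> complex^2" where
  "del k z = (if k = 1 then vector [z$2, z$3] else if k = 2 then vector [z$1, z$3] else vector [z$1, z$2])"

definition homog :: "3 \<Rightarrow> complex^2 \<Rightarrow> complex^3" where
  "homog k \<zeta> = ins k \<zeta> + axis k 1"

lemma ins_linear:
  "ins k (u + v) = ins k u + ins k v" "ins k (u - v) = ins k u - ins k v" "ins k (c *s v) = c *s ins k v"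
  "ins k (- v) = - ins k v" "ins k 0 = 0"
  by (simp_all add: ins_def vec_eq_iff forall_3)

lemma del_linear:
  "del k (u + v) = del k u + del k v" "del k (u - v) = del k u - del k v" "del k (c *s v) = c *s del k v"
  by (simp_all add: del_def vec_eq_iff forall_2)

lemma del_ins [simp]: "del k (ins k v) = v"
  by (simp add: del_def ins_def vec_eq_iff forall_2)

lemma ins_nth [simp]: "ins k v $ k = 0"
  using exhaust_3[of k] by (auto simp: ins_def)

lemma ins_del: "ins k (del k z) = z - (z$k) *s axis k 1"
  using exhaust_3[of k] by (auto simp: del_def ins_def vec_eq_iff forall_3 axis_def)

lemma homog_nth [simp]: "homog k \<zeta> $ k = 1"
  by (simp add: homog_def axis_def)

lemma del_axis [simp]: "del k (axis k c) = 0"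
  using exhaust_3[of k] by (auto simp: del_def vec_eq_iff forall_2 axis_def)

lemma affine_coords_eq: "affine_coords k z = del k ((1 / z$k) *s z)"
  using exhaust_3[of k] by (auto simp: affine_coords_def del_def vec_eq_iff forall_2)

lemma homog_affine_coords: "z$k \<noteq> 0 \<Longrightarrow> homog k (affine_coords k z) = (1 / z$k) *s z"
  by (simp add: homog_def affine_coords_eq ins_del)

lemma affine_coords_homog: "c \<noteq> 0 \<Longrightarrow> affine_coords k (c *s homog k \<zeta>) = \<zeta>"
  by (simp add: affine_coords_eq) (simp add: homog_def del_linear)

lemma affine_coords_homog1 [simp]: "affine_coords k (homog k \<zeta>) = \<zeta>"
  using affine_coords_homog[of 1 k \<zeta>] by simp

lemma affine_coords_smult: "c \<noteq> 0 \<Longrightarrow> affine_coords k (c *s z) = affine_coords k z"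
  by (simp add: affine_coords_eq)

lemma ins_eqI: "z$k = 0 \<Longrightarrow> ins k (del k z) = z"
  by (simp add: ins_del)

lemma bounded_linear_ins: "bounded_linear (ins k)"
  unfolding linear_conv_bounded_linear[symmetric] linear_iff
  by (simp add: ins_linear scaleR_eq_smult)

lemma bounded_linear_del: "bounded_linear (del k)"
  unfolding linear_conv_bounded_linear[symmetric] linear_iff
  by (simp add: del_linear scaleR_eq_smult)

lemma has_derivative_affine_coords:
  assumes "z$k \<noteq> 0"
  shows "(affine_coords k has_derivative (\<lambda>v. del k ((1 / z$k) *s v - (v$k / (z$k)^2) *s z))) (at z)"
proof -
  have 1: "((\<lambda>z::complex^3. 1 / z$k) has_derivative (\<lambda>v. - (v$k / (z$k)^2))) (at z)"
    using assms by (auto intro!: derivative_eq_intros bounded_linear.has_derivative[OF bounded_linear_vec_nth] simp: power2_eq_square field_simps)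
  have 2: "((\<lambda>z. (1 / z$k) *s z) has_derivative (\<lambda>v. (1 / z$k) *s v + (- (v$k / (z$k)^2)) *s z)) (at z)"
    by (rule bounded_bilinear.FDERIV[OF bounded_bilinear_smult 1 has_derivative_ident])
  have "((\<lambda>z. del k ((1 / z$k) *s z)) has_derivative (\<lambda>v. del k ((1 / z$k) *s v + (- (v$k / (z$k)^2)) *s z))) (at z)"
    by (rule bounded_linear.has_derivative[OF bounded_linear_del 2])
  then show ?thesis unfolding affine_coords_eq[abs_def] by (simp add: vec.scale_minus_left)
qed

lemma hopf_smult: "c \<noteq> 0 \<Longrightarrow> hopf (c *s z) = hopf z"
proof -
  assume c: "c \<noteq> 0"
  have "\<exists>d. d' *s (c *s z) = d *s z \<and> d \<noteq> 0" if "d' \<noteq> 0" for d'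
    using c that by (intro exI[of _ "d' * c"]) (simp add: vector_smult_assoc)
  moreover have "\<exists>d. d' *s z = d *s (c *s z) \<and> d \<noteq> 0" if "d' \<noteq> 0" for d'
    using c that by (intro exI[of _ "d' / c"]) (simp add: vector_smult_assoc)
  ultimately show ?thesis unfolding hopf_def by blast
qed

lemma hopf_self: "z \<in> hopf z" unfolding hopf_def
  by (rule CollectI, rule exI[of _ 1]) simp

lemma hopf_eqD: "hopf z = hopf w \<Longrightarrow> \<exists>c. c \<noteq> 0 \<and> z = c *s w"
  using hopf_self[of z] unfolding hopf_def by auto

lemma cp_chart_hopf: "cp_chart k (hopf z) = affine_coords k z"
proof -
  have "affine_coords k ` hopf z = {affine_coords k z}"
    using hopf_self[of z] affine_coords_smult by (fastforce simp: hopf_def image_iff)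
  then show ?thesis by (simp add: cp_chart_def)
qed

definition pos :: "complex^3 \<Rightarrow> bool" where "pos z \<longleftrightarrow> Re (b_form z z) > 0"

lemma pos_smult [simp]: "c \<noteq> 0 \<Longrightarrow> pos (c *s z) \<longleftrightarrow> pos z"
proof -
  assume c: "c \<noteq> 0"
  have "b_form (c *s z) (c *s z) = (c * cnj c) * b_form z z"
    by (simp add: mult_ac)
  then have "b_form (c *s z) (c *s z) = of_real ((cmod c)^2) * of_real (Re (b_form z z))"
    unfolding complex_norm_square[symmetric] by (simp add: b_form_self[symmetric])
  then have "Re (b_form (c *s z) (c *s z)) = (cmod c)^2 * Re (b_form z z)"
    by simp
  then show ?thesis using c by (simp add: pos_def zero_less_mult_iff)
qed

definition unit :: "complex^3 \<Rightarrow> complex^3" where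
  "unit z = of_real (1 / sqrt (Re (b_form z z))) *s z"

lemma unit_S52: "pos z \<Longrightarrow> unit z \<in> S52"
proof -
  assume "pos z"
  then have p: "Re (b_form z z) > 0" by (simp add: pos_def)
  have "b_form (unit z) (unit z) = of_real ((1 / sqrt (Re (b_form z z)))^2) * b_form z z"
  proof -
    have "b_form (of_real c *s z) (of_real c *s z) = of_real (c^2) * b_form z z" for c
      by (simp add: power2_eq_square)
    then show ?thesis unfolding unit_def .
  qed
  also have "\<dots> = of_real ((1 / sqrt (Re (b_form z z)))^2 * Re (b_form z z))"
    by (simp only: b_form_self[symmetric] of_real_mult)
  also have "\<dots> = 1" using p by (simp add: power_divide)
  finally show ?thesis by (simp add: S52_def)
qed

lemma hopf_unit: "pos z \<Longrightarrow> hopf (unit z) = hopf z"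
  unfolding unit_def by (rule hopf_smult) (simp add: pos_def)

lemma S52_pos: "z \<in> S52 \<Longrightarrow> pos z"
  by (simp add: S52_def pos_def)

lemma CP21_eq: "CP21 = hopf ` {z. pos z}"
  unfolding CP21_def using hopf_unit unit_S52 S52_pos by (auto simp: image_iff)+

lemma cp_domain_eq: "cp_domain k = hopf ` {z. pos z \<and> z$k \<noteq> 0}"
proof -
  have "hopf z \<in> hopf ` {z \<in> S52. z$k \<noteq> 0}" if "pos z" "z$k \<noteq> 0" for z
    using that unit_S52[OF that(1)] hopf_unit[OF that(1)]
    by (intro image_eqI[of _ _ "unit z"]) (auto simp: unit_def pos_def)
  then show ?thesis unfolding cp_domain_def using S52_pos by blast
qed

lemma hopf_in_cp_domain: "hopf z \<in> cp_domain k \<longleftrightarrow> pos z \<and> z$k \<noteq> 0"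
  unfolding cp_domain_eq by (auto dest!: hopf_eqD simp: image_iff)

lemma cp_domain_cases: assumes "l \<in> cp_domain k"
  obtains \<zeta> where "pos (homog k \<zeta>)" "l = hopf (homog k \<zeta>)" "cp_chart k l = \<zeta>"
proof -
  obtain z where z: "pos z" "z$k \<noteq> 0" "l = hopf z" using assms unfolding cp_domain_eq by auto
  have "homog k (affine_coords k z) = (1 / z$k) *s z" using z homog_affine_coords by simp
  then have "pos (homog k (affine_coords k z))" "hopf (homog k (affine_coords k z)) = hopf z"
    using z by (simp_all add: hopf_smult)
  then show ?thesis using that[of "affine_coords k z"] z cp_chart_hopf by simp
qed

lemma hopf_homog_in: "pos (homog k \<zeta>) \<Longrightarrow> hopf (homog k \<zeta>) \<in> cp_domain k"
  by (simp add: hopf_in_cp_domain)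

lemma cp_chart_homog [simp]: "cp_chart k (hopf (homog k \<zeta>)) = \<zeta>"
  by (simp add: cp_chart_hopf)

lemma inv_cp_chart: "pos (homog k \<zeta>) \<Longrightarrow> inv_into (cp_domain k) (cp_chart k) \<zeta> = hopf (homog k \<zeta>)"
  by (rule inv_into_f_eq) (auto simp: hopf_homog_in inj_on_def elim!: cp_domain_cases)

lemma open_pos_homog: "open {\<zeta>. pos (homog k \<zeta>)}"
proof -
  have "continuous_on UNIV (\<lambda>\<zeta>. Re (b_form (homog k \<zeta>) (homog k \<zeta>)))"
    unfolding homog_def
    by (intro continuous_intros bounded_bilinear.continuous_on[OF bounded_bilinear_b_form]
        linear_continuous_on bounded_linear_ins)
  from open_Collect_less[OF continuous_on_const this, of 0] show ?thesis by (simp add: pos_def)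
qed

text \<open>The Hermitian Fubini-Study form of $b$ at the line through $z$, as a form on $\mathbf C^3$: the
  $b$-product of the components of $v$ and $w$ orthogonal to $z$, scaled so that it depends only on the line and
  on $v$, $w$ modulo $z$ (\<open>fs_invariant\<close>).\<close>

definition fs :: "complex^3 \<Rightarrow> complex^3 \<Rightarrow> complex^3 \<Rightarrow> complex" where
  "fs z v w = b_form v w / b_form z z - b_form v z * b_form z w / (b_form z z)^2"

lemma fs_invariant:
  assumes "c \<noteq> 0" "b_form z z \<noteq> 0"
  shows "fs (c *s z) (c *s v + d *s z) (c *s w + e *s z) = fs z v w"
proof -
  have "cnj c * c \<noteq> 0" using assms by simp
  then show ?thesis
    unfolding fs_def using assms
    by (simp add: divide_simps power2_eq_square) (simp add: algebra_simps)
qed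

lemma horizontal_iff: "w \<in> horizontal z \<longleftrightarrow> b_form z w = 0"
  by (auto simp: horizontal_def complex_eq_iff)

text \<open>For existence, rescale a point of the pseudo-sphere over $\zeta$ to \<open>homog k \<zeta>\<close> and use the invariance
  of \<open>fs\<close>. For uniqueness, every pair of tangent vectors of the chart is the image of
  horizontal vectors at the normalised lift of $\zeta$.\<close>

lemma cp_metric_eq:
  assumes "pos (homog k \<zeta>)"
  shows "cp_metric k \<zeta> = (\<lambda>v w. Re (fs (homog k \<zeta>) (ins k v) (ins k w)))"
  unfolding cp_metric_def
proof (rule the_equality)
  let ?d = "\<lambda>z. frechet_derivative (affine_coords k) (at z)"
  have d: "?d z v = del k ((1 / z$k) *s v - (v$k / (z$k)^2) *s z)" if "z$k \<noteq> 0" for z v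
    using frechet_derivative_eqI[OF has_derivative_affine_coords[OF that]] by simp
  have insd: "ins k (?d z v) = (1 / z$k) *s v + (- (v$k / (z$k)^2)) *s z" if "z$k \<noteq> 0" for z v
    unfolding d[OF that] using that by (subst ins_eqI) (auto simp: power2_eq_square vec.scale_minus_left)
  show "\<forall>z\<in>S52. z$k \<noteq> 0 \<and> affine_coords k z = \<zeta> \<longrightarrow>
     (\<forall>v\<in>horizontal z. \<forall>w\<in>horizontal z. Re (fs (homog k \<zeta>) (ins k (?d z v)) (ins k (?d z w))) = Re (b_form v w))"
  proof (intro ballI impI, elim conjE)
    fix z v w assume z: "z \<in> S52" "z$k \<noteq> 0" "affine_coords k z = \<zeta>" and vw: "v \<in> horizontal z" "w \<in> horizontal z"
    have h: "homog k \<zeta> = (1 / z$k) *s z" using z homog_affine_coords by metis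
    have "fs (homog k \<zeta>) (ins k (?d z v)) (ins k (?d z w)) = fs z v w"
      unfolding insd[OF z(2)] h using z by (intro fs_invariant) (auto simp: S52_def)
    also have "\<dots> = b_form v w" using vw z by (simp add: fs_def horizontal_iff S52_def)
    finally show "Re (fs (homog k \<zeta>) (ins k (?d z v)) (ins k (?d z w))) = Re (b_form v w)" by simp
  qed
next
  let ?d = "\<lambda>z. frechet_derivative (affine_coords k) (at z)"
  have d: "?d z v = del k ((1 / z$k) *s v - (v$k / (z$k)^2) *s z)" if "z$k \<noteq> 0" for z v
    using frechet_derivative_eqI[OF has_derivative_affine_coords[OF that]] by simp
  fix g assume g: "\<forall>z\<in>S52. z$k \<noteq> 0 \<and> affine_coords k z = \<zeta> \<longrightarrow>
     (\<forall>v\<in>horizontal z. \<forall>w\<in>horizontal z. g (?d z v) (?d z w) = Re (b_form v w))"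
  define h where "h = homog k \<zeta>"
  define n where "n = Re (b_form h h)"
  have n: "n > 0" "b_form h h = of_real n" using assms by (auto simp: n_def h_def pos_def b_form_self[symmetric])
  define s where "s = complex_of_real (1 / sqrt n)"
  have s: "s \<noteq> 0" "s * s = 1 / of_real n" "cnj s = s"
    using n by (auto simp: s_def of_real_mult[symmetric] simp del: of_real_mult)
  have z: "unit h = s *s h" by (simp add: unit_def s_def n_def)
  have z1: "(s *s h) $ k \<noteq> 0" "affine_coords k (s *s h) = \<zeta>" "s *s h \<in> S52" "(s *s h) $ k = s"
    using s unit_S52[of h] assms z by (auto simp: h_def affine_coords_homog)
  \<comment> \<open>the horizontal lift at $s\,h$ of the chart vector $v$\<close>
  define H where "H v = s *s (ins k v - (b_form h (ins k v) / n) *s h)" for v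
  have hor: "H v \<in> horizontal (s *s h)" for v
    using n by (simp add: horizontal_iff H_def)
  have Hk: "H v $ k = - s * (b_form h (ins k v) / n)" for v by (simp add: H_def h_def)
  have dH: "?d (s *s h) (H v) = v" for v
  proof -
    have "(1 / s) *s H v - (H v $ k / s^2) *s (s *s h) = ins k v"
      using s(1) unfolding Hk unfolding H_def by (simp add: vec_eq_iff power2_eq_square field_simps)
    then show ?thesis unfolding d[OF z1(1)] unfolding z1(4) by simp
  qed
  show "g = (\<lambda>v w. Re (fs (homog k \<zeta>) (ins k v) (ins k w)))"
  proof (intro ext)
    fix v w
    have "g v w = Re (b_form (H v) (H w))"
      using g z1 hor dH by metis
    also have "b_form (H v) (H w) = fs h (ins k v) (ins k w)"
    proof -
      let ?v = "ins k v" and ?w = "ins k w"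
      have "b_form (H v) (H w) = (s * s) * (b_form ?v ?w - (b_form h ?w / n) * b_form ?v h
          - cnj (b_form h ?v / n) * b_form h ?w + cnj (b_form h ?v / n) * (b_form h ?w / n) * b_form h h)"
        unfolding H_def using s(3) by (simp add: algebra_simps)
      also have "\<dots> = fs h ?v ?w"
        unfolding s(2) fs_def n(2) complex_cnj_divide b_form_cnj using n(1)
        by (simp add: power2_eq_square field_simps)
      finally show ?thesis .
    qed
    finally show "g v w = Re (fs (homog k \<zeta>) (ins k v) (ins k w))" by (simp add: h_def)
  qed
qed


lemma has_derivative_homog: "(homog k has_derivative ins k) (at \<zeta>)"
proof -
  have "((\<lambda>\<zeta>. ins k \<zeta> + axis k 1) has_derivative (\<lambda>v. ins k v + 0)) (at \<zeta>)"
    by (intro has_derivative_add has_derivative_const bounded_linear_imp_has_derivative bounded_linear_ins)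
  then show ?thesis by (simp add: homog_def[abs_def])
qed

lemma pos_self: assumes "pos z" shows "b_form z z = of_real (Re (b_form z z))" "Re (b_form z z) > 0" "b_form z z \<noteq> 0"
  using assms b_form_self[of z] by (auto simp: pos_def)

lemma fs_nondegenerate:
  assumes p: "pos (homog k \<zeta>)" and 0: "\<And>w. Re (fs (homog k \<zeta>) (ins k c) (ins k w)) = 0"
  shows "c = 0"
proof -
  define z where "z = homog k \<zeta>"
  note n = pos_self[OF p, folded z_def]
  define d where "d = ins k c - (b_form z (ins k c) / b_form z z) *s z"
  have fsd: "fs z (ins k c) w = b_form d w / b_form z z" for w
    using n(3) unfolding fs_def d_def b_form_simps complex_cnj_divide b_form_cnj 
    by (simp add: power2_eq_square field_simps)
  have "fs z (ins k c) (ins k w) = 0" for w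
  proof -
    have "Re (fs z (ins k c) (ins k w)) = 0" "Re (fs z (ins k c) (ins k (\<i> *s w))) = 0"
      using 0 by (simp_all add: z_def)
    moreover have "fs z (ins k c) (ins k (\<i> *s w)) = \<i> * fs z (ins k c) (ins k w)"
      by (simp add: ins_linear fsd)
    ultimately show ?thesis by (simp add: complex_eq_iff)
  qed
  then have dw: "b_form d (ins k w) = 0" for w using n(3) by (simp add: fsd)
  have dz: "b_form d z = 0"
    using n(3) by (simp add: d_def b_form_cnj)
  have "b_form d x = 0" for x
  proof -
    have "x = ins k (del k (x - (x$k) *s z)) + (x$k) *s z"
      by (simp add: ins_eqI z_def)
    then show ?thesis using dw dz by (metis add.right_neutral b_form_simps(2,8) mult_zero_right)
  qed
  then have "d = 0" by (rule b_form_eq_0)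
  then have eq: "ins k c = (b_form z (ins k c) / b_form z z) *s z" by (simp add: d_def)
  then have "ins k c $ k = (b_form z (ins k c) / b_form z z) * z $ k"
    by (metis vector_smult_component)
  then have "b_form z (ins k c) / b_form z z = 0" by (simp add: z_def)
  with eq have "ins k c = 0" by simp
  then show "c = 0" by (metis del_ins ins_linear(5))
qed

text \<open>The derivative of \<open>fs\<close> in its base point $z$ in the direction $u$.\<close>

definition fs_deriv :: "complex^3 \<Rightarrow> complex^3 \<Rightarrow> complex^3 \<Rightarrow> complex^3 \<Rightarrow> complex" where
  "fs_deriv z u v w = - (b_form v w * (b_form u z + b_form z u)) / (b_form z z)^2
     - (b_form v u * b_form z w + b_form v z * b_form u w) / (b_form z z)^2
     + 2 * (b_form v z * b_form z w * (b_form u z + b_form z u)) / (b_form z z)^3"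

lemma has_derivative_b_form_left: "(b_form x has_derivative b_form x) (at z)"
  by (rule bounded_linear_imp_has_derivative[OF bounded_bilinear.bounded_linear_right[OF bounded_bilinear_b_form]])

lemma has_derivative_b_form_right: "((\<lambda>z. b_form z x) has_derivative (\<lambda>u. b_form u x)) (at z)"
  by (rule bounded_linear_imp_has_derivative[OF bounded_bilinear.bounded_linear_left[OF bounded_bilinear_b_form]])

lemma has_derivative_fs:
  assumes "b_form z z \<noteq> 0"
  shows "((\<lambda>z. fs z v w) has_derivative (\<lambda>u. fs_deriv z u v w)) (at z)"
  unfolding fs_def[abs_def]
  apply (rule has_derivative_eq_rhs)
   apply (rule derivative_eq_intros refl has_derivative_b_form_left has_derivative_b_form_right
       bounded_bilinear.FDERIV[OF bounded_bilinear_b_form] has_derivative_ident assms | simp add: assms)+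
  using assms by (auto simp: fun_eq_iff fs_deriv_def power2_eq_square power3_eq_cube field_simps)

text \<open>The left argument of \<open>fs\<close> on the left-hand side is the classical Christoffel symbol of the
  Fubini-Study metric. The identity is the Koszul formula for it, an algebraic identity in the six products of
  $z,u,v,w$.\<close>

lemma fs_koszul:
  assumes "pos z"
  shows "2 * Re (fs z (- (b_form z u / b_form z z) *s v - (b_form z v / b_form z z) *s u) w)
    = Re (fs_deriv z u v w) + Re (fs_deriv z v u w) - Re (fs_deriv z w u v)"
proof -
  define n where "n = Re (b_form z z)"
  have n: "n > 0" "b_form z z = of_real n" using assms by (auto simp: n_def pos_def b_form_self[symmetric])
  define p where "p = b_form u v"
  define q where "q = b_form v w"
  define r where "r = b_form u w"
  define a where "a = b_form z u"
  define b where "b = b_form z v"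
  define c where "c = b_form z w"
  have c: "b_form v u = cnj p" "b_form w v = cnj q" "b_form w u = cnj r"
    "b_form u z = cnj a" "b_form v z = cnj b" "b_form w z = cnj c"
    by (simp_all add: p_def q_def r_def a_def b_def c_def b_form_cnj)
  have s: "a + cnj a = of_real (2 * Re a)" "b + cnj b = of_real (2 * Re b)" "c + cnj c = of_real (2 * Re c)"
     "cnj a + a = of_real (2 * Re a)" "cnj b + b = of_real (2 * Re b)" "cnj c + c = of_real (2 * Re c)"
    by (simp_all add: complex_eq_iff)
  note defs = p_def[symmetric] q_def[symmetric] r_def[symmetric] a_def[symmetric] b_def[symmetric] c_def[symmetric]
  have L: "fs z (- (a / n) *s v - (b / n) *s u) w
     = - (cnj a * q + cnj b * r) / of_real (n^2) + (2 * cnj a * cnj b * c) / of_real (n^3)"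
    unfolding fs_def b_form_simps n(2) c defs
    using n(1) by (simp add: field_simps power2_eq_square power3_eq_cube)
  have R: "fs_deriv z u v w = - (2 * Re a * q + cnj p * c + cnj b * r) / of_real (n^2) + (2 * (cnj b * c * (2 * Re a))) / of_real (n^3)"
    "fs_deriv z v u w = - (2 * Re b * r + p * c + cnj a * q) / of_real (n^2) + (2 * (cnj a * c * (2 * Re b))) / of_real (n^3)"
    "fs_deriv z w u v = - (2 * Re c * p + r * b + cnj a * cnj q) / of_real (n^2) + (2 * (cnj a * b * (2 * Re c))) / of_real (n^3)"
    unfolding fs_deriv_def n(2) c defs s
    using n(1) by (simp_all add: field_simps power2_eq_square power3_eq_cube)
  show ?thesis
    unfolding R defs n(2) L Re_divide_of_real plus_complex.sel uminus_complex.sel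
    using n(1) by (simp add: field_simps)
qed

section \<open>The Levi-Civita connection of the projective plane and its unitary isometries\<close>

text \<open>The Christoffel symbol is a definite description; by nondegeneracy any solution of the Koszul formula is its value.\<close>

lemma christoffel_eqI:
  assumes k: "\<And>w. 2 * g x c w = frechet_derivative (\<lambda>y. g y v w) (at x) u
    + frechet_derivative (\<lambda>y. g y u w) (at x) v - frechet_derivative (\<lambda>y. g y u v) (at x) w"
    and lin: "\<And>c d w. g x (c - d) w = g x c w - g x d w"
    and nd: "\<And>c. (\<And>w. g x c w = 0) \<Longrightarrow> c = 0"
  shows "christoffel g x u v = c"
  unfolding christoffel_def
proof (rule the_equality)
  fix d assume d: "\<forall>w. 2 * g x d w = frechet_derivative (\<lambda>y. g y v w) (at x) u
    + frechet_derivative (\<lambda>y. g y u w) (at x) v - frechet_derivative (\<lambda>y. g y u v) (at x) w"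
  have "g x (d - c) w = 0" for w using spec[OF d, of w] k[of w] by (simp add: lin)
  then show "d = c" using nd[of "d - c"] by simp
qed (use k in blast)

lemma has_derivative_cp_metric:
  assumes "pos (homog k \<zeta>)"
  shows "((\<lambda>y. cp_metric k y v w) has_derivative
    (\<lambda>u. Re (fs_deriv (homog k \<zeta>) (ins k u) (ins k v) (ins k w)))) (at \<zeta>)"
proof -
  have "((\<lambda>y. Re (fs (homog k y) (ins k v) (ins k w))) has_derivative
    (\<lambda>u. Re (fs_deriv (homog k \<zeta>) (ins k u) (ins k v) (ins k w)))) (at \<zeta>)"
    using pos_self(3)[OF assms]
    by (intro bounded_linear.has_derivative[OF bounded_linear_Re]
        has_derivative_compose[OF has_derivative_homog has_derivative_fs])
  then show ?thesis
    by (rule has_derivative_transform_within_open[OF _ open_pos_homog]) (use assms cp_metric_eq in auto)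
qed

lemma fs_diff_left: "fs z (u - v) w = fs z u w - fs z v w"
  by (simp add: fs_def algebra_simps diff_divide_distrib add_divide_distrib)

lemma cp_christoffel:
  assumes p: "pos (homog k \<zeta>)"
  shows "christoffel (cp_metric k) \<zeta> u v =
    - (b_form (homog k \<zeta>) (ins k u) / b_form (homog k \<zeta>) (homog k \<zeta>)) *s v
    - (b_form (homog k \<zeta>) (ins k v) / b_form (homog k \<zeta>) (homog k \<zeta>)) *s u"
proof (rule christoffel_eqI)
  note fd = frechet_derivative_eqI[OF has_derivative_cp_metric[OF p]]
  fix w
  show "2 * cp_metric k \<zeta> (- (b_form (homog k \<zeta>) (ins k u) / b_form (homog k \<zeta>) (homog k \<zeta>)) *s v
    - (b_form (homog k \<zeta>) (ins k v) / b_form (homog k \<zeta>) (homog k \<zeta>)) *s u) w =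
    frechet_derivative (\<lambda>y. cp_metric k y v w) (at \<zeta>) u
    + frechet_derivative (\<lambda>y. cp_metric k y u w) (at \<zeta>) v - frechet_derivative (\<lambda>y. cp_metric k y u v) (at \<zeta>) w"
    unfolding fd using fs_koszul[OF p, of "ins k u" "ins k v" "ins k w"]
    by (simp add: cp_metric_eq[OF p] ins_linear)
qed (use fs_nondegenerate[OF p] in \<open>auto simp: cp_metric_eq[OF p] ins_linear fs_diff_left\<close>)

definition unitary12 :: "complex^3^3 \<Rightarrow> bool" where
  "unitary12 T \<longleftrightarrow> (\<forall>x y. b_form (T *v x) (T *v y) = b_form x y)"

definition act :: "complex^3^3 \<Rightarrow> (complex^3) set \<Rightarrow> (complex^3) set" where
  "act T l = (\<lambda>z. T *v z) ` l"

lemma act_hopf: "act T (hopf z) = hopf (T *v z)"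
  by (auto simp: act_def hopf_def image_iff vector_scalar_commute) (metis vector_scalar_commute)

lemma unitary12_pos: "unitary12 T \<Longrightarrow> pos (T *v z) \<longleftrightarrow> pos z"
  by (simp add: unitary12_def pos_def)

lemma unitary12_inverse:
  assumes "unitary12 T"
  obtains T' where "unitary12 T'" "\<And>z. T' *v (T *v z) = z" "\<And>z. T *v (T' *v z) = z"
proof -
  have "T *v x = 0 \<Longrightarrow> x = 0" for x
    using assms b_form_eq_0[of x] unfolding unitary12_def by (metis b_form_simps(9))
  then obtain T' where 1: "T' ** T = mat 1" using matrix_left_invertible_ker[of T] by auto
  then have 2: "T ** T' = mat 1" using matrix_left_right_inverse by blast
  have i: "T' *v (T *v z) = z" "T *v (T' *v z) = z" for z using 1 2 by (simp_all add: matrix_vector_mul_assoc)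
  moreover have "unitary12 T'"
    using assms i unfolding unitary12_def by metis
  ultimately show ?thesis using that by blast
qed

lemma unitary12_mult: "unitary12 S \<Longrightarrow> unitary12 T \<Longrightarrow> unitary12 (S ** T)"
  by (simp add: unitary12_def matrix_vector_mul_assoc[symmetric])

lemma bounded_linear_matrix_complex: "bounded_linear ((*v) (T :: complex^'n^'m))"
  unfolding linear_conv_bounded_linear[symmetric] linear_iff
  by (simp add: scaleR_eq_smult matrix_vector_right_distrib vector_scalar_commute)

lemma ins_derivative_affine:
  assumes "z$k \<noteq> 0"
  shows "ins k (del k ((1 / z$k) *s v - (v$k / (z$k)^2) *s z)) = (1 / z$k) *s v + (- (v$k / (z$k)^2)) *s z"
  using assms by (subst ins_eqI) (auto simp: power2_eq_square vec.scale_minus_left)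

lemma smooth_on_affine_coords: "smooth_on {z. z$k \<noteq> 0} (affine_coords k)"
proof -
  have o: "open {z::complex^3. z$k \<noteq> 0}"
    by (intro open_Collect_neq continuous_intros)
  have "smooth_on {z. z$k \<noteq> 0} (\<lambda>z. del k ((1 / z$k) *s z))"
    by (intro smooth_on_bounded_linear_compose[OF bounded_linear_del] smooth_on_divide
        smooth_on_bilinear[OF bounded_bilinear_smult] o smooth_on_const
        smooth_on_bounded_linear[OF bounded_linear_vec_nth] smooth_on_bounded_linear[OF bounded_linear_ident]) auto
  then show ?thesis by (simp add: affine_coords_eq[abs_def])
qed

lemma smooth_on_homog: "open S \<Longrightarrow> smooth_on S f \<Longrightarrow> smooth_on S (\<lambda>x. homog k (f x))"
  unfolding homog_def
  by (intro smooth_on_add smooth_on_const smooth_on_bounded_linear_compose[OF bounded_linear_ins])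

lemma bij_betw_act:
  assumes "unitary12 T" shows "bij_betw (act T) CP21 CP21"
proof -
  obtain T' where T': "unitary12 T'" "\<And>z. T' *v (T *v z) = z" "\<And>z. T *v (T' *v z) = z"
    using unitary12_inverse[OF assms] by blast
  show ?thesis
    by (rule bij_betw_byWitness[where f' = "act T'"])
      (auto simp: CP21_eq act_hopf T' unitary12_pos[OF assms] unitary12_pos[OF T'(1)])
qed

text \<open>In affine charts the map is $\zeta\mapsto$ \<open>affine_coords l (T *v homog k \<zeta>)\<close>, a
  quotient of affine functions. Its derivative lifts to the derivative of $T$ up to scaling and a multiple of the
  base point, neither of which \<open>fs\<close> notices.\<close>

lemma holomorphic_isometry_act:
  assumes T: "unitary12 T"
  shows "holomorphic_isometry (act T)"
  unfolding holomorphic_isometry_def Let_def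
proof (intro conjI allI)
  show "bij_betw (act T) CP21 CP21" by (rule bij_betw_act[OF T])
next
  fix k l
  let ?D = "cp_chart k ` {p \<in> cp_domain k. act T p \<in> cp_domain l}"
  let ?F = "cp_chart l \<circ> act T \<circ> inv_into (cp_domain k) (cp_chart k)"
  define Z where "Z \<zeta> = T *v homog k \<zeta>" for \<zeta>
  define F' where "F' \<zeta> v = del l ((1 / Z \<zeta> $ l) *s (T *v ins k v) - ((T *v ins k v) $ l / (Z \<zeta> $ l)^2) *s Z \<zeta>)" for \<zeta> v
  have D: "?D = {\<zeta>. pos (homog k \<zeta>) \<and> Z \<zeta> $ l \<noteq> 0}"
  proof (intro set_eqI iffI)
    fix \<zeta> assume "\<zeta> \<in> ?D"
    then obtain p where p: "p \<in> cp_domain k" "act T p \<in> cp_domain l" "\<zeta> = cp_chart k p" by auto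
    from p(1) obtain \<xi> where "pos (homog k \<xi>)" "p = hopf (homog k \<xi>)" "cp_chart k p = \<xi>"
      by (rule cp_domain_cases)
    with p show "\<zeta> \<in> {\<zeta>. pos (homog k \<zeta>) \<and> Z \<zeta> $ l \<noteq> 0}"
      by (simp add: act_hopf hopf_in_cp_domain Z_def)
  next
    fix \<zeta> assume "\<zeta> \<in> {\<zeta>. pos (homog k \<zeta>) \<and> Z \<zeta> $ l \<noteq> 0}"
    then show "\<zeta> \<in> ?D"
      by (intro image_eqI[of _ _ "hopf (homog k \<zeta>)"])
        (auto simp: act_hopf hopf_in_cp_domain Z_def unitary12_pos[OF T])
  qed
  have smZ: "smooth_on S Z" if "open S" for S unfolding Z_def[abs_def]
    by (intro smooth_on_bounded_linear_compose[OF bounded_linear_matrix_complex] smooth_on_homog that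
        smooth_on_bounded_linear[OF bounded_linear_ident])
  have contZ: "continuous_on UNIV Z" using smooth_on_continuous_on[OF smZ[OF open_UNIV]] .
  have "open {\<zeta>. Z \<zeta> $ l \<noteq> 0}"
    by (intro open_Collect_neq continuous_on_component contZ continuous_on_const)
  then show oD: "open ?D" unfolding D using open_pos_homog[of k] by (simp add: Collect_conj_eq open_Int)
  have F: "?F \<zeta> = affine_coords l (Z \<zeta>)" if "\<zeta> \<in> ?D" for \<zeta>
    using that unfolding D by (simp add: inv_cp_chart act_hopf cp_chart_hopf Z_def)
  have "smooth_on ?D (\<lambda>\<zeta>. affine_coords l (Z \<zeta>))"
    by (rule smooth_on_compose[OF oD _ smZ[OF oD] smooth_on_affine_coords]) (use D in auto)
  then show "smooth_on ?D ?F"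
    by (rule smooth_on_cong[OF oD, rotated]) (simp add: F del: comp_apply)
  have dF: "dd ?F \<zeta> = F' \<zeta>" if "\<zeta> \<in> ?D" for \<zeta>
  proof -
    have l: "Z \<zeta> $ l \<noteq> 0" using that D by blast
    have "(Z has_derivative (\<lambda>v. T *v ins k v)) (at \<zeta>)" unfolding Z_def[abs_def]
      by (intro bounded_linear.has_derivative[OF bounded_linear_matrix_complex] has_derivative_homog)
    from has_derivative_compose[OF this has_derivative_affine_coords[OF l]]
    have "((\<lambda>\<zeta>. affine_coords l (Z \<zeta>)) has_derivative F' \<zeta>) (at \<zeta>)" by (simp add: F'_def[abs_def])
    then have "(?F has_derivative F' \<zeta>) (at \<zeta>)"
      by (rule has_derivative_transform_within_open[OF _ oD that]) (simp add: F del: comp_apply)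
    then show ?thesis by (rule frechet_derivative_eqI)
  qed
  show "\<forall>\<zeta>\<in>?D. \<forall>v w.
      dd ?F \<zeta> (\<i> *s v) = \<i> *s dd ?F \<zeta> v \<and>
      pullback_metric (cp_metric l) ?F \<zeta> v w = cp_metric k \<zeta> v w"
  proof (intro ballI allI conjI)
    fix \<zeta> v w assume \<zeta>: "\<zeta> \<in> ?D"
    then have l: "Z \<zeta> $ l \<noteq> 0" and p: "pos (homog k \<zeta>)" using D by auto
    show "dd ?F \<zeta> (\<i> *s v) = \<i> *s dd ?F \<zeta> v"
      unfolding dF[OF \<zeta>] F'_def by (simp add: ins_linear vector_scalar_commute vec_eq_iff del_linear algebra_simps)
    have hl: "homog l (affine_coords l (Z \<zeta>)) = (1 / Z \<zeta> $ l) *s Z \<zeta>"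
      by (rule homog_affine_coords[OF l])
    have p': "pos (homog l (affine_coords l (Z \<zeta>)))" unfolding hl using l p 
      by (simp add: Z_def unitary12_pos[OF T])
    have iF: "ins l (F' \<zeta> v) = (1 / Z \<zeta> $ l) *s (T *v ins k v) + (- ((T *v ins k v) $ l / (Z \<zeta> $ l)^2)) *s Z \<zeta>" for v
      unfolding F'_def by (rule ins_derivative_affine[OF l])
    have bZ: "b_form (Z \<zeta>) (Z \<zeta>) \<noteq> 0" using pos_self(3)[OF p] T by (simp add: Z_def unitary12_def)
    have "pullback_metric (cp_metric l) ?F \<zeta> v w
       = Re (fs ((1 / Z \<zeta> $ l) *s Z \<zeta>) (ins l (F' \<zeta> v)) (ins l (F' \<zeta> w)))"
      unfolding pullback_metric_def dF[OF \<zeta>] F[OF \<zeta>] cp_metric_eq[OF p'] hl by (rule refl)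
    also have "\<dots> = Re (fs (Z \<zeta>) (T *v ins k v) (T *v ins k w))"
      unfolding iF using l by (subst fs_invariant[OF _ bZ]) auto
    also have "\<dots> = cp_metric k \<zeta> v w"
      using T unfolding cp_metric_eq[OF p] by (simp add: fs_def Z_def unitary12_def)
    finally show "pullback_metric (cp_metric l) ?F \<zeta> v w = cp_metric k \<zeta> v w" .
  qed
qed

section \<open>Lorentzian surfaces with a null frame\<close>

lemma smooth_on_dd_linear:
  assumes "smooth_on S F" "x \<in> S"
  shows "dd F x (u + v) = dd F x u + dd F x v" "dd F x (c *\<^sub>R u) = c *\<^sub>R dd F x u"
  using has_derivative_linear[OF smooth_on_has_derivative[OF assms]] by (simp_all add: linear_add linear_cmul)

lemma vec_expand: "(u::real^'n) = (\<Sum>i\<in>UNIV. (u$i) *\<^sub>R axis i 1)"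
  by (simp add: vec_eq_iff axis_def if_distrib cong: if_cong)

lemma linear_vec_expand: "linear F \<Longrightarrow> F (u::real^'n) = (\<Sum>i\<in>UNIV. (u$i) *\<^sub>R F (axis i 1))"
  by (subst vec_expand) (simp add: linear_sum linear_cmul)

text \<open>The product rule for $y\mapsto F_y(V(y))$ where $F_y$ is linear and depends smoothly on $y$.
  It is used for the metric, for the Christoffel symbols and for $df$, all of which are defined
  on constant vector fields only.\<close>

lemma linear_family_dd:
  fixes F :: "'a::real_normed_vector \<Rightarrow> real^'n \<Rightarrow> 'b::real_normed_vector"
  assumes S: "open S" and lin: "\<And>y. y \<in> S \<Longrightarrow> linear (F y)" and sm: "\<And>v. smooth_on S (\<lambda>y. F y v)"
  shows "x \<in> S \<Longrightarrow> dd (\<lambda>y. F y w) x u = (\<Sum>i\<in>UNIV. (w$i) *\<^sub>R dd (\<lambda>y. F y (axis i 1)) x u)"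
    and "x \<in> S \<Longrightarrow> linear (\<lambda>w. dd (\<lambda>y. F y w) x u)"
    and "smooth_on S V \<Longrightarrow> smooth_on S (\<lambda>y. F y (V y))"
    and "smooth_on S V \<Longrightarrow> x \<in> S \<Longrightarrow> ((\<lambda>y. F y (V y)) has_derivative (\<lambda>u. dd (\<lambda>y. F y (V x)) x u + F x (dd V x u))) (at x)"
proof -
  have 1: "dd (\<lambda>y. F y w) x u = (\<Sum>i\<in>UNIV. (w$i) *\<^sub>R dd (\<lambda>y. F y (axis i 1)) x u)" if x: "x \<in> S" for x w u
  proof -
    have "((\<lambda>y. \<Sum>i\<in>UNIV. (w$i) *\<^sub>R F y (axis i 1)) has_derivative
        (\<lambda>u. \<Sum>i\<in>UNIV. (w$i) *\<^sub>R dd (\<lambda>y. F y (axis i 1)) x u)) (at x)"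
      by (intro has_derivative_sum has_derivative_scaleR_right smooth_on_has_derivative[OF sm x])
    then have "((\<lambda>y. F y w) has_derivative
        (\<lambda>u. \<Sum>i\<in>UNIV. (w$i) *\<^sub>R dd (\<lambda>y. F y (axis i 1)) x u)) (at x)"
      by (rule has_derivative_transform_within_open[OF _ S x]) (rule linear_vec_expand[OF lin, symmetric])
    then show ?thesis by (simp add: frechet_derivative_eqI)
  qed
  then show "x \<in> S \<Longrightarrow> dd (\<lambda>y. F y w) x u = (\<Sum>i\<in>UNIV. (w$i) *\<^sub>R dd (\<lambda>y. F y (axis i 1)) x u)" .
  show "x \<in> S \<Longrightarrow> linear (\<lambda>w. dd (\<lambda>y. F y w) x u)"
  proof (rule linearI)
    assume x: "x \<in> S"
    note eq = 1[OF x, of _ u]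
    show "dd (\<lambda>y. F y (v + w)) x u = dd (\<lambda>y. F y v) x u + dd (\<lambda>y. F y w) x u" for v w
      unfolding eq[of "v + w"] eq[of v] eq[of w] by (simp add: scaleR_add_left sum.distrib)
    show "dd (\<lambda>y. F y (c *\<^sub>R v)) x u = c *\<^sub>R dd (\<lambda>y. F y v) x u" for c v
      unfolding eq[of "c *\<^sub>R v"] eq[of v] by (simp add: scaleR_sum_right)
  qed
  assume V: "smooth_on S V"
  have Vi: "smooth_on S (\<lambda>y. V y $ i)" for i
    by (rule smooth_on_bounded_linear_compose[OF bounded_linear_vec_nth S V])
  have "smooth_on S (\<lambda>y. \<Sum>i\<in>UNIV. (V y$i) *\<^sub>R F y (axis i 1))"
    by (intro smooth_on_sum smooth_on_scaleR S Vi sm finite)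
  then show "smooth_on S (\<lambda>y. F y (V y))"
    by (rule smooth_on_cong[OF S, rotated]) (rule linear_vec_expand[OF lin, symmetric])
  assume x: "x \<in> S"
  have Vd: "((\<lambda>y. V y $ i) has_derivative (\<lambda>u. dd V x u $ i)) (at x)" for i
    by (rule bounded_linear.has_derivative[OF bounded_linear_vec_nth smooth_on_has_derivative[OF V x]])
  have "((\<lambda>y. \<Sum>i\<in>UNIV. (V y$i) *\<^sub>R F y (axis i 1)) has_derivative
     (\<lambda>u. \<Sum>i\<in>UNIV. (V x$i) *\<^sub>R dd (\<lambda>y. F y (axis i 1)) x u + (dd V x u $ i) *\<^sub>R F x (axis i 1))) (at x)"
    by (intro has_derivative_sum has_derivative_scaleR smooth_on_has_derivative[OF sm x] Vd)
  then have "((\<lambda>y. F y (V y)) has_derivative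
     (\<lambda>u. \<Sum>i\<in>UNIV. (V x$i) *\<^sub>R dd (\<lambda>y. F y (axis i 1)) x u + (dd V x u $ i) *\<^sub>R F x (axis i 1))) (at x)"
    by (rule has_derivative_transform_within_open[OF _ S x]) (rule linear_vec_expand[OF lin, symmetric])
  then show "((\<lambda>y. F y (V y)) has_derivative (\<lambda>u. dd (\<lambda>y. F y (V x)) x u + F x (dd V x u))) (at x)"
    by (simp add: sum.distrib 1[OF x, symmetric] linear_vec_expand[OF lin[OF x], symmetric])
qed

lemma fs_linear:
  "fs z (u + v) w = fs z u w + fs z v w" "fs z w (u + v) = fs z w u + fs z w v"
  "fs z (c *s v) w = cnj c * fs z v w" "fs z v (c *s w) = c * fs z v w"
  by (simp_all add: fs_def algebra_simps add_divide_distrib)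

lemma fs_cnj: "cnj (fs z v w) = fs z w v"
  by (simp add: fs_def b_form_cnj mult.commute)

lemma smooth_on_fs:
  assumes "open S" "smooth_on S z" "smooth_on S V" "smooth_on S W" "\<And>x. x \<in> S \<Longrightarrow> b_form (z x) (z x) \<noteq> 0"
  shows "smooth_on S (\<lambda>x. fs (z x) (V x) (W x))"
  unfolding fs_def power2_eq_square
  by (intro smooth_on_diff smooth_on_divide smooth_on_mult smooth_on_bilinear[OF bounded_bilinear_b_form])
     (use assms in auto)

text \<open>Independence means that the determinant does not vanish, so Cramer's rule provides the coefficients.\<close>

lemma two_dim_expand:
  fixes a b u :: "'a::field^2"
  assumes ind: "\<And>s t. s *s a + t *s b = 0 \<Longrightarrow> s = 0 \<and> t = 0"
  obtains s t where "u = s *s a + t *s b"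
proof -
  let ?d = "a$1 * b$2 - a$2 * b$1"
  have "?d \<noteq> 0"
  proof
    assume d: "?d = 0"
    have "(b$2) *s a + (- a$2) *s b = 0" "(b$1) *s a + (- a$1) *s b = 0"
      using d by (auto simp: vec_eq_iff forall_2 algebra_simps)
    from ind[OF this(1)] ind[OF this(2)] have "a = 0" by (simp add: vec_eq_iff forall_2)
    with ind[of 1 0] show False by simp
  qed
  then show ?thesis
    by (intro that[of "(u$1 * b$2 - u$2 * b$1) / ?d" "(a$1 * u$2 - a$2 * u$1) / ?d"])
      (simp add: vec_eq_iff forall_2 divide_simps, simp add: algebra_simps)
qed

text \<open>A coordinate piece of a Lorentzian surface in one affine chart, with a null frame.\<close>

locale framed_surface =
  fixes k :: 3 and f :: "real^2 \<Rightarrow> complex^2" and U :: "(real^2) set" and e1 e2 :: "real^2 \<Rightarrow> real^2"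
  assumes open_U: "open U" and smooth_f: "smooth_on U f"
    and pos_f: "\<And>x. x \<in> U \<Longrightarrow> pos (homog k (f x))"
    and frame: "null_frame_on U (pullback_metric (cp_metric k) f) e1 e2"
begin

abbreviation g :: "(real^2) metric_field" where "g \<equiv> pullback_metric (cp_metric k) f"

lemma g_eq: "x \<in> U \<Longrightarrow> g x u v = Re (fs (homog k (f x)) (ins k (dd f x u)) (ins k (dd f x v)))"
  by (simp add: pullback_metric_def cp_metric_eq[OF pos_f])

lemma g_linear:
  assumes "x \<in> U"
  shows "g x (u + v) w = g x u w + g x v w" "g x w (u + v) = g x w u + g x w v"
    "g x (c *\<^sub>R u) w = c * g x u w" "g x w (c *\<^sub>R u) = c * g x w u"
  by (simp_all add: g_eq assms smooth_on_dd_linear[OF smooth_f] ins_linear fs_linear scaleR_eq_smult)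

lemma g_sym: "x \<in> U \<Longrightarrow> g x u v = g x v u"
  using fs_cnj by (metis cnj.simps(1) g_eq)

lemma linear_g: "x \<in> U \<Longrightarrow> linear (g x u)" "x \<in> U \<Longrightarrow> linear (\<lambda>v. g x v u)"
  by (simp_all add: linearI g_linear)

lemma smooth_e: "smooth_on U e1" "smooth_on U e2"
  using frame by (simp_all add: null_frame_on_def)

lemma g_e: assumes "x \<in> U" shows "g x (e1 x) (e1 x) = 0" "g x (e2 x) (e2 x) = 0"
   "g x (e1 x) (e2 x) = -1" "g x (e2 x) (e1 x) = -1"
  using frame assms g_sym[OF assms, of "e1 x" "e2 x"] by (simp_all add: null_frame_on_def)

lemma smooth_homog: "smooth_on U (\<lambda>x. homog k (f x))"
  by (rule smooth_on_homog[OF open_U smooth_f])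

lemma smooth_df: "smooth_on U V \<Longrightarrow> smooth_on U (\<lambda>x. dd f x (V x))"
  by (rule linear_family_dd(3)[OF open_U]) 
    (auto intro: smooth_on_frechet_derivative smooth_f has_derivative_linear smooth_on_has_derivative)

lemma smooth_g:
  assumes "smooth_on U V" "smooth_on U W"
  shows "smooth_on U (\<lambda>x. g x (V x) (W x))"
proof -
  have "smooth_on U (\<lambda>x. Re (fs (homog k (f x)) (ins k (dd f x (V x))) (ins k (dd f x (W x)))))"
    by (intro smooth_on_bounded_linear_compose[OF bounded_linear_Re] smooth_on_fs open_U smooth_homog
        smooth_on_bounded_linear_compose[OF bounded_linear_ins] smooth_df assms pos_self pos_f)
  then show ?thesis by (rule smooth_on_cong[OF open_U, rotated]) (simp add: g_eq)
qed

lemma smooth_g_const: "smooth_on U (\<lambda>x. g x u v)"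
  by (intro smooth_g smooth_on_const open_U)

text \<open>The null frame is a basis, and $\langle e_1,e_2\rangle=-1$ makes $-\langle\cdot,e_2\rangle$,
  $-\langle\cdot,e_1\rangle$ the dual basis.\<close>

lemma frame_expand:
  assumes x: "x \<in> U"
  shows "u = - g x u (e2 x) *\<^sub>R e1 x - g x u (e1 x) *\<^sub>R e2 x"
proof -
  let ?a = "e1 x" and ?b = "e2 x"
  have ind: "s = 0 \<and> t = 0" if "s *\<^sub>R ?a + t *\<^sub>R ?b = 0" for s t
  proof -
    have "g x (s *\<^sub>R ?a + t *\<^sub>R ?b) ?b = - s" "g x (s *\<^sub>R ?a + t *\<^sub>R ?b) ?a = - t"
      by (simp_all add: g_linear[OF x] g_e[OF x])
    moreover have "g x 0 w = 0" for w using g_linear(3)[OF x, of 0 0 w] by simp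
    ultimately show ?thesis unfolding that by simp
  qed
  obtain s t where "u = s *s ?a + t *s ?b"
    using two_dim_expand[of ?a ?b u] ind by (metis scalar_mult_eq_scaleR)
  then have st: "u = s *\<^sub>R ?a + t *\<^sub>R ?b" by (simp add: scalar_mult_eq_scaleR)
  have "g x u ?b = - s" "g x u ?a = - t" unfolding st
    by (simp_all add: g_linear[OF x] g_e[OF x])
  then show ?thesis using st by simp
qed

definition koszul_form :: "real^2 \<Rightarrow> real^2 \<Rightarrow> real^2 \<Rightarrow> real^2 \<Rightarrow> real" where
  "koszul_form x u v w = dd (\<lambda>y. g y v w) x u + dd (\<lambda>y. g y u w) x v - dd (\<lambda>y. g y u v) x w"

lemma linear_dg:
  assumes "x \<in> U"
  shows "linear (\<lambda>v. dd (\<lambda>y. g y v w) x u)" "linear (\<lambda>v. dd (\<lambda>y. g y w v) x u)" "linear (\<lambda>v. dd (\<lambda>y. g y u w) x v)"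
  using assms linear_family_dd(2)[OF open_U linear_g(1) smooth_g_const] linear_family_dd(2)[OF open_U linear_g(2) smooth_g_const]
    has_derivative_linear[OF smooth_on_has_derivative[OF smooth_g_const]] by blast+

lemma linear_K: assumes "x \<in> U" shows "linear (koszul_form x u v)" "linear (\<lambda>v. koszul_form x u v w)"
  unfolding koszul_form_def by (intro linear_compose_add linear_compose_sub linear_dg assms)+

lemma smooth_K: "smooth_on U (\<lambda>x. koszul_form x u v w)"
  unfolding koszul_form_def by (intro smooth_on_add smooth_on_diff open_U smooth_on_frechet_derivative smooth_g_const)

lemma K_sym: "x \<in> U \<Longrightarrow> koszul_form x u v w = koszul_form x v u w"
  unfolding koszul_form_def using frechet_derivative_cong_open[OF open_U, of x "\<lambda>y. g y u v" "\<lambda>y. g y v u"] g_sym by simp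

abbreviation \<Gamma> :: "real^2 \<Rightarrow> real^2 \<Rightarrow> real^2 \<Rightarrow> real^2" where "\<Gamma> \<equiv> christoffel g"

lemma koszul_solution:
  assumes x: "x \<in> U"
  shows "2 * g x ((- (1/2) * koszul_form x u v (e2 x)) *\<^sub>R e1 x + (- (1/2) * koszul_form x u v (e1 x)) *\<^sub>R e2 x) w = koszul_form x u v w"
proof -
  have "koszul_form x u v w = koszul_form x u v (- g x w (e2 x) *\<^sub>R e1 x + (- g x w (e1 x)) *\<^sub>R e2 x)"
    using frame_expand[OF x, of w] by simp
  also have "\<dots> = - g x w (e2 x) * koszul_form x u v (e1 x) - g x w (e1 x) * koszul_form x u v (e2 x)"
    using linear_K(1)[OF x, of u v] by (simp add: linear_diff linear_cmul linear_neg)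
  finally show ?thesis
    unfolding g_linear[OF x] using g_sym[OF x] by (simp add: algebra_simps)
qed

text \<open>An explicit formula in the null frame, from which existence, linearity and smoothness of the Christoffel
  symbols of the induced metric all follow.\<close>

lemma christoffel_eq:
  assumes x: "x \<in> U"
  shows "\<Gamma> x u v = (- (1/2) * koszul_form x u v (e2 x)) *\<^sub>R e1 x + (- (1/2) * koszul_form x u v (e1 x)) *\<^sub>R e2 x"
proof (rule christoffel_eqI, fold koszul_form_def)
  show "2 * g x ((- (1/2) * koszul_form x u v (e2 x)) *\<^sub>R e1 x + (- (1/2) * koszul_form x u v (e1 x)) *\<^sub>R e2 x) w = koszul_form x u v w" for w
    by (rule koszul_solution[OF x])
next
  fix c d w show "g x (c - d) w = g x c w - g x d w"
    using linear_diff[OF linear_g(2)[OF x]] by blast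
next
  fix c assume "\<And>w. g x c w = 0"
  with frame_expand[OF x, of c] show "c = 0" by simp
qed

lemma koszul: "x \<in> U \<Longrightarrow> 2 * g x (\<Gamma> x u v) w = koszul_form x u v w"
  by (simp only: christoffel_eq koszul_solution)

lemma christoffel_sym: "x \<in> U \<Longrightarrow> \<Gamma> x u v = \<Gamma> x v u"
  using christoffel_eq K_sym by simp

lemma linear_christoffel: "x \<in> U \<Longrightarrow> linear (\<Gamma> x u)"
  by (rule linearI) (simp_all add: christoffel_eq linear_add[OF linear_K(2)] linear_cmul[OF linear_K(2)] algebra_simps)

lemma smooth_christoffel: "smooth_on U (\<lambda>x. \<Gamma> x u v)"
proof -
  have "smooth_on U (\<lambda>x. (- (1/2) * koszul_form x u v (e2 x)) *\<^sub>R e1 x + (- (1/2) * koszul_form x u v (e1 x)) *\<^sub>R e2 x)"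
    by (intro smooth_on_add smooth_on_scaleR smooth_on_mult open_U smooth_on_const smooth_e
        linear_family_dd(3)[OF open_U linear_K(1) smooth_K])
  then show ?thesis by (rule smooth_on_cong[OF open_U, rotated]) (simp add: christoffel_eq)
qed

lemma metric_compatible: "x \<in> U \<Longrightarrow> dd (\<lambda>y. g y v w) x u = g x (\<Gamma> x u v) w + g x v (\<Gamma> x u w)"
proof -
  assume x: "x \<in> U"
  have "2 * g x (\<Gamma> x u v) w + 2 * g x (\<Gamma> x u w) v = 2 * dd (\<lambda>y. g y v w) x u"
    unfolding koszul[OF x] koszul_form_def 
    using frechet_derivative_cong_open[OF open_U x, of "\<lambda>y. g y w v" "\<lambda>y. g y v w"] g_sym by simp
  then show ?thesis using g_sym[OF x] by simp
qed

definition cov :: "(real^2 \<Rightarrow> real^2) \<Rightarrow> real^2 \<Rightarrow> real^2 \<Rightarrow> real^2" where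
  "cov V x u = dd V x u + \<Gamma> x u (V x)"

lemma has_derivative_g:
  assumes x: "x \<in> U" and V: "smooth_on U V" and W: "smooth_on U W"
  shows "((\<lambda>y. g y (V y) (W y)) has_derivative (\<lambda>u. g x (cov V x u) (W x) + g x (V x) (cov W x u))) (at x)"
proof -
  have lin: "linear (\<lambda>v. g y v (W y))" if "y \<in> U" for y using linear_g(2)[OF that] .
  have sm: "smooth_on U (\<lambda>y. g y v (W y))" for v by (intro smooth_g smooth_on_const open_U W)
  have "((\<lambda>y. g y (V y) (W y)) has_derivative (\<lambda>u. dd (\<lambda>y. g y (V x) (W y)) x u + g x (dd V x u) (W x))) (at x)"
    by (rule linear_family_dd(4)[OF open_U lin sm V x])
  moreover have "((\<lambda>y. g y (V x) (W y)) has_derivative (\<lambda>u. dd (\<lambda>y. g y (V x) (W x)) x u + g x (V x) (dd W x u))) (at x)"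
    by (rule linear_family_dd(4)[OF open_U linear_g(1) smooth_g_const W x])
  ultimately show ?thesis
    by (simp add: frechet_derivative_eqI metric_compatible[OF x] cov_def g_linear[OF x] algebra_simps)
qed

text \<open>The connection form: metric compatibility and the constant products of the frame force
  $\nabla e_1=\omega e_1$ and $\nabla e_2=-\omega e_2$ (lemma \<open>cov_e\<close>).\<close>

definition \<omega> :: "real^2 \<Rightarrow> real^2 \<Rightarrow> real" where "\<omega> x u = - g x (cov e1 x u) (e2 x)"

lemma g_cov:
  assumes x: "x \<in> U" and V: "smooth_on U V" and W: "smooth_on U W" and c: "\<And>y. y \<in> U \<Longrightarrow> g y (V y) (W y) = c"
  shows "g x (cov V x u) (W x) + g x (V x) (cov W x u) = 0"
proof -
  have "((\<lambda>y. g y (V y) (W y)) has_derivative (\<lambda>u. 0)) (at x)"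
    by (rule has_derivative_transform_within_open[OF has_derivative_const[of c] open_U x]) (simp add: c)
  from has_derivative_unique[OF this has_derivative_g[OF x V W]] show ?thesis by metis
qed

lemma cov_e:
  assumes x: "x \<in> U"
  shows "cov e1 x u = \<omega> x u *\<^sub>R e1 x" "cov e2 x u = - \<omega> x u *\<^sub>R e2 x"
proof -
  note c = g_cov[OF x smooth_e(1) smooth_e(1) g_e(1), of u] g_cov[OF x smooth_e(2) smooth_e(2) g_e(2), of u]
     g_cov[OF x smooth_e(1) smooth_e(2) g_e(3), of u]
  have "g x (cov e1 x u) (e1 x) = 0" "g x (cov e2 x u) (e2 x) = 0" "g x (cov e2 x u) (e1 x) = \<omega> x u"
    using c g_sym[OF x] by (simp_all add: \<omega>_def)
  then show "cov e1 x u = \<omega> x u *\<^sub>R e1 x" "cov e2 x u = - \<omega> x u *\<^sub>R e2 x"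
    using frame_expand[OF x, of "cov e1 x u"] frame_expand[OF x, of "cov e2 x u"] by (simp_all add: \<omega>_def)
qed

lemma smooth_omega: "smooth_on U (\<lambda>x. \<omega> x u)"
  unfolding \<omega>_def cov_def
  by (intro smooth_on_minus smooth_g smooth_on_add open_U smooth_e smooth_on_frechet_derivative
      linear_family_dd(3)[OF open_U linear_christoffel smooth_christoffel])

text \<open>Antisymmetrising the second derivative of $e_1$, computed from $\partial_ve_1=\omega(v)e_1-\Gamma(v,e_1)$, yields
  $d\omega(u,v)\,e_1=R(u,v)e_1$.\<close>

lemma flat_imp_omega_closed:
  assumes x: "x \<in> U" and flat: "\<And>w. riemann_curvature g x u v w = 0"
  shows "dd (\<lambda>y. \<omega> y v) x u = dd (\<lambda>y. \<omega> y u) x v"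
proof -
  have de: "dd e1 y w = \<omega> y w *\<^sub>R e1 y - \<Gamma> y w (e1 y)" if "y \<in> U" for y w
    using cov_e(1)[OF that, of w] by (simp add: cov_def algebra_simps)
  have d2: "dd (\<lambda>y. dd e1 y v) x u = \<omega> x v *\<^sub>R dd e1 x u + dd (\<lambda>y. \<omega> y v) x u *\<^sub>R e1 x
      - (dd (\<lambda>y. \<Gamma> y v (e1 x)) x u + \<Gamma> x v (dd e1 x u))" for u v
  proof -
    have "((\<lambda>y. \<omega> y v *\<^sub>R e1 y - \<Gamma> y v (e1 y)) has_derivative (\<lambda>u. (\<omega> x v *\<^sub>R dd e1 x u + dd (\<lambda>y. \<omega> y v) x u *\<^sub>R e1 x)
      - (dd (\<lambda>y. \<Gamma> y v (e1 x)) x u + \<Gamma> x v (dd e1 x u)))) (at x)"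
      by (intro has_derivative_diff has_derivative_scaleR smooth_on_has_derivative[OF _ x] smooth_e smooth_omega
          linear_family_dd(4)[OF open_U linear_christoffel smooth_christoffel] x)
    then have "((\<lambda>y. dd e1 y v) has_derivative (\<lambda>u. (\<omega> x v *\<^sub>R dd e1 x u + dd (\<lambda>y. \<omega> y v) x u *\<^sub>R e1 x)
      - (dd (\<lambda>y. \<Gamma> y v (e1 x)) x u + \<Gamma> x v (dd e1 x u)))) (at x)"
      by (rule has_derivative_transform_within_open[OF _ open_U x]) (simp add: de)
    then show ?thesis by (simp add: frechet_derivative_eqI)
  qed
  have lin: "\<Gamma> x w (a *\<^sub>R e1 x - b) = a *\<^sub>R \<Gamma> x w (e1 x) - \<Gamma> x w b" for w a b
    using linear_christoffel[OF x, of w] by (simp add: linear_diff linear_cmul)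
  have "dd (\<lambda>y. dd e1 y v) x u = dd (\<lambda>y. dd e1 y u) x v"
    by (rule symmetric_second_derivative[OF open_U x smooth_e(1)])
  then have "dd (\<lambda>y. \<omega> y v) x u *\<^sub>R e1 x - dd (\<lambda>y. \<omega> y u) x v *\<^sub>R e1 x = riemann_curvature g x u v (e1 x)"
    unfolding d2 de[OF x] lin riemann_curvature_def by (simp add: algebra_simps)
  then have "(dd (\<lambda>y. \<omega> y v) x u - dd (\<lambda>y. \<omega> y u) x v) *\<^sub>R e1 x = 0"
    using flat by (simp add: scaleR_diff_left)
  moreover have "e1 x \<noteq> 0" using g_e(3)[OF x] g_linear(3)[OF x, of 0 "e1 x" "e2 x"] by auto
  ultimately show ?thesis by simp
qed

abbreviation II :: "real^2 \<Rightarrow> real^2 \<Rightarrow> real^2 \<Rightarrow> complex^2" where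
  "II \<equiv> second_fundamental_form (cp_metric k) f"

lemma linear_df: "x \<in> U \<Longrightarrow> linear (\<lambda>u. dd f x u)"
  by (rule has_derivative_linear[OF smooth_on_has_derivative[OF smooth_f]])

lemma cp_christoffel_sym: "x \<in> U \<Longrightarrow> christoffel (cp_metric k) (f x) u v = christoffel (cp_metric k) (f x) v u"
  by (simp add: cp_christoffel[OF pos_f])

lemma II_sym: "x \<in> U \<Longrightarrow> II x u v = II x v u"
  unfolding second_fundamental_form_def
  using symmetric_second_derivative[OF open_U _ smooth_f, of x v u] cp_christoffel_sym christoffel_sym by simp

lemma linear_cp_christoffel: "x \<in> U \<Longrightarrow> linear (christoffel (cp_metric k) (f x) u)"
  by (rule linearI)
     (simp_all add: cp_christoffel[OF pos_f] ins_linear scaleR_eq_smult vec_eq_iff add_divide_distrib algebra_simps)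

lemma linear_II: "x \<in> U \<Longrightarrow> linear (II x u)"
  unfolding second_fundamental_form_def
  by (intro linear_compose_add linear_compose_sub linear_family_dd(2)[OF open_U linear_df smooth_on_frechet_derivative[OF smooth_f]]
      linear_compose[OF linear_df linear_cp_christoffel, unfolded o_def]
      linear_compose[OF linear_christoffel linear_df, unfolded o_def])

text \<open>In a null frame the inverse metric is $-(e_1\otimes e_2+e_2\otimes e_1)$, so the trace of the second
  fundamental form is $-2h(e_1,e_2)$.\<close>

lemma minimal_imp_II:
  assumes x: "x \<in> U" and H: "mean_curvature (cp_metric k) f x = 0"
  shows "II x (e1 x) (e2 x) = 0"
proof -
  define G :: "real^2^2" where "G = (\<chi> i j. g x (axis i 1) (axis j 1))"
  define N :: "real^2^2" where "N = (\<chi> i j. - (e1 x $ i * e2 x $ j + e2 x $ i * e1 x $ j))"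
  have "(N ** G) $ i $ j = (axis j 1 :: real^2) $ i" for i j
  proof -
    have "(N ** G) $ i $ j = - (e1 x $ i * (\<Sum>k\<in>UNIV. (e2 x $ k) *\<^sub>R g x (axis k 1) (axis j 1))
        + e2 x $ i * (\<Sum>k\<in>UNIV. (e1 x $ k) *\<^sub>R g x (axis k 1) (axis j 1)))"
      by (simp add: N_def G_def matrix_matrix_mult_def sum_2 algebra_simps)
    also have "\<dots> = - (e1 x $ i * g x (e2 x) (axis j 1) + e2 x $ i * g x (e1 x) (axis j 1))"
      unfolding linear_vec_expand[OF linear_g(2)[OF x], symmetric] ..
    also have "\<dots> = (axis j 1 :: real^2) $ i"
      using arg_cong[OF frame_expand[OF x, of "axis j 1"], of "\<lambda>v. v $ i"] g_sym[OF x] by simp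
    finally show ?thesis .
  qed
  then have NG: "N ** G = mat 1" by (simp add: vec_eq_iff axis_def mat_def eq_commute)
  then have GN: "G ** N = mat 1" using matrix_left_right_inverse by blast
  have "G ** matrix_inv G = mat 1 \<and> matrix_inv G ** G = mat 1"
    unfolding matrix_inv_def by (rule someI[of _ N]) (simp add: GN NG)
  then have inv: "matrix_inv G = N"
    by (metis GN matrix_mul_assoc matrix_mul_lid matrix_mul_rid)
  have lin2: "linear (\<lambda>u. II x u w)" for w
    using linear_II[OF x, of w] II_sym[OF x] by (simp add: linear_iff)
  have "II x u w = (\<Sum>i\<in>UNIV. \<Sum>j\<in>UNIV. (u$i * w$j) *\<^sub>R II x (axis i 1) (axis j 1))" for u w
    by (subst linear_vec_expand[OF lin2], subst linear_vec_expand[OF linear_II[OF x]])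
       (simp add: scaleR_sum_right)
  note ex = this
  have "0 = (\<Sum>i\<in>UNIV. \<Sum>j\<in>UNIV. N $ i $ j *\<^sub>R II x (axis i 1) (axis j 1))"
    using H unfolding mean_curvature_def G_def[symmetric] Let_def inv by simp
  also have "\<dots> = - (II x (e1 x) (e2 x) + II x (e2 x) (e1 x))"
    unfolding ex[of "e1 x" "e2 x"] ex[of "e2 x" "e1 x"] by (simp add: N_def sum_2 algebra_simps scaleR_diff_left)
  also have "\<dots> = - (2 *\<^sub>R II x (e1 x) (e2 x))" using II_sym[OF x, of "e2 x" "e1 x"] by (simp add: scaleR_2)
  finally show ?thesis by simp
qed

end

section \<open>The lift to the pseudo-sphere\<close>

text \<open>The lift $Z$ is the positive multiple of the homogeneous coordinates on the pseudo-sphere; it is not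
  horizontal in general, and the imaginary form $a(u)=b(Z,\partial_uZ)$ measures the failure. \<open>Hl x V\<close> is the horizontal lift at
  $Z(x)$ of the chart vector $V$.\<close>

context framed_surface begin

definition h :: "real^2 \<Rightarrow> complex^3" where "h x = homog k (f x)"
definition sc :: "real^2 \<Rightarrow> real" where "sc x = Re (b_form (h x) (h x)) powr (- 1 / 2)"
definition Z :: "real^2 \<Rightarrow> complex^3" where "Z x = of_real (sc x) *s h x"
definition \<kappa> :: "real^2 \<Rightarrow> complex^2 \<Rightarrow> complex" where
  "\<kappa> x V = b_form (h x) (ins k V) / b_form (h x) (h x)"
definition Hl :: "real^2 \<Rightarrow> complex^2 \<Rightarrow> complex^3" where
  "Hl x V = of_real (sc x) *s ins k V - \<kappa> x V *s Z x"

lemma h_self: assumes "x \<in> U"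
  shows "Re (b_form (h x) (h x)) > 0" "b_form (h x) (h x) = of_real (Re (b_form (h x) (h x)))" "b_form (h x) (h x) \<noteq> 0"
  using pos_self[OF pos_f[OF assms]] by (simp_all add: h_def)

lemma sc_pos: "x \<in> U \<Longrightarrow> sc x > 0" using h_self[of x] by (simp add: sc_def)

lemma sc_sq: assumes "x \<in> U" shows "of_real (sc x) * of_real (sc x) * b_form (h x) (h x) = 1"
proof -
  have "sc x * sc x * Re (b_form (h x) (h x)) = 1"
  proof -
    have "sc x * sc x = Re (b_form (h x) (h x)) powr (- 1 / 2 + - 1 / 2)" by (simp only: sc_def powr_add)
    also have "\<dots> = inverse (Re (b_form (h x) (h x)))"
      using h_self(1)[OF assms] by (simp add: powr_minus)
    finally show ?thesis using h_self(1)[OF assms] by simp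
  qed
  then have "complex_of_real (sc x * sc x * Re (b_form (h x) (h x))) = of_real 1" by (rule arg_cong)
  then show ?thesis using h_self(2)[OF assms] by simp
qed

lemma smooth_h: "smooth_on U h"
  using smooth_homog by (simp add: h_def[abs_def])

lemma smooth_sc: "smooth_on U sc"
  unfolding sc_def[abs_def]
  by (intro smooth_on_powr open_U smooth_on_bounded_linear_compose[OF bounded_linear_Re]
      smooth_on_bilinear[OF bounded_bilinear_b_form] smooth_h h_self)

lemma smooth_of_real: "smooth_on U r \<Longrightarrow> smooth_on U (\<lambda>x. complex_of_real (r x))"
  by (rule smooth_on_bounded_linear_compose[OF bounded_linear_of_real open_U])

lemma smooth_Z: "smooth_on U Z"
  unfolding Z_def[abs_def]
  by (intro smooth_on_bilinear[OF bounded_bilinear_smult] open_U smooth_of_real smooth_sc smooth_h)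

lemma smooth_kappa: "smooth_on U V \<Longrightarrow> smooth_on U (\<lambda>x. \<kappa> x (V x))"
  unfolding \<kappa>_def
  by (intro smooth_on_divide open_U h_self smooth_on_bilinear[OF bounded_bilinear_b_form] smooth_h
      smooth_on_bounded_linear_compose[OF bounded_linear_ins])

lemma smooth_Hl: "smooth_on U V \<Longrightarrow> smooth_on U (\<lambda>x. Hl x (V x))"
  unfolding Hl_def
  by (intro smooth_on_diff smooth_on_bilinear[OF bounded_bilinear_smult] open_U smooth_of_real smooth_sc
      smooth_on_bounded_linear_compose[OF bounded_linear_ins] smooth_kappa smooth_Z)

lemma Hl_linear: "Hl x (V + W) = Hl x V + Hl x W" "Hl x (V - W) = Hl x V - Hl x W" "Hl x (c *s V) = c *s Hl x V"
  "Hl x (r *\<^sub>R V) = of_real r *s Hl x V"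
  by (simp_all add: Hl_def \<kappa>_def ins_linear scaleR_eq_smult vec_eq_iff add_divide_distrib diff_divide_distrib algebra_simps)

lemma b_Z: assumes "x \<in> U" shows "b_form (Z x) (Z x) = 1" "b_form (Z x) (Hl x V) = 0" "b_form (Hl x V) (Z x) = 0"
proof -
  show 1: "b_form (Z x) (Z x) = 1" using sc_sq[OF assms] by (simp add: Z_def mult.assoc)
  have "b_form (Z x) (Hl x V) = of_real (sc x) * of_real (sc x) * b_form (h x) (ins k V) - \<kappa> x V * b_form (Z x) (Z x)"
    by (simp add: Hl_def, simp add: Z_def)
  also have "\<dots> = 0" unfolding 1 using sc_sq[OF assms] h_self(3)[OF assms] by (simp add: \<kappa>_def field_simps)
  finally show 2: "b_form (Z x) (Hl x V) = 0" .
  show "b_form (Hl x V) (Z x) = 0" using arg_cong[OF 2, of cnj] by (simp add: b_form_cnj)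
qed

lemma b_Hl: assumes x: "x \<in> U" shows "b_form (Hl x V) (Hl x W) = fs (h x) (ins k V) (ins k W)"
proof -
  have "b_form (Hl x V) (Hl x W) = b_form (Hl x V) (of_real (sc x) *s ins k W)"
    using b_Z(3)[OF x] by (subst (2) Hl_def) simp
  also have "\<dots> = of_real (sc x) * of_real (sc x) * b_form (ins k V) (ins k W)
      - cnj (\<kappa> x V) * (of_real (sc x) * of_real (sc x)) * b_form (h x) (ins k W)"
    by (simp add: Hl_def Z_def algebra_simps)
  also have "of_real (sc x) * of_real (sc x) = 1 / b_form (h x) (h x)"
    using sc_sq[OF x] h_self(3)[OF x] by (simp add: field_simps)
  also have "cnj (\<kappa> x V) = b_form (ins k V) (h x) / b_form (h x) (h x)"
    by (simp add: \<kappa>_def b_form_cnj)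
  finally show ?thesis by (simp add: fs_def power2_eq_square)
qed

lemma g_Hl: "x \<in> U \<Longrightarrow> g x u v = Re (b_form (Hl x (dd f x u)) (Hl x (dd f x v)))"
  by (simp add: g_eq b_Hl h_def)

definition a :: "real^2 \<Rightarrow> real^2 \<Rightarrow> complex" where "a x u = b_form (Z x) (dd Z x u)"

lemma smooth_a: "smooth_on U (\<lambda>x. a x u)"
  unfolding a_def by (intro smooth_on_bilinear[OF bounded_bilinear_b_form] open_U smooth_Z smooth_on_frechet_derivative)

lemma dd_sc: "x \<in> U \<Longrightarrow> ((\<lambda>x. complex_of_real (sc x)) has_derivative (\<lambda>u. of_real (dd sc x u))) (at x)"
  by (rule bounded_linear.has_derivative[OF bounded_linear_of_real smooth_on_has_derivative[OF smooth_sc]])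

lemma h_has_derivative: "x \<in> U \<Longrightarrow> (h has_derivative (\<lambda>u. ins k (dd f x u))) (at x)"
  unfolding h_def[abs_def]
  by (rule has_derivative_compose[OF smooth_on_has_derivative[OF smooth_f] has_derivative_homog])

lemma dZ_aux:
  assumes x: "x \<in> U"
  shows "dd Z x u = (of_real (dd sc x u) / of_real (sc x) + \<kappa> x (dd f x u)) *s Z x + Hl x (dd f x u)"
proof -
  have "(Z has_derivative (\<lambda>u. of_real (sc x) *s ins k (dd f x u) + of_real (dd sc x u) *s h x)) (at x)"
    unfolding Z_def[abs_def]
    by (rule bounded_bilinear.FDERIV[OF bounded_bilinear_smult dd_sc[OF x] h_has_derivative[OF x]])
  then have "dd Z x u = of_real (sc x) *s ins k (dd f x u) + of_real (dd sc x u) *s h x"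
    by (simp add: frechet_derivative_eqI)
  also have "of_real (dd sc x u) *s h x = (of_real (dd sc x u) / of_real (sc x)) *s Z x"
    using sc_pos[OF x] by (simp add: Z_def)
  finally show ?thesis by (simp add: Hl_def vec_eq_iff algebra_simps)
qed

lemma a_eq: "x \<in> U \<Longrightarrow> a x u = of_real (dd sc x u) / of_real (sc x) + \<kappa> x (dd f x u)"
  unfolding a_def dZ_aux by (simp add: b_Z)

lemma dZ: "x \<in> U \<Longrightarrow> dd Z x u = a x u *s Z x + Hl x (dd f x u)"
  by (simp add: dZ_aux a_eq)

lemma b_form_const_derivative:
  assumes x: "x \<in> U" and V: "smooth_on U V" and W: "smooth_on U W"
    and c: "\<And>y. y \<in> U \<Longrightarrow> b_form (V y) (W y) = c"
  shows "b_form (V x) (dd W x u) + b_form (dd V x u) (W x) = 0"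
proof -
  have 1: "((\<lambda>y. b_form (V y) (W y)) has_derivative (\<lambda>u. b_form (V x) (dd W x u) + b_form (dd V x u) (W x))) (at x)"
    by (intro bounded_bilinear.FDERIV[OF bounded_bilinear_b_form] smooth_on_has_derivative[OF _ x] V W)
  have 2: "((\<lambda>y. b_form (V y) (W y)) has_derivative (\<lambda>u. 0)) (at x)"
    by (rule has_derivative_transform_within_open[OF has_derivative_const[of c] open_U x]) (simp add: c)
  show ?thesis using fun_cong[OF has_derivative_unique[OF 1 2]] .
qed

lemma cnj_a: "x \<in> U \<Longrightarrow> cnj (a x u) = - a x u"
proof -
  assume x: "x \<in> U"
  have "a x u + cnj (a x u) = 0"
    using b_form_const_derivative[OF x smooth_Z smooth_Z b_Z(1)] by (simp add: a_def b_form_cnj)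
  then show ?thesis by (metis add_eq_0_iff)
qed

text \<open>The Fubini-Study connection is the horizontal part of flat differentiation in $\mathbf C^3$,
  twisted by $a$: comparing the derivative of \<open>Hl\<close> with the explicit Christoffel symbols, the terms containing the derivative of
  the scale factor combine to $a$ because they are the ones in \<open>dZ_aux\<close>. Only the $Z$-component is then unknown, and
  differentiating $b(Z,H)=0$ gives it.\<close>

lemma dHl:
  assumes x: "x \<in> U" and V: "smooth_on U V"
  shows "dd (\<lambda>y. Hl y (V y)) x u = a x u *s Hl x (V x)
    + Hl x (dd V x u + christoffel (cp_metric k) (f x) (dd f x u) (V x))
    - b_form (Hl x (dd f x u)) (Hl x (V x)) *s Z x"
proof -
  let ?G = "christoffel (cp_metric k) (f x) (dd f x u) (V x)"
  have V': "((\<lambda>y. ins k (V y)) has_derivative (\<lambda>u. ins k (dd V x u))) (at x)"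
    by (rule bounded_linear.has_derivative[OF bounded_linear_ins smooth_on_has_derivative[OF V x]])
  have \<kappa>': "((\<lambda>y. \<kappa> y (V y)) has_derivative dd (\<lambda>y. \<kappa> y (V y)) x) (at x)"
    by (rule smooth_on_has_derivative[OF smooth_kappa[OF V] x])
  have "((\<lambda>y. Hl y (V y)) has_derivative (\<lambda>u. (of_real (sc x) *s ins k (dd V x u) + of_real (dd sc x u) *s ins k (V x))
     - (\<kappa> x (V x) *s dd Z x u + dd (\<lambda>y. \<kappa> y (V y)) x u *s Z x))) (at x)"
    unfolding Hl_def[abs_def]
    by (intro has_derivative_diff bounded_bilinear.FDERIV[OF bounded_bilinear_smult] dd_sc[OF x] V' \<kappa>' smooth_on_has_derivative[OF smooth_Z x])
  then have 1: "dd (\<lambda>y. Hl y (V y)) x u = (of_real (sc x) *s ins k (dd V x u) + of_real (dd sc x u) *s ins k (V x))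
     - (\<kappa> x (V x) *s dd Z x u + dd (\<lambda>y. \<kappa> y (V y)) x u *s Z x)"
    by (simp add: frechet_derivative_eqI)
  have 2: "of_real (dd sc x u) *s ins k (V x) = (of_real (dd sc x u) / of_real (sc x)) *s (Hl x (V x) + \<kappa> x (V x) *s Z x)"
    using sc_pos[OF x] by (simp add: Hl_def vec_eq_iff)
  have 3: "of_real (sc x) *s ins k (dd V x u) = Hl x (dd V x u) + \<kappa> x (dd V x u) *s Z x"
    by (simp add: Hl_def)
  have G: "?G = - \<kappa> x (dd f x u) *s V x - \<kappa> x (V x) *s dd f x u"
    unfolding cp_christoffel[OF pos_f[OF x]] \<kappa>_def h_def ..
  have HG: "Hl x (dd V x u + ?G) = Hl x (dd V x u) - \<kappa> x (dd f x u) *s Hl x (V x) - \<kappa> x (V x) *s Hl x (dd f x u)"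
    unfolding G Hl_linear by (simp add: vec_eq_iff)
  obtain c where c: "dd (\<lambda>y. Hl y (V y)) x u = a x u *s Hl x (V x) + Hl x (dd V x u + ?G) + c *s Z x"
    by (rule that[of "of_real (dd sc x u) / of_real (sc x) * \<kappa> x (V x) + \<kappa> x (dd V x u) - \<kappa> x (V x) * a x u - dd (\<lambda>y. \<kappa> y (V y)) x u"])
      (simp add: 1 2 3 HG dZ[OF x], simp add: a_eq[OF x] vec_eq_iff algebra_simps)
  have "b_form (Z x) (dd (\<lambda>y. Hl y (V y)) x u) + b_form (dd Z x u) (Hl x (V x)) = 0"
    by (rule b_form_const_derivative[OF x smooth_Z smooth_Hl[OF V] b_Z(2)])
  then have "c = - b_form (Hl x (dd f x u)) (Hl x (V x))"
    unfolding c dZ[OF x] by (simp add: b_Z[OF x] add_eq_0_iff)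
  then show ?thesis using c by (simp add: vec_eq_iff)
qed

text \<open>The Gauss formula for a tangent field that is not constant in coordinates.\<close>

lemma ambient_derivative_df:
  assumes x: "x \<in> U" and V: "smooth_on U V"
  shows "dd (\<lambda>y. dd f y (V y)) x u + christoffel (cp_metric k) (f x) (dd f x u) (dd f x (V x))
     = II x u (V x) + dd f x (cov V x u)"
proof -
  have "((\<lambda>y. dd f y (V y)) has_derivative (\<lambda>u. dd (\<lambda>y. dd f y (V x)) x u + dd f x (dd V x u))) (at x)"
    by (rule linear_family_dd(4)[OF open_U linear_df smooth_on_frechet_derivative[OF smooth_f] V x])
  then show ?thesis
    by (simp add: frechet_derivative_eqI second_fundamental_form_def cov_def smooth_on_dd_linear[OF smooth_f x])
qed

definition H1 where "H1 x = Hl x (dd f x (e1 x))"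
definition H2 where "H2 x = Hl x (dd f x (e2 x))"
definition \<theta>1 where "\<theta>1 x u = - g x u (e2 x)"
definition \<theta>2 where "\<theta>2 x u = - g x u (e1 x)"

lemma smooth_H: "smooth_on U H1" "smooth_on U H2"
  unfolding H1_def[abs_def] H2_def[abs_def] by (intro smooth_Hl smooth_df smooth_e)+

lemma smooth_theta: "smooth_on U (\<lambda>x. \<theta>1 x u)" "smooth_on U (\<lambda>x. \<theta>2 x u)"
  unfolding \<theta>1_def \<theta>2_def by (intro smooth_on_minus smooth_g smooth_e smooth_on_const open_U)+

lemma theta_expand: "x \<in> U \<Longrightarrow> u = \<theta>1 x u *\<^sub>R e1 x + \<theta>2 x u *\<^sub>R e2 x"
  using frame_expand[of x u] by (simp add: \<theta>1_def \<theta>2_def)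

lemma theta_e: "x \<in> U \<Longrightarrow> \<theta>1 x (e1 x) = 1" "x \<in> U \<Longrightarrow> \<theta>1 x (e2 x) = 0"
  "x \<in> U \<Longrightarrow> \<theta>2 x (e1 x) = 0" "x \<in> U \<Longrightarrow> \<theta>2 x (e2 x) = 1"
  by (simp_all add: \<theta>1_def \<theta>2_def g_e)

lemma Hl_df: "x \<in> U \<Longrightarrow> Hl x (dd f x u) = of_real (\<theta>1 x u) *s H1 x + of_real (\<theta>2 x u) *s H2 x"
  by (subst theta_expand[of x u]) (simp_all add: smooth_on_dd_linear[OF smooth_f] Hl_linear H1_def H2_def)

lemma b_H: assumes x: "x \<in> U" shows "b_form (H1 x) (H1 x) = 0" "b_form (H2 x) (H2 x) = 0" "Re (b_form (H1 x) (H2 x)) = -1"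
  "b_form (Z x) (H1 x) = 0" "b_form (Z x) (H2 x) = 0" "b_form (H1 x) (Z x) = 0" "b_form (H2 x) (Z x) = 0"
  using g_e[OF x] unfolding g_Hl[OF x] by (simp_all add: complex_eq_iff H1_def H2_def b_Z[OF x])

text \<open>The $H_i$ are null with $b(H_1,H_2)=\beta\neq0$, so they span the horizontal space over $\mathbf C$ and the
  coefficients are obtained by pairing with the other basis vector.\<close>

lemma Hl_expand:
  assumes x: "x \<in> U" and \<beta>: "b_form (H1 x) (H2 x) = \<beta>"
  shows "Hl x V = (b_form (H2 x) (Hl x V) / cnj \<beta>) *s H1 x + (b_form (H1 x) (Hl x V) / \<beta>) *s H2 x"
proof -
  have \<beta>0: "\<beta> \<noteq> 0" "cnj \<beta> \<noteq> 0" using b_H(3)[OF x] \<beta> by auto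
  have \<beta>': "b_form (H2 x) (H1 x) = cnj \<beta>" using \<beta> by (metis b_form_cnj)
  have lin: "Hl x (s *s dd f x (e1 x) + t *s dd f x (e2 x)) = s *s H1 x + t *s H2 x" for s t
    by (simp add: Hl_linear H1_def H2_def)
  have pair: "b_form (H1 x) (s *s H1 x + t *s H2 x) = t * \<beta>" "b_form (H2 x) (s *s H1 x + t *s H2 x) = s * cnj \<beta>" for s t
    by (simp_all add: b_H[OF x] \<beta> \<beta>')
  have "Hl x 0 = 0" using Hl_linear(3)[of x 0 0] by simp
  then have "s = 0 \<and> t = 0" if "s *s dd f x (e1 x) + t *s dd f x (e2 x) = 0" for s t
  proof -
    have "s *s H1 x + t *s H2 x = 0" using lin[of s t] that \<open>Hl x 0 = 0\<close> by simp
    then have "t * \<beta> = 0" "s * cnj \<beta> = 0" using pair[of s t] by simp_all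
    then show ?thesis using \<beta>0 by simp
  qed
  then obtain s t where "V = s *s dd f x (e1 x) + t *s dd f x (e2 x)"
    by (rule two_dim_expand)
  then show ?thesis using \<beta>0 by (simp only: lin pair) simp
qed

text \<open>The real part is $\langle e_1,e_2\rangle$; the imaginary part is $\langle Je_1,e_2\rangle$, which only sees the tangential part
  $\sinh\theta\,e_1$ of $Je_1$.\<close>

lemma wirtinger_gram:
  assumes x: "x \<in> U" and w: "wirtinger_angle_on U (cp_metric k) f e1 e2 (\<lambda>_. \<theta>)"
  shows "b_form (H1 x) (H2 x) = Complex (-1) (- sinh \<theta>)"
proof -
  let ?G = "cp_metric k (f x)"
  let ?\<xi> = "\<i> *s dd f x (e1 x)"
  have G: "?G V W = Re (b_form (Hl x V) (Hl x W))" for V W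
    by (simp add: cp_metric_eq[OF pos_f[OF x]] b_Hl[OF x] h_def)
  have Glin: "?G (V - W) w = ?G V w - ?G W w" for V W w by (simp add: G Hl_linear)
  have Gg: "?G (dd f x u) (dd f x v) = g x u v" for u v by (simp add: g_Hl[OF x] G)
  \<comment> \<open>the tangential component, expanded in the null frame\<close>
  define u where "u = - ?G ?\<xi> (dd f x (e2 x)) *\<^sub>R e1 x - ?G ?\<xi> (dd f x (e1 x)) *\<^sub>R e2 x"
  have lin: "linear (\<lambda>v. ?G ?\<xi> (dd f x v))"
    by (rule linearI) (simp_all add: G Hl_linear smooth_on_dd_linear[OF smooth_f x])
  have u: "?G (?\<xi> - dd f x u) (dd f x v) = 0" for v
  proof -
    have "?G ?\<xi> (dd f x v) = \<theta>1 x v * ?G ?\<xi> (dd f x (e1 x)) + \<theta>2 x v * ?G ?\<xi> (dd f x (e2 x))"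
      by (subst theta_expand[OF x, of v]) (simp add: linear_add[OF lin] linear_cmul[OF lin])
    also have "\<dots> = g x u v"
      unfolding u_def using g_sym[OF x]
      by (simp add: linear_diff[OF linear_g(1)[OF x]] linear_neg[OF linear_g(1)[OF x]] g_linear[OF x] \<theta>1_def \<theta>2_def)
    finally show ?thesis unfolding Glin Gg by simp
  qed
  have "tangential (cp_metric k) f x ?\<xi> = u"
    unfolding tangential_def
  proof (rule the_equality)
    show "\<forall>v. ?G (?\<xi> - dd f x u) (dd f x v) = 0" using u by blast
  next
    fix u' assume u': "\<forall>v. ?G (?\<xi> - dd f x u') (dd f x v) = 0"
    then have "g x (u - u') v = 0" for v
      using spec[OF u', of v] u[of v] unfolding Glin Gg linear_diff[OF linear_g(2)[OF x]] by simp
    then show "u' = u" using frame_expand[OF x, of "u - u'"] by simp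
  qed
  moreover have "tangential (cp_metric k) f x ?\<xi> = sinh \<theta> *\<^sub>R e1 x"
    using w x by (simp add: wirtinger_angle_on_def Let_def)
  ultimately have "g x u (e2 x) = sinh \<theta> * g x (e1 x) (e2 x)"
    by (metis g_linear(3)[OF x])
  then have "?G ?\<xi> (dd f x (e2 x)) = sinh \<theta> * g x (e1 x) (e2 x)"
    using u[of "e2 x"] unfolding Glin Gg by simp
  then have "Im (b_form (H1 x) (H2 x)) = - sinh \<theta>"
    by (simp add: G Hl_linear H1_def H2_def g_e[OF x])
  then show ?thesis using b_H(3)[OF x] by (simp add: complex_eq_iff)
qed

end

section \<open>Structure equations of a minimal flat slant surface\<close>

text \<open>Slantness enters only through the constant $\beta$.\<close>

locale minimal_flat_slant_patch = framed_surface +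
  fixes \<beta> :: complex
  assumes minimal: "\<And>x. x \<in> U \<Longrightarrow> mean_curvature (cp_metric k) f x = 0"
    and flat: "\<And>x u v w. x \<in> U \<Longrightarrow> riemann_curvature (pullback_metric (cp_metric k) f) x u v w = 0"
    and gram: "\<And>x. x \<in> U \<Longrightarrow> b_form (H1 x) (H2 x) = \<beta>"
    and nonempty: "U \<noteq> {}"
begin

lemma beta: "Re \<beta> = -1" "\<beta> \<noteq> 0" "cnj \<beta> \<noteq> 0"
proof -
  obtain x where "x \<in> U" using nonempty by blast
  then show "Re \<beta> = -1" using b_H(3) gram by metis
  then show "\<beta> \<noteq> 0" by auto
  then show "cnj \<beta> \<noteq> 0" by simp
qed

lemma gram': "x \<in> U \<Longrightarrow> b_form (H2 x) (H1 x) = cnj \<beta>"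
  using gram by (metis b_form_cnj)

text \<open>The functions $p$ and $q$ are the components of the second fundamental form: the lift of $h(e_1,e_1)$ is $pH_2$ and that
  of $h(e_2,e_2)$ is $qH_1$ (lemma \<open>Hl_II\<close>).\<close>

definition p where "p x = b_form (H1 x) (Hl x (II x (e1 x) (e1 x))) / \<beta>"
definition q where "q x = b_form (H2 x) (Hl x (II x (e2 x) (e2 x))) / cnj \<beta>"

lemma II_e: assumes x: "x \<in> U"
  shows "II x u (e1 x) = \<theta>1 x u *\<^sub>R II x (e1 x) (e1 x)" "II x u (e2 x) = \<theta>2 x u *\<^sub>R II x (e2 x) (e2 x)"
proof -
  have *: "II x w u = \<theta>1 x u *\<^sub>R II x w (e1 x) + \<theta>2 x u *\<^sub>R II x w (e2 x)" for w
    using arg_cong[OF theta_expand[OF x, of u], of "II x w"] linear_II[OF x, of w] by (simp add: linear_add linear_cmul)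
  have 12: "II x (e1 x) (e2 x) = 0" "II x (e2 x) (e1 x) = 0"
    using minimal_imp_II[OF x minimal[OF x]] II_sym[OF x] by metis+
  show "II x u (e1 x) = \<theta>1 x u *\<^sub>R II x (e1 x) (e1 x)" "II x u (e2 x) = \<theta>2 x u *\<^sub>R II x (e2 x) (e2 x)"
    using *[of "e1 x"] *[of "e2 x"] by (simp_all add: 12 II_sym[OF x, of u])
qed

lemma dH_aux:
  assumes x: "x \<in> U"
  shows "dd H1 x u = (a x u + of_real (\<omega> x u)) *s H1 x + of_real (\<theta>1 x u) *s Hl x (II x (e1 x) (e1 x))
      - (cnj \<beta> * of_real (\<theta>2 x u)) *s Z x"
    "dd H2 x u = (a x u - of_real (\<omega> x u)) *s H2 x + of_real (\<theta>2 x u) *s Hl x (II x (e2 x) (e2 x))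
      - (\<beta> * of_real (\<theta>1 x u)) *s Z x"
proof -
  have 1: "b_form (Hl x (dd f x u)) (H1 x) = cnj \<beta> * of_real (\<theta>2 x u)"
    "b_form (Hl x (dd f x u)) (H2 x) = \<beta> * of_real (\<theta>1 x u)"
    by (simp_all add: Hl_df[OF x] b_H[OF x] gram[OF x] gram'[OF x])
  have 2: "Hl x (dd f x (cov e1 x u)) = of_real (\<omega> x u) *s H1 x" "Hl x (dd f x (cov e2 x u)) = (- of_real (\<omega> x u)) *s H2 x"
    by (simp_all only: cov_e[OF x] smooth_on_dd_linear[OF smooth_f x] Hl_linear of_real_minus H1_def H2_def)
  have 3: "dd H1 x u = a x u *s H1 x + Hl x (II x u (e1 x) + dd f x (cov e1 x u)) - b_form (Hl x (dd f x u)) (H1 x) *s Z x"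
    "dd H2 x u = a x u *s H2 x + Hl x (II x u (e2 x) + dd f x (cov e2 x u)) - b_form (Hl x (dd f x u)) (H2 x) *s Z x"
    using dHl[OF x smooth_df[OF smooth_e(1)], of u] dHl[OF x smooth_df[OF smooth_e(2)], of u]
    unfolding ambient_derivative_df[OF x smooth_e(1)] ambient_derivative_df[OF x smooth_e(2)]
    by (simp_all add: H1_def[abs_def] H2_def[abs_def])
  show "dd H1 x u = (a x u + of_real (\<omega> x u)) *s H1 x + of_real (\<theta>1 x u) *s Hl x (II x (e1 x) (e1 x))
      - (cnj \<beta> * of_real (\<theta>2 x u)) *s Z x"
    "dd H2 x u = (a x u - of_real (\<omega> x u)) *s H2 x + of_real (\<theta>2 x u) *s Hl x (II x (e2 x) (e2 x))
      - (\<beta> * of_real (\<theta>1 x u)) *s Z x"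
    unfolding 3 1 II_e[OF x, of u] Hl_linear 2 by (simp_all add: vec_eq_iff algebra_simps)
qed

text \<open>All four statements express that the Gram matrix of $H_1,H_2$ is constant. Differentiating $b(H_1,H_2)$ along $e_1$ and
  $e_2$ removes the components along $H_1$ and $H_2$ respectively; differentiating $b(H_i,H_i)=0$ removes the real parts.\<close>

lemma Hl_II:
  assumes x: "x \<in> U"
  shows "Hl x (II x (e1 x) (e1 x)) = p x *s H2 x" "Hl x (II x (e2 x) (e2 x)) = q x *s H1 x"
    "Re (p x * \<beta>) = 0" "Re (q x * cnj \<beta>) = 0"
proof -
  let ?P = "Hl x (II x (e1 x) (e1 x))" and ?Q = "Hl x (II x (e2 x) (e2 x))"
  note b = b_H[OF x] gram[OF x] gram'[OF x] theta_e[OF x] b_Z[OF x] cnj_a[OF x]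
  have "b_form (H1 x) (dd H2 x u) + b_form (dd H1 x u) (H2 x) = 0" for u
    by (rule b_form_const_derivative[OF x smooth_H gram])
  from this[of "e1 x"] this[of "e2 x"]
  have "b_form ?P (H2 x) = 0" "b_form (H1 x) ?Q = 0"
    unfolding dH_aux[OF x] by (simp_all add: b algebra_simps)
  then have 0: "b_form (H2 x) ?P = 0" "b_form (H1 x) ?Q = 0" by (metis b_form_cnj complex_cnj_zero_iff)+
  show "?P = p x *s H2 x" using Hl_expand[OF x gram[OF x], of "II x (e1 x) (e1 x)"] 0 by (simp add: p_def)
  show "?Q = q x *s H1 x" using Hl_expand[OF x gram[OF x], of "II x (e2 x) (e2 x)"] 0 by (simp add: q_def)
  have "b_form (H1 x) (dd H1 x u) + b_form (dd H1 x u) (H1 x) = 0"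
    "b_form (H2 x) (dd H2 x u) + b_form (dd H2 x u) (H2 x) = 0" for u
    using b_form_const_derivative[OF x smooth_H(1) smooth_H(1) b_H(1)]
      b_form_const_derivative[OF x smooth_H(2) smooth_H(2) b_H(2)] by blast+
  from this(1)[of "e1 x"] this(2)[of "e2 x"]
  have "b_form (H1 x) ?P + b_form ?P (H1 x) = 0" "b_form (H2 x) ?Q + b_form ?Q (H2 x) = 0"
    unfolding dH_aux[OF x] by (simp_all add: b)
  moreover have "b_form (H1 x) ?P = p x * \<beta>" "b_form (H2 x) ?Q = q x * cnj \<beta>"
    using beta by (simp_all add: p_def q_def)
  ultimately have "p x * \<beta> + cnj (p x * \<beta>) = 0" "q x * cnj \<beta> + cnj (q x * cnj \<beta>) = 0"
    by (metis b_form_cnj)+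
  moreover have "Re z = 0" if "z + cnj z = 0" for z using arg_cong[OF that, of Re] by simp
  ultimately show "Re (p x * \<beta>) = 0" "Re (q x * cnj \<beta>) = 0" by blast+
qed

lemma dZ': "x \<in> U \<Longrightarrow> dd Z x u = a x u *s Z x + of_real (\<theta>1 x u) *s H1 x + of_real (\<theta>2 x u) *s H2 x"
  by (simp add: dZ Hl_df)

lemma dH1: "x \<in> U \<Longrightarrow> dd H1 x u = - (cnj \<beta> * of_real (\<theta>2 x u)) *s Z x
    + (a x u + of_real (\<omega> x u)) *s H1 x + (p x * of_real (\<theta>1 x u)) *s H2 x"
  by (simp add: dH_aux Hl_II vec_eq_iff algebra_simps)

lemma dH2: "x \<in> U \<Longrightarrow> dd H2 x u = - (\<beta> * of_real (\<theta>1 x u)) *s Z x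
    + (q x * of_real (\<theta>2 x u)) *s H1 x + (a x u - of_real (\<omega> x u)) *s H2 x"
  by (simp add: dH_aux Hl_II vec_eq_iff algebra_simps)

lemma smooth_dd: "smooth_on U F \<Longrightarrow> smooth_on U V \<Longrightarrow> smooth_on U (\<lambda>x. dd F x (V x))"
  by (rule linear_family_dd(3)[OF open_U has_derivative_linear[OF smooth_on_has_derivative] smooth_on_frechet_derivative])

lemma smooth_p: "smooth_on U p" "smooth_on U q"
proof -
  have 1: "smooth_on U (\<lambda>x. b_form (H1 x) (dd H1 x (e1 x)) / \<beta>)" and 2: "smooth_on U (\<lambda>x. b_form (H2 x) (dd H2 x (e2 x)) / cnj \<beta>)"
    by (intro smooth_on_divide open_U beta smooth_on_const smooth_on_bilinear[OF bounded_bilinear_b_form] smooth_H smooth_e smooth_dd)+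
  show "smooth_on U p"
    by (rule smooth_on_cong[OF open_U _ 1]) (simp add: dH1 b_H gram gram' theta_e beta)
  show "smooth_on U q"
    by (rule smooth_on_cong[OF open_U _ 2]) (simp add: dH2 b_H gram gram' theta_e beta)
qed

text \<open>The product rule in the moving frame; with it mixed second derivatives of the frame vectors can be compared component by
  component.\<close>

lemma dd_coef:
  assumes x: "x \<in> U" and c: "smooth_on U c0" "smooth_on U c1" "smooth_on U c2"
    and F: "\<forall>y\<in>U. F y = c0 y *s Z y + c1 y *s H1 y + c2 y *s H2 y"
  shows "dd F x u =
     (dd c0 x u + c0 x * a x u - c1 x * cnj \<beta> * of_real (\<theta>2 x u) - c2 x * \<beta> * of_real (\<theta>1 x u)) *s Z x
   + (dd c1 x u + c0 x * of_real (\<theta>1 x u) + c1 x * (a x u + of_real (\<omega> x u)) + c2 x * q x * of_real (\<theta>2 x u)) *s H1 x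
   + (dd c2 x u + c0 x * of_real (\<theta>2 x u) + c1 x * p x * of_real (\<theta>1 x u) + c2 x * (a x u - of_real (\<omega> x u))) *s H2 x"
proof -
  have "((\<lambda>y. c0 y *s Z y + c1 y *s H1 y + c2 y *s H2 y) has_derivative
     (\<lambda>u. c0 x *s dd Z x u + dd c0 x u *s Z x + (c1 x *s dd H1 x u + dd c1 x u *s H1 x)
        + (c2 x *s dd H2 x u + dd c2 x u *s H2 x))) (at x)"
    by (intro has_derivative_add bounded_bilinear.FDERIV[OF bounded_bilinear_smult] smooth_on_has_derivative[OF _ x] c smooth_Z smooth_H)
  then have "(F has_derivative
     (\<lambda>u. c0 x *s dd Z x u + dd c0 x u *s Z x + (c1 x *s dd H1 x u + dd c1 x u *s H1 x)
        + (c2 x *s dd H2 x u + dd c2 x u *s H2 x))) (at x)"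
    by (rule has_derivative_transform_within_open[OF _ open_U x]) (simp add: F)
  then have "dd F x u = c0 x *s dd Z x u + dd c0 x u *s Z x + (c1 x *s dd H1 x u + dd c1 x u *s H1 x)
        + (c2 x *s dd H2 x u + dd c2 x u *s H2 x)" by (simp add: frechet_derivative_eqI)
  then show ?thesis unfolding dZ'[OF x] dH1[OF x] dH2[OF x] by (simp add: vec_eq_iff algebra_simps)
qed

lemma frame_independent:
  assumes x: "x \<in> U" and eq: "s0 *s Z x + s1 *s H1 x + s2 *s H2 x = t0 *s Z x + t1 *s H1 x + t2 *s H2 x"
  shows "s0 = t0" "s1 = t1" "s2 = t2"
proof -
  note b = b_H[OF x] gram[OF x] gram'[OF x] b_Z[OF x]
  show "s0 = t0" using arg_cong[OF eq, of "b_form (Z x)"] by (simp add: b)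
  show "s1 = t1" using arg_cong[OF eq, of "b_form (H2 x)"] beta by (simp add: b)
  show "s2 = t2" using arg_cong[OF eq, of "b_form (H1 x)"] beta by (simp add: b)
qed

lemma dd_complex_of_real:
  "smooth_on U r \<Longrightarrow> x \<in> U \<Longrightarrow> dd (\<lambda>y. complex_of_real (r y)) x u = of_real (dd r x u)"
  by (simp add: frechet_derivative_eqI[OF bounded_linear.has_derivative[OF bounded_linear_of_real smooth_on_has_derivative]])

text \<open>The symmetry of second derivatives of $Z$: curvature of the Hopf connection and vanishing torsion.\<close>

lemma integrability_Z:
  assumes x: "x \<in> U"
  shows "dd (\<lambda>y. a y v) x u - dd (\<lambda>y. a y u) x v
      = (\<beta> - cnj \<beta>) * of_real (\<theta>1 x u * \<theta>2 x v - \<theta>1 x v * \<theta>2 x u)"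
    and "dd (\<lambda>y. \<theta>1 y v) x u - dd (\<lambda>y. \<theta>1 y u) x v = - (\<theta>1 x v * \<omega> x u - \<theta>1 x u * \<omega> x v)"
    and "dd (\<lambda>y. \<theta>2 y v) x u - dd (\<lambda>y. \<theta>2 y u) x v = \<theta>2 x v * \<omega> x u - \<theta>2 x u * \<omega> x v"
proof -
  note c = smooth_a smooth_of_real[OF smooth_theta(1)] smooth_of_real[OF smooth_theta(2)]
  note s = symmetric_second_derivative[OF open_U x smooth_Z, of v u]
  have F: "\<forall>y\<in>U. dd Z y w = a y w *s Z y + of_real (\<theta>1 y w) *s H1 y + of_real (\<theta>2 y w) *s H2 y" for w
    using dZ' by blast
  note exu = dd_coef[where F = "\<lambda>y. dd Z y u" and ?c0.0 = "\<lambda>y. a y u" and ?c1.0 = "\<lambda>y. of_real (\<theta>1 y u)"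
      and ?c2.0 = "\<lambda>y. of_real (\<theta>2 y u)", OF x c F]
  note exv = dd_coef[where F = "\<lambda>y. dd Z y v" and ?c0.0 = "\<lambda>y. a y v" and ?c1.0 = "\<lambda>y. of_real (\<theta>1 y v)"
      and ?c2.0 = "\<lambda>y. of_real (\<theta>2 y v)", OF x c F]
  note e = s[unfolded exv exu dd_complex_of_real[OF smooth_theta(1) x] dd_complex_of_real[OF smooth_theta(2) x]]
  show "dd (\<lambda>y. a y v) x u - dd (\<lambda>y. a y u) x v
      = (\<beta> - cnj \<beta>) * of_real (\<theta>1 x u * \<theta>2 x v - \<theta>1 x v * \<theta>2 x u)"
    using frame_independent(1)[OF x e] by (simp add: algebra_simps)
  have "complex_of_real (dd (\<lambda>y. \<theta>1 y v) x u - dd (\<lambda>y. \<theta>1 y u) x v) = of_real (- (\<theta>1 x v * \<omega> x u - \<theta>1 x u * \<omega> x v))"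
    using frame_independent(2)[OF x e] by (simp add: algebra_simps)
  then show "dd (\<lambda>y. \<theta>1 y v) x u - dd (\<lambda>y. \<theta>1 y u) x v = - (\<theta>1 x v * \<omega> x u - \<theta>1 x u * \<omega> x v)"
    by (simp only: of_real_eq_iff)
  have "complex_of_real (dd (\<lambda>y. \<theta>2 y v) x u - dd (\<lambda>y. \<theta>2 y u) x v) = of_real (\<theta>2 x v * \<omega> x u - \<theta>2 x u * \<omega> x v)"
    using frame_independent(3)[OF x e] by (simp add: algebra_simps)
  then show "dd (\<lambda>y. \<theta>2 y v) x u - dd (\<lambda>y. \<theta>2 y u) x v = \<theta>2 x v * \<omega> x u - \<theta>2 x u * \<omega> x v"
    by (simp only: of_real_eq_iff)
qed

lemma dd_of_real_mult:
  assumes "smooth_on U c" "smooth_on U r" "x \<in> U"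
  shows "dd (\<lambda>y. c y * complex_of_real (r y)) x u = c x * of_real (dd r x u) + dd c x u * of_real (r x)"
proof -
  have "((\<lambda>y. c y * complex_of_real (r y)) has_derivative (\<lambda>u. c x * of_real (dd r x u) + dd c x u * of_real (r x))) (at x)"
    by (intro has_derivative_mult smooth_on_has_derivative[OF assms(1,3)]
      bounded_linear.has_derivative[OF bounded_linear_of_real smooth_on_has_derivative[OF assms(2,3)]])
  then show ?thesis by (simp add: frechet_derivative_eqI)
qed

lemma dd_add:
  assumes "smooth_on U c" "smooth_on U d" "x \<in> U"
  shows "dd (\<lambda>y. c y + d y) x u = dd c x u + dd d x u"
  using frechet_derivative_eqI[OF has_derivative_add[OF smooth_on_has_derivative[OF assms(1,3)] smooth_on_has_derivative[OF assms(2,3)]]]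
  by simp

text \<open>The first equation combines the Gauss equation for a flat surface with the curvature of the Hopf connection, which is the
  source of the coefficient $2$; the second is a Codazzi equation. Both are read off in the directions $e_1,e_2$, where the dual
  forms have the values $0$ and $1$.\<close>

lemma integrability_H1:
  assumes x: "x \<in> U"
  shows "\<beta> - 2 * cnj \<beta> = p x * q x" "dd p x (e2 x) = 3 * p x * of_real (\<omega> x (e2 x))"
proof -
  have c0: "smooth_on U (\<lambda>y. - cnj \<beta> * of_real (\<theta>2 y v))" for v
    by (intro smooth_on_mult open_U smooth_on_const smooth_of_real smooth_theta)
  have c1: "smooth_on U (\<lambda>y. a y v + of_real (\<omega> y v))" for v
    by (intro smooth_on_add open_U smooth_a smooth_of_real smooth_omega)
  have c2: "smooth_on U (\<lambda>y. p y * of_real (\<theta>1 y v))" for v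
    by (intro smooth_on_mult open_U smooth_p smooth_of_real smooth_theta)
  define u where "u = e1 x"
  define v where "v = e2 x"
  have \<theta>: "\<theta>1 x u = 1" "\<theta>1 x v = 0" "\<theta>2 x u = 0" "\<theta>2 x v = 1"
    using theta_e[OF x] by (simp_all add: u_def v_def)
  note s = symmetric_second_derivative[OF open_U x smooth_H(1), of v u]
  have F: "\<forall>y\<in>U. dd H1 y w = (- cnj \<beta> * of_real (\<theta>2 y w)) *s Z y + (a y w + of_real (\<omega> y w)) *s H1 y
      + (p y * of_real (\<theta>1 y w)) *s H2 y" for w
    by (simp add: dH1)
  note exu = dd_coef[where F = "\<lambda>y. dd H1 y u" and ?c0.0 = "\<lambda>y. - cnj \<beta> * of_real (\<theta>2 y u)"
      and ?c1.0 = "\<lambda>y. a y u + of_real (\<omega> y u)" and ?c2.0 = "\<lambda>y. p y * of_real (\<theta>1 y u)",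
      OF x c0 c1 c2 F]
  note exv = dd_coef[where F = "\<lambda>y. dd H1 y v" and ?c0.0 = "\<lambda>y. - cnj \<beta> * of_real (\<theta>2 y v)"
      and ?c1.0 = "\<lambda>y. a y v + of_real (\<omega> y v)" and ?c2.0 = "\<lambda>y. p y * of_real (\<theta>1 y v)",
      OF x c0 c1 c2 F]
  note e = s[unfolded exv exu
      dd_of_real_mult[OF smooth_p(1) smooth_theta(1) x] dd_add[OF smooth_a smooth_of_real[OF smooth_omega] x]
      dd_complex_of_real[OF smooth_omega x] \<theta>]
  have om: "dd (\<lambda>y. \<omega> y v) x u = dd (\<lambda>y. \<omega> y u) x v"
    by (rule flat_imp_omega_closed[OF x flat[OF x]])
  have da: "dd (\<lambda>y. a y v) x u = dd (\<lambda>y. a y u) x v + (\<beta> - cnj \<beta>)"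
    using integrability_Z(1)[OF x, of v u] \<theta> by (simp add: algebra_simps)
  show "\<beta> - 2 * cnj \<beta> = p x * q x"
    using frame_independent(2)[OF x e] by (simp add: om da algebra_simps)
  have d\<theta>: "complex_of_real (dd (\<lambda>y. \<theta>1 y v) x u) = of_real (dd (\<lambda>y. \<theta>1 y u) x v + \<omega> x v)"
    using integrability_Z(2)[OF x, of v u] \<theta> by (simp add: algebra_simps)
  show "dd p x (e2 x) = 3 * p x * of_real (\<omega> x (e2 x))"
    using frame_independent(3)[OF x e] unfolding v_def[symmetric]
    by (simp add: d\<theta> algebra_simps)
qed

lemma integrability_H2:
  assumes x: "x \<in> U"
  shows "dd q x (e1 x) = - 3 * q x * of_real (\<omega> x (e1 x))"
proof -
  have c0: "smooth_on U (\<lambda>y. - \<beta> * of_real (\<theta>1 y v))" for v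
    by (intro smooth_on_mult open_U smooth_on_const smooth_of_real smooth_theta)
  have c1: "smooth_on U (\<lambda>y. q y * of_real (\<theta>2 y v))" for v
    by (intro smooth_on_mult open_U smooth_p smooth_of_real smooth_theta)
  have c2: "smooth_on U (\<lambda>y. a y v - of_real (\<omega> y v))" for v
    by (intro smooth_on_diff open_U smooth_a smooth_of_real smooth_omega)
  define u where "u = e1 x"
  define v where "v = e2 x"
  have \<theta>: "\<theta>1 x u = 1" "\<theta>1 x v = 0" "\<theta>2 x u = 0" "\<theta>2 x v = 1"
    using theta_e[OF x] by (simp_all add: u_def v_def)
  note s = symmetric_second_derivative[OF open_U x smooth_H(2), of v u]
  have F: "\<forall>y\<in>U. dd H2 y w = (- \<beta> * of_real (\<theta>1 y w)) *s Z y + (q y * of_real (\<theta>2 y w)) *s H1 y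
      + (a y w - of_real (\<omega> y w)) *s H2 y" for w
    by (simp add: dH2)
  note exu = dd_coef[where F = "\<lambda>y. dd H2 y u" and ?c0.0 = "\<lambda>y. - \<beta> * of_real (\<theta>1 y u)"
      and ?c1.0 = "\<lambda>y. q y * of_real (\<theta>2 y u)" and ?c2.0 = "\<lambda>y. a y u - of_real (\<omega> y u)",
      OF x c0 c1 c2 F]
  note exv = dd_coef[where F = "\<lambda>y. dd H2 y v" and ?c0.0 = "\<lambda>y. - \<beta> * of_real (\<theta>1 y v)"
      and ?c1.0 = "\<lambda>y. q y * of_real (\<theta>2 y v)" and ?c2.0 = "\<lambda>y. a y v - of_real (\<omega> y v)",
      OF x c0 c1 c2 F]
  note e = s[unfolded exv exu
      dd_of_real_mult[OF smooth_p(2) smooth_theta(2) x] \<theta>]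
  have d\<theta>: "complex_of_real (dd (\<lambda>y. \<theta>2 y v) x u) = of_real (dd (\<lambda>y. \<theta>2 y u) x v + \<omega> x u)"
    using integrability_Z(3)[OF x, of v u] \<theta> by (simp add: algebra_simps)
  show "dd q x (e1 x) = - 3 * q x * of_real (\<omega> x (e1 x))"
    using frame_independent(2)[OF x e] unfolding u_def[symmetric]
    by (simp add: d\<theta> algebra_simps eq_neg_iff_add_eq_0)
qed

text \<open>The product of the imaginary numbers $p\beta$ and $q\bar\beta$ is real, hence so is $pq=\beta-2\bar\beta$, whose imaginary part is
  $3\,\mathrm{Im}\,\beta$.\<close>

theorem beta_eq: "\<beta> = -1"
proof -
  obtain x where x: "x \<in> U" using nonempty by blast
  have "Im ((p x * \<beta>) * (q x * cnj \<beta>)) = 0" using Hl_II(3,4)[OF x] by simp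
  moreover have "(p x * \<beta>) * (q x * cnj \<beta>) = (p x * q x) * (\<beta> * cnj \<beta>)" by (simp add: mult_ac)
  ultimately have "Im ((p x * q x) * of_real ((cmod \<beta>)^2)) = 0" by (simp only: complex_norm_square[symmetric] of_real_power)
  then have "Im (p x * q x) * (cmod \<beta>)^2 = 0" by simp
  then have "Im (\<beta> - 2 * cnj \<beta>) = 0" using beta integrability_H1(1)[OF x] by simp
  then show ?thesis using beta(1) by (simp add: complex_eq_iff)
qed

lemma p_q: "x \<in> U \<Longrightarrow> p x * q x = 1" "x \<in> U \<Longrightarrow> Re (p x) = 0"
  using integrability_H1(1)[of x] Hl_II(3)[of x] by (simp_all add: beta_eq)

lemma linear_omega: "x \<in> U \<Longrightarrow> linear (\<omega> x)"
  unfolding \<omega>_def cov_def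
  by (rule linearI) (simp_all add: smooth_on_dd_linear[OF smooth_e(1)] g_linear christoffel_sym[of x _ "e1 x"]
      linear_add[OF linear_christoffel] linear_cmul[OF linear_christoffel] algebra_simps)

text \<open>The Codazzi equations give $dp(e_2)$ and $dq(e_1)$; since $q=1/p$, the latter is the missing derivative of $p$.\<close>

lemma dd_p:
  assumes x: "x \<in> U" shows "dd p x u = 3 * p x * of_real (\<omega> x u)"
proof -
  have "((\<lambda>y. p y * q y) has_derivative (\<lambda>u. p x * dd q x u + dd p x u * q x)) (at x)"
    by (intro has_derivative_mult smooth_on_has_derivative[OF _ x] smooth_p)
  moreover have "((\<lambda>y. p y * q y) has_derivative (\<lambda>u. 0)) (at x)"
    by (rule has_derivative_transform_within_open[OF has_derivative_const[of 1] open_U x]) (simp add: p_q)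
  ultimately have "(\<lambda>u. p x * dd q x u + dd p x u * q x) = (\<lambda>u. 0)"
    by (rule has_derivative_unique)
  from fun_cong[OF this, of "e1 x"] have "q x * dd p x (e1 x) = q x * (3 * p x * of_real (\<omega> x (e1 x)))"
    unfolding integrability_H2[OF x] by (simp add: algebra_simps)
  moreover have "q x \<noteq> 0" using p_q(1)[OF x] by auto
  ultimately have 1: "dd p x (e1 x) = 3 * p x * of_real (\<omega> x (e1 x))" by simp
  have "dd p x u = of_real (\<theta>1 x u) * dd p x (e1 x) + of_real (\<theta>2 x u) * dd p x (e2 x)"
  proof -
    have "dd p x (\<theta>1 x u *\<^sub>R e1 x + \<theta>2 x u *\<^sub>R e2 x) = \<theta>1 x u *\<^sub>R dd p x (e1 x) + \<theta>2 x u *\<^sub>R dd p x (e2 x)"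
      by (simp only: smooth_on_dd_linear[OF smooth_p(1) x])
    then show ?thesis using theta_expand[OF x, of u] by (simp add: scaleR_conv_of_real[where 'a=complex])
  qed
  also have "\<dots> = 3 * p x * of_real (\<theta>1 x u * \<omega> x (e1 x) + \<theta>2 x u * \<omega> x (e2 x))"
    unfolding 1 integrability_H1(2)[OF x] by (simp add: algebra_simps)
  also have "\<theta>1 x u * \<omega> x (e1 x) + \<theta>2 x u * \<omega> x (e2 x) = \<omega> x u"
    using arg_cong[OF theta_expand[OF x, of u], of "\<omega> x"]
    by (simp add: linear_add[OF linear_omega[OF x]] linear_cmul[OF linear_omega[OF x]])
  finally show ?thesis .
qed

lemma restrict:
  assumes V: "open V" "V \<subseteq> U" "V \<noteq> {}"
  shows "minimal_flat_slant_patch k f V e1 e2 \<beta>"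
proof -
  have "framed_surface k f V e1 e2"
    using V smooth_f pos_f frame
    by (intro framed_surface.intro) (auto simp: null_frame_on_def intro: smooth_on_subset[OF _ V(2)])
  then show ?thesis
    using V minimal flat gram nonempty
    by (intro minimal_flat_slant_patch.intro) (auto simp: minimal_flat_slant_patch_axioms_def)
qed

end

section \<open>The normalised frame\<close>

text \<open>On a ball on which the nowhere vanishing imaginary function $p$ has constant sign $s_0$ the cube root below is smooth.\<close>

locale normalized_patch = minimal_flat_slant_patch +
  fixes x0 :: "real^2" and \<epsilon> s0 :: real
  assumes ball: "U = ball x0 \<epsilon>" "\<epsilon> > 0"
    and sign: "s0 = 1 \<or> s0 = -1" "\<And>x. x \<in> U \<Longrightarrow> 0 < s0 * Im (p x)"
begin

lemma dd_coef_normalized: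
  assumes "x \<in> U" "smooth_on U c0" "smooth_on U c1" "smooth_on U c2"
    and "\<forall>y\<in>U. F y = c0 y *s Z y + c1 y *s H1 y + c2 y *s H2 y"
  shows "dd F x u =
     (dd c0 x u + c0 x * a x u + c1 x * of_real (\<theta>2 x u) + c2 x * of_real (\<theta>1 x u)) *s Z x
   + (dd c1 x u + c0 x * of_real (\<theta>1 x u) + c1 x * (a x u + of_real (\<omega> x u)) + c2 x * q x * of_real (\<theta>2 x u)) *s H1 x
   + (dd c2 x u + c0 x * of_real (\<theta>2 x u) + c1 x * p x * of_real (\<theta>1 x u) + c2 x * (a x u - of_real (\<omega> x u))) *s H2 x"
  using dd_coef[OF assms, of u] by (simp add: beta_eq)

text \<open>The real cube root of $1/\mathrm{Im}\,p$. Passing from $e_1,e_2$ to $\lambda e_1,\lambda^{-1}e_2$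
  multiplies $p$ by $\lambda^3$, so it turns $p$ into $i$; by \<open>dd_lam\<close> the new frame is parallel.\<close>

definition lam :: "real^2 \<Rightarrow> real" where "lam x = s0 * (s0 * Im (p x)) powr (- 1 / 3)"

lemma x0_in: "x0 \<in> U" using ball by simp

lemma smooth_lam: "smooth_on U lam"
  unfolding lam_def[abs_def]
  by (intro smooth_on_mult smooth_on_powr smooth_on_const open_U sign
      smooth_on_bounded_linear_compose[OF bounded_linear_Im] smooth_p)

lemma lam_nz: "x \<in> U \<Longrightarrow> lam x \<noteq> 0"
  using sign(1) sign(2)[of x] by (auto simp: lam_def)

lemma lam_cube:
  assumes x: "x \<in> U" shows "lam x ^ 3 * Im (p x) = 1"
proof -
  let ?r = "s0 * Im (p x)"
  have "(r powr (- 1 / 3)) ^ 3 = r powr (- 1)" if "r > 0" for r :: real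
    using that by (simp add: powr_power)
  from this[OF sign(2)[OF x]] have "(?r powr (- 1 / 3)) ^ 3 = ?r powr (- 1)" .
  also have "\<dots> = inverse ?r" using sign(2)[OF x] by (simp add: powr_minus)
  finally have "lam x ^ 3 * Im (p x) = s0 ^ 3 * inverse ?r * Im (p x)"
    unfolding lam_def by (simp add: power_mult_distrib)
  also have "\<dots> = 1" using sign(1) sign(2)[OF x] by auto
  finally show ?thesis .
qed

lemma p_eq: "x \<in> U \<Longrightarrow> p x = \<i> * of_real (Im (p x))"
  using p_q(2)[of x] by (simp add: complex_eq_iff)

lemma dd_lam:
  assumes x: "x \<in> U" shows "dd lam x u = - lam x * \<omega> x u"
proof -
  have "(p has_derivative (\<lambda>u. 3 * p x * of_real (\<omega> x u))) (at x)"
    by (rule has_derivative_eq_rhs[OF smooth_on_has_derivative[OF smooth_p(1) x]]) (simp add: fun_eq_iff dd_p[OF x])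
  then have dr: "((\<lambda>y. Im (p y)) has_derivative (\<lambda>u. 3 * Im (p x) * \<omega> x u)) (at x)"
    by (rule has_derivative_eq_rhs[OF bounded_linear.has_derivative[OF bounded_linear_Im]]) simp
  have "((\<lambda>y. lam y ^ 3 * Im (p y)) has_derivative
     (\<lambda>u. lam x ^ 3 * (3 * Im (p x) * \<omega> x u) + (3 * dd lam x u * lam x ^ 2) * Im (p x))) (at x)"
    by (rule has_derivative_eq_rhs[OF has_derivative_mult[OF has_derivative_power[OF smooth_on_has_derivative[OF smooth_lam x]] dr]])
       (simp add: mult_ac)
  moreover have "((\<lambda>y. lam y ^ 3 * Im (p y)) has_derivative (\<lambda>u. 0)) (at x)"
    by (rule has_derivative_transform_within_open[OF has_derivative_const[of 1] open_U x]) (simp add: lam_cube)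
  ultimately have "(\<lambda>u. lam x ^ 3 * (3 * Im (p x) * \<omega> x u) + (3 * dd lam x u * lam x ^ 2) * Im (p x)) = (\<lambda>u. 0)"
    by (rule has_derivative_unique)
  from fun_cong[OF this, of u] have "(3 * lam x ^ 2 * Im (p x)) * (lam x * \<omega> x u + dd lam x u) = 0"
    by (simp add: algebra_simps power2_eq_square power3_eq_cube)
  moreover have "Im (p x) \<noteq> 0" using sign(2)[OF x] by auto
  ultimately show ?thesis using lam_nz[OF x] by (simp add: add_eq_0_iff)
qed

text \<open>In the rescaled frame the structure equations have constant coefficients, apart from the common
  term $a$. The vectors $Z+\mu^{-1}H_1+\mu H_2$ with $\mu^3=i$ are the common eigenvectors of the two coefficient matrices, with
  eigenvalues $\mu$ and $\mu^{-1}$.\<close>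

definition W :: "complex \<Rightarrow> real^2 \<Rightarrow> complex^3" where
  "W \<mu> x = Z x + (of_real (lam x) / \<mu>) *s H1 x + (\<mu> / of_real (lam x)) *s H2 x"

definition \<sigma> :: "complex \<Rightarrow> real^2 \<Rightarrow> real^2 \<Rightarrow> complex" where
  "\<sigma> \<mu> x u = a x u + \<mu> * of_real (\<theta>1 x u / lam x) + of_real (lam x * \<theta>2 x u) / \<mu>"

lemma smooth_lam': "smooth_on U (\<lambda>x. complex_of_real (lam x) / \<mu>)" if "\<mu> \<noteq> 0"
  by (intro smooth_on_divide open_U that smooth_on_const smooth_of_real smooth_lam)

lemma smooth_lam'': "smooth_on U (\<lambda>x. \<mu> / complex_of_real (lam x))"
  by (intro smooth_on_divide open_U smooth_on_const smooth_of_real smooth_lam) (simp add: lam_nz)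

lemma smooth_W: "\<mu> \<noteq> 0 \<Longrightarrow> smooth_on U (W \<mu>)"
  unfolding W_def[abs_def]
  by (intro smooth_on_add smooth_on_bilinear[OF bounded_bilinear_smult] smooth_lam' smooth_lam'' open_U smooth_Z smooth_H)

lemma dW:
  assumes x: "x \<in> U" and \<mu>: "\<mu> ^ 3 = \<i>"
  shows "dd (W \<mu>) x u = \<sigma> \<mu> x u *s W \<mu> x"
proof -
  have \<mu>0: "\<mu> \<noteq> 0" using \<mu> by auto
  have l0: "complex_of_real (lam x) \<noteq> 0" using lam_nz[OF x] by simp
  have d1: "dd (\<lambda>x. complex_of_real (lam x) / \<mu>) x u = - of_real (lam x * \<omega> x u) / \<mu>"
  proof -
    have "((\<lambda>x. complex_of_real (lam x) / \<mu>) has_derivative (\<lambda>u. of_real (dd lam x u) / \<mu>)) (at x)"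
      by (intro bounded_linear.has_derivative[OF bounded_linear_divide]
        bounded_linear.has_derivative[OF bounded_linear_of_real] smooth_on_has_derivative[OF smooth_lam x])
    then show ?thesis by (simp add: frechet_derivative_eqI dd_lam[OF x])
  qed
  have d2: "dd (\<lambda>x. \<mu> / complex_of_real (lam x)) x u = \<mu> * of_real (\<omega> x u) / of_real (lam x)"
  proof -
    have "((\<lambda>x. \<mu> * inverse (complex_of_real (lam x))) has_derivative
        (\<lambda>u. \<mu> * - (inverse (of_real (lam x)) * of_real (dd lam x u) * inverse (of_real (lam x))))) (at x)"
      by (intro has_derivative_mult_right Deriv.has_derivative_inverse l0
        bounded_linear.has_derivative[OF bounded_linear_of_real] smooth_on_has_derivative[OF smooth_lam x])
    then show ?thesis using l0 by (simp add: divide_inverse frechet_derivative_eqI dd_lam[OF x])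
  qed
  have F: "\<forall>y\<in>U. W \<mu> y = 1 *s Z y + (of_real (lam y) / \<mu>) *s H1 y + (\<mu> / of_real (lam y)) *s H2 y"
    by (simp add: W_def)
  have pl: "p x = \<i> / of_real (lam x) ^ 3"
  proof -
    have "complex_of_real (lam x ^ 3 * Im (p x)) = 1" using lam_cube[OF x] by simp
    then show ?thesis using l0 by (subst p_eq[OF x]) (simp add: field_simps)
  qed
  have ql: "q x = of_real (lam x) ^ 3 / \<i>"
  proof -
    have "p x \<noteq> 0" using p_q(1)[OF x] by auto
    then have "q x = 1 / p x" using p_q(1)[OF x] by (simp add: field_simps)
    then show ?thesis unfolding pl by simp
  qed
  have d0: "dd (\<lambda>x. 1 :: complex) x u = 0" by (simp add: frechet_derivative_const)
  have pl': "of_real (lam x) / \<mu> * p x = \<mu>^2 / of_real (lam x) ^ 2"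
    unfolding pl \<mu>[symmetric] using l0 \<mu>0 by (simp add: field_simps power2_eq_square power3_eq_cube)
  have ql': "\<mu> / of_real (lam x) * q x = of_real (lam x) ^ 2 / \<mu> ^ 2"
    unfolding ql \<mu>[symmetric] using l0 \<mu>0 by (simp add: field_simps power2_eq_square power3_eq_cube)
  define l where "l = complex_of_real (lam x)"
  have W: "\<sigma> \<mu> x u *s W \<mu> x = \<sigma> \<mu> x u *s Z x + (\<sigma> \<mu> x u * (l / \<mu>)) *s H1 x + (\<sigma> \<mu> x u * (\<mu> / l)) *s H2 x"
    by (simp add: W_def l_def vec_eq_iff algebra_simps)
  have \<sigma>: "\<sigma> \<mu> x u = a x u + \<mu> * (of_real (\<theta>1 x u) / l) + l * of_real (\<theta>2 x u) / \<mu>"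
    by (simp add: \<sigma>_def l_def)
  have eqI: "A = A' \<Longrightarrow> B = B' \<Longrightarrow> C = C' \<Longrightarrow> A *s Z x + B *s H1 x + C *s H2 x = A' *s Z x + B' *s H1 x + C' *s H2 x" for A B C A' B' C'
    by simp
  note l0 = l0[folded l_def]
  show ?thesis
    unfolding dd_coef_normalized[OF x smooth_on_const[OF open_U] smooth_lam'[OF \<mu>0] smooth_lam'' F] d0 d1 d2 pl' ql' W
    unfolding of_real_mult of_real_minus l_def[symmetric]
    by (rule eqI; unfold \<sigma>; use l0 \<mu>0 in \<open>simp add: field_simps power2_eq_square\<close>)
qed

text \<open>For unimodular $\mu$ one has $1/\bar\mu=\mu$, which makes the Gram matrix constant.\<close>

lemma gram_W:
  assumes x: "x \<in> U" and "cmod \<mu> = 1" "cmod \<mu>' = 1"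
  shows "b_form (W \<mu> x) (W \<mu>' x) = of_real (1 - 2 * Re (\<mu> * \<mu>'))"
proof -
  have l0: "complex_of_real (lam x) \<noteq> 0" using lam_nz[OF x] by simp
  have 1: "\<mu> * cnj \<mu> = 1" "\<mu>' * cnj \<mu>' = 1"
    using assms(2,3) by (simp_all add: complex_norm_square[symmetric])
  then have inv: "1 / cnj \<mu> = \<mu>" "1 / \<mu>' = cnj \<mu>'" 
  proof -
    have "cnj \<mu> \<noteq> 0" "\<mu>' \<noteq> 0" using 1 by auto
    then show "1 / cnj \<mu> = \<mu>" "1 / \<mu>' = cnj \<mu>'"
      using 1 by (simp_all add: divide_eq_eq mult.commute)
  qed
  have "b_form (W \<mu> x) (W \<mu>' x) = 1 - (1 / cnj \<mu>) * \<mu>' - cnj \<mu> * (1 / \<mu>')"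
    using l0 unfolding W_def by (simp add: b_Z[OF x] b_H[OF x] gram[OF x] gram'[OF x] beta_eq)
  also have "\<dots> = 1 - (\<mu> * \<mu>' + cnj (\<mu> * \<mu>'))" unfolding inv by simp
  also have "\<dots> = of_real (1 - 2 * Re (\<mu> * \<mu>'))" unfolding complex_add_cnj by simp
  finally show ?thesis .
qed

definition \<mu>0 :: complex where "\<mu>0 = - \<i>"
definition \<mu>p :: complex where "\<mu>p = Complex (sqrt 3 / 2) (1 / 2)"
definition \<mu>m :: complex where "\<mu>m = Complex (- sqrt 3 / 2) (1 / 2)"

lemma kappa:
  "\<mu>0 ^ 3 = \<i>" "\<mu>p ^ 3 = \<i>" "\<mu>m ^ 3 = \<i>" "cmod \<mu>0 = 1" "cmod \<mu>p = 1" "cmod \<mu>m = 1"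
  "\<mu>0 \<noteq> 0" "\<mu>p \<noteq> 0" "\<mu>m \<noteq> 0"
  "1 / \<mu>0 = \<i>" "1 / \<mu>p = Complex (sqrt 3 / 2) (- 1 / 2)" "1 / \<mu>m = Complex (- sqrt 3 / 2) (- 1 / 2)"
  "\<mu>0 + \<mu>p + \<mu>m = 0" "1 / \<mu>0 + 1 / \<mu>p + 1 / \<mu>m = 0"
proof -
  show *: "1 / \<mu>0 = \<i>" "1 / \<mu>p = Complex (sqrt 3 / 2) (- 1 / 2)" "1 / \<mu>m = Complex (- sqrt 3 / 2) (- 1 / 2)"
    by (simp_all add: \<mu>0_def \<mu>p_def \<mu>m_def complex_eq_iff Re_divide Im_divide power_divide power2_eq_square)
  show "1 / \<mu>0 + 1 / \<mu>p + 1 / \<mu>m = 0" unfolding * by (simp add: complex_eq_iff)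
qed (simp_all add: \<mu>0_def \<mu>p_def \<mu>m_def complex_eq_iff cmod_def power3_eq_cube power_divide field_simps)

lemma gram_kappa:
  assumes x: "x \<in> U"
  shows "b_form (W \<mu>0 x) (W \<mu>0 x) = 3" "b_form (W \<mu>0 x) (W \<mu>p x) = 0" "b_form (W \<mu>0 x) (W \<mu>m x) = 0"
   "b_form (W \<mu>p x) (W \<mu>0 x) = 0" "b_form (W \<mu>p x) (W \<mu>p x) = 0" "b_form (W \<mu>p x) (W \<mu>m x) = 3"
   "b_form (W \<mu>m x) (W \<mu>0 x) = 0" "b_form (W \<mu>m x) (W \<mu>p x) = 3" "b_form (W \<mu>m x) (W \<mu>m x) = 0"
proof -
  have re: "Re (\<mu>0 * \<mu>0) = -1" "Re (\<mu>0 * \<mu>p) = 1/2" "Re (\<mu>0 * \<mu>m) = 1/2" "Re (\<mu>p * \<mu>0) = 1/2" "Re (\<mu>p * \<mu>p) = 1/2"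
    "Re (\<mu>p * \<mu>m) = -1" "Re (\<mu>m * \<mu>0) = 1/2" "Re (\<mu>m * \<mu>p) = -1" "Re (\<mu>m * \<mu>m) = 1/2"
    by (simp_all add: \<mu>0_def \<mu>p_def \<mu>m_def)
  show "b_form (W \<mu>0 x) (W \<mu>0 x) = 3" "b_form (W \<mu>0 x) (W \<mu>p x) = 0" "b_form (W \<mu>0 x) (W \<mu>m x) = 0"
   "b_form (W \<mu>p x) (W \<mu>0 x) = 0" "b_form (W \<mu>p x) (W \<mu>p x) = 0" "b_form (W \<mu>p x) (W \<mu>m x) = 3"
   "b_form (W \<mu>m x) (W \<mu>0 x) = 0" "b_form (W \<mu>m x) (W \<mu>p x) = 3" "b_form (W \<mu>m x) (W \<mu>m x) = 0"
    unfolding gram_W[OF x kappa(4) kappa(4)] gram_W[OF x kappa(4) kappa(5)] gram_W[OF x kappa(4) kappa(6)]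
      gram_W[OF x kappa(5) kappa(4)] gram_W[OF x kappa(5) kappa(5)] gram_W[OF x kappa(5) kappa(6)]
      gram_W[OF x kappa(6) kappa(4)] gram_W[OF x kappa(6) kappa(5)] gram_W[OF x kappa(6) kappa(6)] re
    by simp_all
qed

lemma Z_W: "x \<in> U \<Longrightarrow> W \<mu>0 x + W \<mu>p x + W \<mu>m x = 3 *s Z x"
proof -
  assume x: "x \<in> U"
  have "W \<mu>0 x + W \<mu>p x + W \<mu>m x = 3 *s Z x + (of_real (lam x) * (1 / \<mu>0 + 1 / \<mu>p + 1 / \<mu>m)) *s H1 x
     + ((\<mu>0 + \<mu>p + \<mu>m) / of_real (lam x)) *s H2 x"
    by (simp add: W_def vec_eq_iff algebra_simps add_divide_distrib)
  then show ?thesis unfolding kappa(13,14) by simp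
qed

end

section \<open>Integration of the structure equations\<close>

text \<open>By the quotient rule $W/w$ has derivative $0$, so a solution of $dW=\sigma W$ keeps its complex direction.\<close>

lemma eigenvector_ode:
  fixes W :: "'a::euclidean_space \<Rightarrow> complex^'n"
  assumes B: "convex B" "x \<in> B" "x0 \<in> B"
    and W: "\<And>x. x \<in> B \<Longrightarrow> (W has_derivative (\<lambda>u. \<sigma> x u *s W x)) (at x)"
    and w: "\<And>x. x \<in> B \<Longrightarrow> (w has_derivative (\<lambda>u. \<sigma> x u * w x)) (at x)"
    and nz: "\<And>x. x \<in> B \<Longrightarrow> w x \<noteq> 0"
  shows "W x = (w x / w x0) *s W x0"
proof -
  have "((\<lambda>x. inverse (w x) *s W x) has_derivative (\<lambda>u. 0)) (at x within B)" if x: "x \<in> B" for x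
  proof -
    have "((\<lambda>x. inverse (w x) *s W x) has_derivative
      (\<lambda>u. inverse (w x) *s (\<sigma> x u *s W x) + - (inverse (w x) * (\<sigma> x u * w x) * inverse (w x)) *s W x)) (at x)"
      by (intro bounded_bilinear.FDERIV[OF bounded_bilinear_smult] Deriv.has_derivative_inverse nz[OF x] W[OF x] w[OF x])
    then have "((\<lambda>x. inverse (w x) *s W x) has_derivative (\<lambda>u. 0)) (at x)"
      by (rule has_derivative_eq_rhs) (use nz[OF x] in \<open>simp add: fun_eq_iff vec_eq_iff\<close>)
    then show ?thesis by (rule has_derivative_at_withinI)
  qed
  from has_derivative_zero_constant[OF B(1) this]
  obtain c where c: "\<And>x. x \<in> B \<Longrightarrow> inverse (w x) *s W x = c" by blast
  have "inverse (w x) *s W x = inverse (w x0) *s W x0" unfolding c[OF B(2)] c[OF B(3)] ..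
  then have "w x *s (inverse (w x) *s W x) = w x *s (inverse (w x0) *s W x0)" by simp
  then show ?thesis using nz[OF B(2)] by (simp add: divide_inverse)
qed

lemma unitary12_columns:
  assumes g: "b_form c1 c1 = -1" "b_form c2 c2 = 1" "b_form c3 c3 = 1"
    "b_form c1 c2 = 0" "b_form c1 c3 = 0" "b_form c2 c3 = 0"
  obtains T where "unitary12 T" "\<And>y. T *v y = y$1 *s c1 + y$2 *s c2 + y$3 *s c3"
proof -
  define T :: "complex^3^3" where "T = (\<chi> i j. (if j = 1 then c1 else if j = 2 then c2 else c3) $ i)"
  have T: "T *v y = y$1 *s c1 + y$2 *s c2 + y$3 *s c3" for y
    by (simp add: T_def matrix_vector_mult_def sum_3 vec_eq_iff mult.commute)
  have g': "b_form c2 c1 = 0" "b_form c3 c1 = 0" "b_form c3 c2 = 0"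
    using g b_form_cnj by (metis complex_cnj_zero)+
  have "unitary12 T" unfolding unitary12_def T
    by (simp add: g g' algebra_simps) (simp add: b_form_def)
  then show ?thesis using that T by blast
qed

text \<open>The model surface is parametrised by $z=v+3iu$ with $u=(x-y)/2$ and $v=\sqrt3(x+y)/2$, in which its affine
  coordinate $(z_3+z_1)/z_2$ is $\sqrt2e^z$; this is the change from $z$ to the null coordinates $(x,y)$.\<close>

definition log_coords :: "complex \<Rightarrow> real^2" where
  "log_coords z = vector [Re z / sqrt 3 + Im z / 3, Re z / sqrt 3 - Im z / 3]"

lemma bounded_linear_log_coords: "bounded_linear log_coords"
  unfolding linear_conv_bounded_linear[symmetric] linear_iff
  by (simp add: log_coords_def vec_eq_iff forall_2 add_divide_distrib algebra_simps)

lemma L_tilde_log_coords: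
  fixes z :: complex
  defines "e \<equiv> exp (\<i> * of_real (Im z / 3))" and "E \<equiv> of_real (exp (Re z))"
  shows "L_tilde 1 (log_coords z) = of_real (1 / sqrt 3) *s
    vector [of_real (sqrt 2) * e * ((E - inverse E) / 2), inverse (e ^ 2), of_real (sqrt 2) * e * ((E + inverse E) / 2)]"
proof -
  have 1: "log_coords z $ 1 - log_coords z $ 2 = 2 * (Im z / 3)" "log_coords z $ 1 + log_coords z $ 2 = 2 * Re z / sqrt 3"
    by (simp_all add: log_coords_def)
  have 2: "sqrt 3 / 2 * (2 * Re z / sqrt 3) = Re z" by simp
  have 3: "log_coords z $ 2 - log_coords z $ 1 = - (2 * (Im z / 3))" using 1(1) by simp
  have 4: "exp (\<i> * of_real (- (2 * (Im z / 3)))) = inverse (e ^ 2)"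
  proof -
    have "\<i> * of_real (- (2 * (Im z / 3))) = - (of_nat 2 * (\<i> * of_real (Im z / 3)))" by simp
    then show ?thesis unfolding e_def by (simp only: exp_minus exp_of_nat_mult)
  qed
  have 5: "exp (\<i> / 2 * of_real (2 * (Im z / 3))) = e" unfolding e_def by simp
  have 6: "complex_of_real (sinh (Re z)) = (E - inverse E) / 2" "complex_of_real (cosh (Re z)) = (E + inverse E) / 2"
    by (simp_all add: E_def sinh_field_def cosh_field_def exp_minus)
  have "L_tilde 1 (log_coords z) = of_real (1 / sqrt 3) *s
    vector [of_real (sqrt 2) * exp (\<i> / 2 * of_real (log_coords z $ 1 - log_coords z $ 2))
        * of_real (sinh (sqrt 3 / 2 * (log_coords z $ 1 + log_coords z $ 2))),
      exp (\<i> * of_real (log_coords z $ 2 - log_coords z $ 1)),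
      of_real (sqrt 2) * exp (\<i> / 2 * of_real (log_coords z $ 1 - log_coords z $ 2))
        * of_real (cosh (sqrt 3 / 2 * (log_coords z $ 1 + log_coords z $ 2)))]"
    by (simp add: L_tilde_def Let_def)
  then show ?thesis unfolding 1 2 3 4 5 6 .
qed

context normalized_patch begin

lemma W_has_derivative: "x \<in> U \<Longrightarrow> \<mu> ^ 3 = \<i> \<Longrightarrow> (W \<mu> has_derivative (\<lambda>u. \<sigma> \<mu> x u *s W \<mu> x)) (at x)"
  by (rule has_derivative_eq_rhs[OF smooth_on_has_derivative[OF smooth_W]]) (auto simp: fun_eq_iff dW)

text \<open>When $c$ has product $3$ with the initial value of $W_\mu$, this is the scalar factor $w_\mu$ with initial value $1$.\<close>

definition pairing :: "complex^3 \<Rightarrow> complex \<Rightarrow> real^2 \<Rightarrow> complex" where "pairing c \<mu> x = b_form c (W \<mu> x) / 3"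

lemma pairing_has_derivative:
  assumes "x \<in> U" "\<mu> ^ 3 = \<i>"
  shows "(pairing c \<mu> has_derivative (\<lambda>u. \<sigma> \<mu> x u * pairing c \<mu> x)) (at x)"
proof -
  have "((\<lambda>x. b_form c (W \<mu> x) / 3) has_derivative (\<lambda>u. b_form c (\<sigma> \<mu> x u *s W \<mu> x) / 3)) (at x)"
    by (intro bounded_linear.has_derivative[OF bounded_linear_divide]
      bounded_linear.has_derivative[OF bounded_bilinear.bounded_linear_right[OF bounded_bilinear_b_form]] W_has_derivative assms)
  then show ?thesis by (simp add: pairing_def[abs_def])
qed

text \<open>The three eigenvectors are $w_0C_0$, $w_+C_+$, $w_-C_-$ with constant vectors whose Gram matrix is, up to the factor $3$, the
  standard one in a null basis. It follows that $|w_0|=1$ and $\bar w_+w_-=1$, so that all projective information is in $P=w_+/w_0$,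
  and $\log P$ is an affine function of flat null coordinates.\<close>

theorem normal_form:
  "\<exists>T U' V \<Psi> g. unitary12 T \<and> open U' \<and> x0 \<in> U' \<and> U' \<subseteq> U \<and> open V \<and> homeomorphism U' V \<Psi> g \<and>
     smooth_on U' \<Psi> \<and> smooth_on V g \<and> (\<forall>x\<in>U'. hopf (homog k (f x)) = act T (hopf (L_tilde 1 (\<Psi> x))))"
proof -
  define C0 where "C0 = W \<mu>0 x0"
  define Cp where "Cp = W \<mu>p x0"
  define Cm where "Cm = W \<mu>m x0"
  define w0 where "w0 = pairing C0 \<mu>0"
  define wp where "wp = pairing Cm \<mu>p"
  define wm where "wm = pairing Cp \<mu>m"
  note gram0 = gram_kappa[OF x0_in, folded C0_def Cp_def Cm_def]
  have w_x0: "w0 x0 = 1" "wp x0 = 1" "wm x0 = 1"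
    by (simp_all add: w0_def wp_def wm_def pairing_def gram0 C0_def[symmetric] Cp_def[symmetric] Cm_def[symmetric])
  have dw: "(w0 has_derivative (\<lambda>u. \<sigma> \<mu>0 x u * w0 x)) (at x)" "(wp has_derivative (\<lambda>u. \<sigma> \<mu>p x u * wp x)) (at x)"
    "(wm has_derivative (\<lambda>u. \<sigma> \<mu>m x u * wm x)) (at x)" if "x \<in> U" for x
    unfolding w0_def wp_def wm_def by (intro pairing_has_derivative that kappa)+
  have cont: "continuous_on U w0" "continuous_on U wp" "continuous_on U wm"
    by (auto intro!: continuous_at_imp_continuous_on has_derivative_continuous[OF dw(1)]
        has_derivative_continuous[OF dw(2)] has_derivative_continuous[OF dw(3)])
  have pos_open: "open (U \<inter> h -` {0<..})" if "continuous_on U h" for h :: "real^2 \<Rightarrow> real"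
    using continuous_open_preimage[OF that open_U open_greaterThan] .
  \<comment> \<open>a neighbourhood where the scalar factors do not vanish and $P$ avoids the cut of the logarithm\<close>
  define G where "G = (U \<inter> (\<lambda>x. Re (w0 x)) -` {0<..}) \<inter> (U \<inter> (\<lambda>x. Re (wp x)) -` {0<..})
     \<inter> (U \<inter> (\<lambda>x. Re (wm x)) -` {0<..}) \<inter> (U \<inter> (\<lambda>x. Re (wp x * cnj (w0 x))) -` {0<..})"
  have "open G" unfolding G_def by (intro open_Int pos_open continuous_intros cont)
  moreover have "x0 \<in> G" using x0_in by (simp add: G_def w_x0)
  ultimately obtain r where r: "r > 0" "ball x0 r \<subseteq> G" using open_contains_ball by blast
  define B where "B = ball x0 r"
  have B: "open B" "convex B" "x0 \<in> B" "B \<subseteq> U" using r by (auto simp: B_def G_def)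
  have BU: "x \<in> U" if "x \<in> B" for x using that B by blast
  have nz: "w0 x \<noteq> 0" "wp x \<noteq> 0" "wm x \<noteq> 0" if "x \<in> B" for x
    using that r by (auto simp: B_def G_def)
  have WB: "W \<mu>0 x = w0 x *s C0" "W \<mu>p x = wp x *s Cp" "W \<mu>m x = wm x *s Cm" if "x \<in> B" for x
    using eigenvector_ode[where w=w0 and W="W \<mu>0" and \<sigma>="\<sigma> \<mu>0", OF B(2) that B(3)]
      eigenvector_ode[where w=wp and W="W \<mu>p" and \<sigma>="\<sigma> \<mu>p", OF B(2) that B(3)]
      eigenvector_ode[where w=wm and W="W \<mu>m" and \<sigma>="\<sigma> \<mu>m", OF B(2) that B(3)]
      dw W_has_derivative kappa(1-3) nz BU
    by (simp_all add: w_x0 C0_def Cp_def Cm_def)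
  have mod: "cnj (w0 x) * w0 x = 1" "cnj (wp x) * wm x = 1" if "x \<in> B" for x
    using gram_kappa(1)[OF BU[OF that]] gram_kappa(6)[OF BU[OF that]] by (simp_all add: WB[OF that] gram0 mult.commute)
  define P where "P x = wp x / w0 x" for x
  have reP: "Re (P x) > 0" if "x \<in> B" for x
  proof -
    have "cnj (w0 x) = 1 / w0 x" using mod(1)[OF that] nz(1)[OF that] by (simp add: field_simps)
    then have "P x = wp x * cnj (w0 x)" by (simp add: P_def)
    then show ?thesis using that r by (auto simp: B_def G_def)
  qed
  define t1 where "t1 x u = \<theta>1 x u / lam x" for x u
  define t2 where "t2 x u = lam x * \<theta>2 x u" for x u
  \<comment> \<open>this is $d\log P$; in the coordinates it says that $d\Psi=(\theta_1/\lambda,\lambda\theta_2)$\<close>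
  have \<sigma>_diff: "\<sigma> \<mu>p x u - \<sigma> \<mu>0 x u = Complex (sqrt 3 / 2 * (t1 x u + t2 x u)) (3 / 2 * (t1 x u - t2 x u))" for x u
  proof -
    have "\<sigma> \<mu>p x u - \<sigma> \<mu>0 x u = (\<mu>p - \<mu>0) * of_real (t1 x u) + (1 / \<mu>p - 1 / \<mu>0) * of_real (t2 x u)"
      by (simp add: \<sigma>_def t1_def t2_def algebra_simps diff_divide_distrib)
    then show ?thesis unfolding kappa(10,11) by (simp add: \<mu>p_def \<mu>0_def complex_eq_iff algebra_simps)
  qed
  have dLn: "((\<lambda>x. Ln (P x)) has_derivative (\<lambda>u. \<sigma> \<mu>p x u - \<sigma> \<mu>0 x u)) (at x)" if x: "x \<in> B" for x
  proof -
    note xU = BU[OF x] and nzx = nz[OF x]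
    have "((\<lambda>x. wp x * inverse (w0 x)) has_derivative
       (\<lambda>u. wp x * - (inverse (w0 x) * (\<sigma> \<mu>0 x u * w0 x) * inverse (w0 x)) + (\<sigma> \<mu>p x u * wp x) * inverse (w0 x))) (at x)"
      by (intro has_derivative_mult Deriv.has_derivative_inverse nzx dw xU)
    then have dP: "(P has_derivative (\<lambda>u. (\<sigma> \<mu>p x u - \<sigma> \<mu>0 x u) * P x)) (at x)"
      unfolding P_def[abs_def] divide_inverse
      by (rule has_derivative_eq_rhs) (use nzx in \<open>simp add: fun_eq_iff algebra_simps\<close>)
    have "P x \<notin> \<real>\<^sub>\<le>\<^sub>0" using reP[OF x] by (auto simp: complex_nonpos_Reals_iff)
    then have "(Ln has_derivative (*) (inverse (P x))) (at (P x))"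
      using has_field_derivative_Ln[of "P x"] by (simp add: has_field_derivative_def)
    from has_derivative_compose[OF dP this]
    have "((\<lambda>x. Ln (P x)) has_derivative (\<lambda>u. inverse (P x) * ((\<sigma> \<mu>p x u - \<sigma> \<mu>0 x u) * P x))) (at x)" .
    then show ?thesis
    proof (rule has_derivative_eq_rhs)
      have "P x \<noteq> 0" using \<open>P x \<notin> \<real>\<^sub>\<le>\<^sub>0\<close> by auto
      then have "inverse (P x) * (c * P x) = c" for c by simp
      then show "(\<lambda>u. inverse (P x) * ((\<sigma> \<mu>p x u - \<sigma> \<mu>0 x u) * P x)) = (\<lambda>u. \<sigma> \<mu>p x u - \<sigma> \<mu>0 x u)" by (simp only:)
    qed
  qed
  define \<Psi> where "\<Psi> x = log_coords (Ln (P x))" for x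
  have d\<Psi>: "(\<Psi> has_derivative (\<lambda>u. t1 x u *\<^sub>R axis 1 1 + t2 x u *\<^sub>R axis 2 1)) (at x)" if "x \<in> B" for x
    unfolding \<Psi>_def[abs_def]
    by (rule has_derivative_eq_rhs[OF bounded_linear.has_derivative[OF bounded_linear_log_coords dLn[OF that]]])
      (simp add: fun_eq_iff \<sigma>_diff log_coords_def vec_eq_iff forall_2 axis_def field_simps)
  have smU: "smooth_on B F" if "smooth_on U F" for F :: "real^2 \<Rightarrow> 'z::real_normed_vector"
    using smooth_on_subset[OF that B(4)] .
  have smt: "smooth_on B (\<lambda>x. t1 x u)" "smooth_on B (\<lambda>x. t2 x u)" for u
    unfolding t1_def t2_def
    by (intro smooth_on_divide smooth_on_mult B smU smooth_theta smooth_lam lam_nz BU | assumption)+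
  have sm\<Psi>: "smooth_on B \<Psi>"
    by (rule smooth_onI_derivative[OF B(1) d\<Psi>]) (intro smooth_on_add smooth_on_scaleR B smt smooth_on_const | assumption)+
  \<comment> \<open>the inverse of the derivative of $\Psi$: the rescaled null frame is dual to $d\Psi$\<close>
  define Kw :: "real^2 \<Rightarrow> real^2 \<Rightarrow> real^2" where "Kw x w = (w$1 * lam x) *\<^sub>R e1 x + (w$2 / lam x) *\<^sub>R e2 x" for x w
  have smK: "smooth_on B (\<lambda>x. Kw x w)" for w
    unfolding Kw_def
    by (intro smooth_on_add smooth_on_scaleR smooth_on_mult smooth_on_divide smooth_on_const B smU smooth_e smooth_lam lam_nz BU | assumption)+
  have dK: "dd \<Psi> x (Kw x w) = w" if x: "x \<in> B" for x w
  proof -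
    note xU = BU[OF x]
    have "\<theta>1 x (Kw x w) = w$1 * lam x" "\<theta>2 x (Kw x w) = w$2 / lam x"
      unfolding \<theta>1_def \<theta>2_def Kw_def by (simp_all add: g_linear[OF xU] g_e[OF xU])
    then have "t1 x (Kw x w) = w$1" "t2 x (Kw x w) = w$2" using lam_nz[OF xU] by (simp_all add: t1_def t2_def)
    then show ?thesis unfolding frechet_derivative_eqI[OF d\<Psi>[OF x]]
      by (simp add: vec_eq_iff forall_2 axis_def)
  qed
  obtain U' V g where g: "open U'" "U' \<subseteq> B" "x0 \<in> U'" "open V" "homeomorphism U' V \<Psi> g" "smooth_on V g"
    using smooth_inverse_function[OF B(1,3) sm\<Psi> smK dK] by blast
  have b': "b_form Cp Cm = 3" "b_form Cm Cp = 3" using gram0 by simp_all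
  \<comment> \<open>Columns of the unitary matrix: $e_2\mapsto C_0/\sqrt3$ and $(e_3\pm e_1)/\sqrt2\mapsto C_\pm/\sqrt3$.\<close>
  define s3 where "s3 = complex_of_real (1 / sqrt 3)"
  define s6 where "s6 = complex_of_real (1 / sqrt 6)"
  have s: "s3 * s3 = 1 / 3" "s6 * s6 = 1 / 6" "cnj s3 = s3" "cnj s6 = s6" "of_real (sqrt 2) * s6 = s3"
  proof -
    show "s3 * s3 = 1 / 3" "s6 * s6 = 1 / 6" unfolding s3_def s6_def of_real_mult[symmetric] by simp_all
    have "sqrt 2 * (1 / sqrt 6) = 1 / sqrt 3" using real_sqrt_mult[of 2 3] by simp
    then show "of_real (sqrt 2) * s6 = s3" unfolding s3_def s6_def by (metis of_real_mult)
  qed (simp_all add: s3_def s6_def)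
  have sc6: "b_form (s6 *s x) (s6 *s y) = 1 / 6 * b_form x y" "b_form (s3 *s x) (s3 *s y) = 1 / 3 * b_form x y" for x y
    unfolding s(1,2)[symmetric] by (simp_all add: s(3,4))
  have cols: "b_form (s6 *s (Cp - Cm)) (s6 *s (Cp - Cm)) = -1" "b_form (s3 *s C0) (s3 *s C0) = 1"
    "b_form (s6 *s (Cp + Cm)) (s6 *s (Cp + Cm)) = 1" "b_form (s6 *s (Cp - Cm)) (s3 *s C0) = 0"
    "b_form (s6 *s (Cp - Cm)) (s6 *s (Cp + Cm)) = 0" "b_form (s3 *s C0) (s6 *s (Cp + Cm)) = 0"
    unfolding sc6 by (simp_all add: gram0)
  obtain T where T: "unitary12 T" "\<And>y. T *v y = y$1 *s (s6 *s (Cp - Cm)) + y$2 *s (s3 *s C0) + y$3 *s (s6 *s (Cp + Cm))"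
    using unitary12_columns[OF cols] by blast
  have "hopf (homog k (f x)) = act T (hopf (L_tilde 1 (\<Psi> x)))" if x: "x \<in> B" for x
  proof -
    note xU = BU[OF x] and nzx = nz[OF x]
    define z where "z = Ln (P x)"
    define e where "e = exp (\<i> * of_real (Im z / 3))"
    define E where "E = complex_of_real (exp (Re z))"
    have eE: "e \<noteq> 0" "E \<noteq> 0" by (simp_all add: e_def E_def)
    have P0: "P x \<noteq> 0" using reP[OF x] by auto
    have e3: "e ^ 3 = exp (\<i> * of_real (Im z))" unfolding e_def exp_of_nat_mult[symmetric] by (simp add: mult.commute)
    have "P x = exp z" using P0 by (simp add: z_def)
    also have "\<dots> = E * e ^ 3" unfolding e3 E_def exp_eq_polar[of z] cis_conv_exp by simp
    finally have Pe: "P x = E * e ^ 3" .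
    have ce: "cnj e * e = 1"
      unfolding e_def exp_cnj by (simp add: exp_add[symmetric])
    have ce': "cnj e = inverse e" using ce eE by (simp add: field_simps)
    have "wm x / w0 x = inverse (cnj (P x))"
    proof -
      have "wm x = inverse (cnj (wp x))" "w0 x = inverse (cnj (w0 x))"
        using mod[OF x] nzx by (simp_all add: field_simps)
      then show ?thesis by (simp add: P_def divide_inverse)
    qed
    also have "\<dots> = e ^ 3 * inverse E" unfolding Pe by (simp add: ce' E_def power_inverse)
    finally have Q: "wm x = w0 x * (e ^ 3 * inverse E)" using nzx by (simp add: field_simps)
    have P': "wp x = w0 x * (E * e ^ 3)" using Pe nzx by (simp add: P_def field_simps)
    have Z3: "Z x = (1 / 3) *s (w0 x *s C0 + wp x *s Cp + wm x *s Cm)"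
      using Z_W[OF xU] unfolding WB[OF x] by simp
    have "T *v L_tilde 1 (\<Psi> x) = s3 *s (((of_real (sqrt 2) * s6) * (e * ((E - inverse E) / 2))) *s (Cp - Cm)
       + (inverse (e ^ 2) * s3) *s C0 + ((of_real (sqrt 2) * s6) * (e * ((E + inverse E) / 2))) *s (Cp + Cm))"
      unfolding \<Psi>_def z_def[symmetric] L_tilde_log_coords T(2) e_def[symmetric] E_def[symmetric] s3_def[symmetric]
      by (simp add: vec_eq_iff algebra_simps)
    also have "\<dots> = (s3 * s3) *s (e *s (E *s Cp + inverse E *s Cm) + inverse (e ^ 2) *s C0)"
      unfolding s(5) by (simp add: vec_eq_iff field_simps)
    also have "\<dots> = (inverse (e ^ 2) / w0 x) *s Z x"
      unfolding s(1) Z3 P' Q using eE nzx by (simp add: vec_eq_iff field_simps power2_eq_square power3_eq_cube)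
    finally have "hopf (T *v L_tilde 1 (\<Psi> x)) = hopf (Z x)"
      using eE nzx by (simp add: hopf_smult)
    also have "\<dots> = hopf (homog k (f x))"
      unfolding Z_def h_def using sc_pos[OF xU] by (simp add: hopf_smult)
    finally show ?thesis by (simp add: act_hopf)
  qed
  then have "\<forall>x\<in>U'. hopf (homog k (f x)) = act T (hopf (L_tilde 1 (\<Psi> x)))" using g(2) by blast
  moreover have "U' \<subseteq> U" using g(2) B(4) by (rule subset_trans)
  ultimately show ?thesis
    by (intro exI[of _ T] exI[of _ U'] exI[of _ V] exI[of _ \<Psi>] exI[of _ g] conjI T(1) g(1,3-6)
        smooth_on_subset[OF sm\<Psi> g(2)])
qed

end

context minimal_flat_slant_patch begin

lemma normal_form_at:
  assumes x0: "x0 \<in> U"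
  shows "\<exists>T U' V \<Psi> g. unitary12 T \<and> open U' \<and> x0 \<in> U' \<and> U' \<subseteq> U \<and> open V \<and> homeomorphism U' V \<Psi> g \<and>
     smooth_on U' \<Psi> \<and> smooth_on V g \<and> (\<forall>x\<in>U'. hopf (homog k (f x)) = act T (hopf (L_tilde 1 (\<Psi> x))))"
proof -
  define s0 where "s0 = sgn (Im (p x0))"
  have "p x0 \<noteq> 0" using p_q(1)[OF x0] by auto
  then have im: "Im (p x0) \<noteq> 0" using p_q(2)[OF x0] by (simp add: complex_eq_iff)
  have "continuous_on U (\<lambda>x. s0 * Im (p x))"
    by (intro continuous_intros smooth_on_continuous_on smooth_p)
  then have "open (U \<inter> (\<lambda>x. s0 * Im (p x)) -` {0<..})"
    by (rule continuous_open_preimage[OF _ open_U open_greaterThan])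
  moreover have "0 < s0 * Im (p x0)" using im by (simp add: s0_def sgn_mult_abs[symmetric] sgn_if)
  ultimately obtain \<epsilon> where \<epsilon>: "\<epsilon> > 0" "ball x0 \<epsilon> \<subseteq> U \<inter> (\<lambda>x. s0 * Im (p x)) -` {0<..}"
    using x0 unfolding open_contains_ball by blast
  interpret r: minimal_flat_slant_patch k f "ball x0 \<epsilon>" e1 e2 \<beta>
    by (rule restrict) (use \<epsilon> in auto)
  interpret n: normalized_patch k f "ball x0 \<epsilon>" e1 e2 \<beta> x0 \<epsilon> s0
    by unfold_locales (use \<epsilon> im in \<open>auto simp: s0_def sgn_if\<close>)
  have "ball x0 \<epsilon> \<subseteq> U" using \<epsilon>(2) by blast
  note sub = subset_trans[OF _ this]
  from n.normal_form obtain T U' V \<Psi> g where nf: "unitary12 T" "open U'" "x0 \<in> U'" "U' \<subseteq> ball x0 \<epsilon>" "open V"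
    "homeomorphism U' V \<Psi> g" "smooth_on U' \<Psi>" "smooth_on V g" 
    "\<forall>x\<in>U'. hopf (homog k (f x)) = act T (hopf (L_tilde 1 (\<Psi> x)))" by blast
  show ?thesis
    by (intro exI[of _ T] exI[of _ U'] exI[of _ V] exI[of _ \<Psi>] exI[of _ g] conjI nf(1-3) sub[OF nf(4)] nf(5-9))
qed

text \<open>Since $\beta=-1$ is real, $b$ is real on lifted tangent vectors, so its product with $J$ has no real part.\<close>

lemma lagrangian_patch:
  assumes x: "x \<in> U"
  shows "cp_metric k (f x) (\<i> *s dd f x u) (dd f x v) = 0"
proof -
  have "cp_metric k (f x) (\<i> *s dd f x u) (dd f x v) = Re (b_form (Hl x (\<i> *s dd f x u)) (Hl x (dd f x v)))"
    by (simp add: cp_metric_eq[OF pos_f[OF x]] b_Hl[OF x] h_def)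
  also have "\<dots> = Re (- \<i> * b_form (Hl x (dd f x u)) (Hl x (dd f x v)))"
    by (simp add: Hl_linear)
  also have "b_form (Hl x (dd f x u)) (Hl x (dd f x v)) = of_real (- (\<theta>1 x u * \<theta>2 x v + \<theta>2 x u * \<theta>1 x v))"
    unfolding Hl_df[OF x] by (simp add: b_H[OF x] gram[OF x] gram'[OF x], simp add: beta_eq)
  finally show ?thesis by simp
qed

end

section \<open>The model surface and its stabiliser\<close>

text \<open>Coefficients can be compared on any infinite set of values, in particular on the values of a real exponential on an interval.\<close>

lemma quartic_zero:
  fixes c0 c1 c2 c3 c4 :: complex
  assumes inf: "infinite S" and 0: "\<And>t. t \<in> S \<Longrightarrow> c0 + c1 * t + c2 * t^2 + c3 * t^3 + c4 * t^4 = 0"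
  shows "c0 = 0" "c1 = 0" "c2 = 0" "c3 = 0" "c4 = 0"
proof -
  have "[:c0, c1, c2, c3, c4:] = 0"
  proof (rule ccontr)
    assume "[:c0, c1, c2, c3, c4:] \<noteq> 0"
    then have "finite {t. poly [:c0, c1, c2, c3, c4:] t = 0}" by (rule poly_roots_finite)
    moreover have "poly [:c0, c1, c2, c3, c4:] t = 0" if "t \<in> S" for t
      using 0[OF that] by (simp add: algebra_simps power2_eq_square power3_eq_cube power4_eq_xxxx)
    then have "S \<subseteq> {t. poly [:c0, c1, c2, c3, c4:] t = 0}" by blast
    ultimately show False using inf finite_subset by blast
  qed
  then show "c0 = 0" "c1 = 0" "c2 = 0" "c3 = 0" "c4 = 0" by (simp_all add: pCons_eq_0_iff)
qed

text \<open>A basis with two null vectors, in which $b$ becomes $\bar R R'+\frac12(\bar P Q'+\bar Q P')$; the coordinates are \<open>null_p\<close>, \<open>null_q\<close> and the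
  second component.\<close>

definition vec_p :: "complex^3" where "vec_p = vector [1/2, 0, 1/2]"
definition vec_q :: "complex^3" where "vec_q = vector [-1/2, 0, 1/2]"
definition vec_r :: "complex^3" where "vec_r = vector [0, 1, 0]"
definition null_p :: "complex^3 \<Rightarrow> complex" where "null_p z = z$3 + z$1"
definition null_q :: "complex^3 \<Rightarrow> complex" where "null_q z = z$3 - z$1"

lemma null_expand: "z = null_p z *s vec_p + null_q z *s vec_q + (z$2) *s vec_r"
  by (simp add: vec_p_def vec_q_def vec_r_def null_p_def null_q_def vec_eq_iff forall_3 field_simps)

lemma b_form_null: "b_form z w = cnj (z$2) * w$2 + (cnj (null_p z) * null_q w + cnj (null_q z) * null_p w) / 2"
  by (simp add: b_form_def null_p_def null_q_def algebra_simps add_divide_distrib diff_divide_distrib)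

lemma null_linear: "null_p (x + y) = null_p x + null_p y" "null_q (x + y) = null_q x + null_q y" "null_p (c *s x) = c * null_p x" "null_q (c *s x) = c * null_q x"
  by (simp_all add: null_p_def null_q_def algebra_simps)

lemma null_basis [simp]: "null_p vec_p = 1" "null_q vec_p = 0" "vec_p$2 = 0" "null_p vec_q = 0" "null_q vec_q = 1" "vec_q$2 = 0" "null_p vec_r = 0" "null_q vec_r = 0" "vec_r$2 = 1"
  by (simp_all add: vec_p_def vec_q_def vec_r_def null_p_def null_q_def)

text \<open>The lift \<open>L_tilde 1\<close> of the model surface, multiplied by $\sqrt3$, with the two exponentials as independent variables: $e=e^{iu}$, $E=e^v$.\<close>

definition model_vec :: "complex \<Rightarrow> complex \<Rightarrow> complex^3" where
  "model_vec e E = (of_real (sqrt 2) * e * E) *s vec_p + (of_real (sqrt 2) * e * inverse E) *s vec_q + inverse (e ^ 2) *s vec_r"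

definition model :: "complex \<Rightarrow> complex^3" where
  "model z = model_vec (exp (\<i> * of_real (Im z / 3))) (of_real (exp (Re z)))"

lemma L_tilde_model: "L_tilde 1 (log_coords z) = of_real (1 / sqrt 3) *s model z"
  unfolding L_tilde_log_coords model_def model_vec_def
  by (simp add: vec_eq_iff forall_3 vec_p_def vec_q_def vec_r_def field_simps)

lemma unit_exp: "cnj (exp (\<i> * of_real t)) * exp (\<i> * of_real t) = 1"
  by (simp add: exp_cnj exp_add[symmetric])

lemma sqrt2_sq: "complex_of_real (sqrt 2) * complex_of_real (sqrt 2) = 2"
  by (simp add: of_real_mult[symmetric] del: of_real_mult)

lemma model_surface: "null_p (model z) * cnj (null_q (model z)) = 2 * (model z $ 2 * cnj (model z $ 2))" "b_form (model z) (model z) = 3"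
proof -
  define e where "e = exp (\<i> * of_real (Im z / 3))"
  define E where "E = complex_of_real (exp (Re z))"
  have e: "cnj e * e = 1" "e \<noteq> 0" unfolding e_def by (rule unit_exp, simp)
  have E: "cnj E = E" "E \<noteq> 0" by (simp_all add: E_def)
  have ce: "cnj e = inverse e" using e by (simp add: field_simps)
  have c: "null_p (model z) = of_real (sqrt 2) * e * E" "null_q (model z) = of_real (sqrt 2) * e * inverse E" "model z $ 2 = inverse (e ^ 2)"
    unfolding model_def e_def[symmetric] E_def[symmetric] by (simp_all add: model_vec_def null_linear)
  show "null_p (model z) * cnj (null_q (model z)) = 2 * (model z $ 2 * cnj (model z $ 2))"
    unfolding c using e(2) E sqrt2_sq by (simp add: ce field_simps)
  show "b_form (model z) (model z) = 3"
    unfolding b_form_null c using e(2) E sqrt2_sq by (simp add: ce field_simps)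
qed

text \<open>The image vector $GY$ satisfies $P\bar Q=2R\bar R$ and $R\bar R+\mathrm{Re}(P\bar Q)=3$, hence $R\bar R=1$ and $P\bar Q=2$. For fixed $u$ and variable
  $E=e^v$ these are identities between polynomials of degree $4$ in $E$. Their extreme coefficients show that
  the form $R$ contains neither $P$ nor $Q$, and that $\bar\alpha_1\alpha_2=\bar\beta_1\beta_2=0$ for the $P$- and $Q$-components of the images of
  the two null vectors; orthogonality of the images does the rest.\<close>

lemma model_monomial:
  assumes G: "unitary12 G" and O: "open Om" "Om \<noteq> {}"
    and img: "\<And>z. z \<in> Om \<Longrightarrow> \<exists>z'. hopf (G *v model z) = hopf (model z')"
  obtains \<alpha> \<gamma> where "\<alpha> \<noteq> 0" "cmod \<gamma> = 1" "G *v vec_r = \<gamma> *s vec_r"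
     "(G *v vec_p = \<alpha> *s vec_p \<and> G *v vec_q = inverse (cnj \<alpha>) *s vec_q) \<or> (G *v vec_q = \<alpha> *s vec_p \<and> G *v vec_p = inverse (cnj \<alpha>) *s vec_q)"
proof -
  define a1 where "a1 = null_p (G *v vec_p)"  define a2 where "a2 = null_q (G *v vec_p)"  define a3 where "a3 = (G *v vec_p)$2"
  define b1 where "b1 = null_p (G *v vec_q)"  define b2 where "b2 = null_q (G *v vec_q)"  define b3 where "b3 = (G *v vec_q)$2"
  define c1 where "c1 = null_p (G *v vec_r)"  define c2 where "c2 = null_q (G *v vec_r)"  define c3 where "c3 = (G *v vec_r)$2"
  note defs = a1_def a2_def a3_def b1_def b2_def b3_def c1_def c2_def c3_def
  have inner: "b_form (G *v x) (G *v y) = b_form x y" for x y using G by (simp add: unitary12_def)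
  have pq: "cnj a3 * b3 + (cnj a1 * b2 + cnj a2 * b1) / 2 = 1 / 2"
    and pr: "cnj a3 * c3 + (cnj a1 * c2 + cnj a2 * c1) / 2 = 0"
    and qr: "cnj b3 * c3 + (cnj b1 * c2 + cnj b2 * c1) / 2 = 0"
    using inner[of vec_p vec_q] inner[of vec_p vec_r] inner[of vec_q vec_r] by (simp_all add: b_form_null defs)
  obtain z0 where z0: "z0 \<in> Om" using O by blast
  then obtain r where r: "r > 0" "ball z0 r \<subseteq> Om" using O open_contains_ball by blast
  define e where "e = exp (\<i> * of_real (Im z0 / 3))"
  have e: "cnj e * e = 1" "e \<noteq> 0" unfolding e_def by (rule unit_exp, simp)
  \<comment> \<open>values of $E$ along a segment in the direction of $v$, for the fixed value $u_0$\<close>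
  define S where "S = (\<lambda>t. complex_of_real (exp (Re z0 + t))) ` {0<..<r}"
  have "inj_on (\<lambda>t. complex_of_real (exp (Re z0 + t))) {0<..<r}" by (auto simp: inj_on_def)
  then have S: "infinite S" unfolding S_def using r(1) by (simp add: finite_image_iff)
  have key: "(G *v model_vec e E)$2 * cnj ((G *v model_vec e E)$2) = 1" "null_p (G *v model_vec e E) * cnj (null_q (G *v model_vec e E)) = 2"
      and ES: "cnj E = E" "E \<noteq> 0" if mem: "E \<in> S" for E
  proof -
    obtain t where t: "0 < t" "t < r" "E = complex_of_real (exp (Re z0 + t))" using mem by (auto simp: S_def)
    show "cnj E = E" "E \<noteq> 0" using t by simp_all
    have "z0 + of_real t \<in> Om" using t r by (intro subsetD[OF r(2)]) (simp add: dist_norm)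
    from img[OF this] obtain z' where "hopf (G *v model (z0 + of_real t)) = hopf (model z')" ..
    moreover have "model (z0 + of_real t) = model_vec e E" unfolding model_def e_def t(3) by simp
    ultimately obtain d where d: "d \<noteq> 0" "G *v model_vec e E = d *s model z'" using hopf_eqD by metis
    have "null_p (G *v model_vec e E) * cnj (null_q (G *v model_vec e E)) = (d * cnj d) * (null_p (model z') * cnj (null_q (model z')))"
      unfolding d(2) by (simp add: null_linear)
    also have "\<dots> = 2 * ((G *v model_vec e E)$2 * cnj ((G *v model_vec e E)$2))"
      unfolding d(2) model_surface by simp
    finally have 1: "null_p (G *v model_vec e E) * cnj (null_q (G *v model_vec e E)) = 2 * ((G *v model_vec e E)$2 * cnj ((G *v model_vec e E)$2))" .
    have eq2: "null_q (G *v model_vec e E) * cnj (null_p (G *v model_vec e E)) = 2 * ((G *v model_vec e E)$2 * cnj ((G *v model_vec e E)$2))"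
      using arg_cong[OF 1, of cnj] by (simp add: mult.commute)
    have "b_form (G *v model_vec e E) (G *v model_vec e E) = 3"
      unfolding inner \<open>model (z0 + of_real t) = model_vec e E\<close>[symmetric] by (rule model_surface)
    then have "3 * ((G *v model_vec e E)$2 * cnj ((G *v model_vec e E)$2)) = 3"
      unfolding b_form_null using 1 eq2 by (simp add: mult.commute)
    then show "(G *v model_vec e E)$2 * cnj ((G *v model_vec e E)$2) = 1" by simp
    with 1 show "null_p (G *v model_vec e E) * cnj (null_q (G *v model_vec e E)) = 2" by simp
  qed
  define s2 where "s2 = complex_of_real (sqrt 2)"
  have s2: "s2 \<noteq> 0" "cnj s2 = s2" "s2 * s2 = 2" using sqrt2_sq by (simp_all add: s2_def)
  define k where "k = inverse (e ^ 2)"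
  have k: "k \<noteq> 0" using e by (simp add: k_def)
  have GY: "G *v model_vec e E = (s2 * e * E) *s (G *v vec_p) + (s2 * e * inverse E) *s (G *v vec_q) + k *s (G *v vec_r)" for E
    by (simp add: model_vec_def s2_def k_def matrix_vector_right_distrib vector_scalar_commute)
  have comp: "(G *v model_vec e E)$2 = s2 * e * E * a3 + s2 * e * inverse E * b3 + k * c3"
     "null_p (G *v model_vec e E) = s2 * e * E * a1 + s2 * e * inverse E * b1 + k * c1"
     "null_q (G *v model_vec e E) = s2 * e * E * a2 + s2 * e * inverse E * b2 + k * c2" for E
    unfolding GY by (simp_all add: null_linear defs)
  have quad: "x0 = (0::complex) \<and> x4 = 0 \<and> x2 = m"
    if "\<And>E. E \<in> S \<Longrightarrow> x0 + x1 * E + x2 * E^2 + x3 * E^3 + x4 * E^4 = m * E^2" for x0 x1 x2 x3 x4 m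
    using quartic_zero[OF S, of x0 x1 "x2 - m" x3 x4] that by (simp add: algebra_simps)
  have expand: "(x2 * E^2 + x1 * E + x0) * cnj (y2 * E^2 + y1 * E + y0) = x0 * cnj y0 + (x0 * cnj y1 + x1 * cnj y0) * E
      + (x0 * cnj y2 + x1 * cnj y1 + x2 * cnj y0) * E^2 + (x2 * cnj y1 + x1 * cnj y2) * E^3 + x2 * cnj y2 * E^4"
    if "cnj E = E" for E x0 x1 x2 y0 y1 y2
    using that by (simp add: algebra_simps power2_eq_square power3_eq_cube power4_eq_xxxx)
  have r0: "(s2 * e * b3) * cnj (s2 * e * b3) = 0 \<and> (s2 * e * a3) * cnj (s2 * e * a3) = 0 \<and>
      (s2 * e * b3) * cnj (s2 * e * a3) + (k * c3) * cnj (k * c3) + (s2 * e * a3) * cnj (s2 * e * b3) = 1"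
  proof (rule quad[where ?x1.0 = "(s2 * e * b3) * cnj (k * c3) + (k * c3) * cnj (s2 * e * b3)" 
        and ?x3.0 = "(s2 * e * a3) * cnj (k * c3) + (k * c3) * cnj (s2 * e * a3)"])
    fix E assume E: "E \<in> S"
    have "E^2 = E^2 * ((G *v model_vec e E)$2 * cnj ((G *v model_vec e E)$2))" using key(1)[OF E] by simp
    also have "\<dots> = (E * (G *v model_vec e E)$2) * cnj (E * (G *v model_vec e E)$2)" using ES(1)[OF E] by (simp add: power2_eq_square)
    also have "E * (G *v model_vec e E)$2 = (s2 * e * a3) * E^2 + (k * c3) * E + (s2 * e * b3)"
      unfolding comp using ES(2)[OF E] by (simp add: field_simps power2_eq_square)
    finally have eq: "E^2 = ((s2 * e * a3) * E^2 + (k * c3) * E + (s2 * e * b3))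
      * cnj ((s2 * e * a3) * E^2 + (k * c3) * E + (s2 * e * b3))" .
    show "(s2 * e * b3) * cnj (s2 * e * b3) + ((s2 * e * b3) * cnj (k * c3) + (k * c3) * cnj (s2 * e * b3)) * E
      + ((s2 * e * b3) * cnj (s2 * e * a3) + (k * c3) * cnj (k * c3) + (s2 * e * a3) * cnj (s2 * e * b3)) * E^2
      + ((s2 * e * a3) * cnj (k * c3) + (k * c3) * cnj (s2 * e * a3)) * E^3 + (s2 * e * a3) * cnj (s2 * e * a3) * E^4 = 1 * E^2"
      unfolding mult_1_left by (rule eq[unfolded expand[OF ES(1)[OF E]], symmetric])
  qed
  have "(s2 * e * b1) * cnj (s2 * e * b2) = 0 \<and> (s2 * e * a1) * cnj (s2 * e * a2) = 0 \<and>
      (s2 * e * b1) * cnj (s2 * e * a2) + (k * c1) * cnj (k * c2) + (s2 * e * a1) * cnj (s2 * e * b2) = 2"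
  proof (rule quad[where ?x1.0 = "(s2 * e * b1) * cnj (k * c2) + (k * c1) * cnj (s2 * e * b2)" 
        and ?x3.0 = "(s2 * e * a1) * cnj (k * c2) + (k * c1) * cnj (s2 * e * a2)"])
    fix E assume E: "E \<in> S"
    have "2 * E^2 = E^2 * (null_p (G *v model_vec e E) * cnj (null_q (G *v model_vec e E)))" using key(2)[OF E] by simp
    also have "\<dots> = (E * null_p (G *v model_vec e E)) * cnj (E * null_q (G *v model_vec e E))" using ES(1)[OF E] by (simp add: power2_eq_square)
    also have "E * null_p (G *v model_vec e E) = (s2 * e * a1) * E^2 + (k * c1) * E + (s2 * e * b1)"
      unfolding comp using ES(2)[OF E] by (simp add: field_simps power2_eq_square)
    also have "E * null_q (G *v model_vec e E) = (s2 * e * a2) * E^2 + (k * c2) * E + (s2 * e * b2)"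
      unfolding comp using ES(2)[OF E] by (simp add: field_simps power2_eq_square)
    finally have eq: "2 * E^2 = ((s2 * e * a1) * E^2 + (k * c1) * E + (s2 * e * b1))
      * cnj ((s2 * e * a2) * E^2 + (k * c2) * E + (s2 * e * b2))" .
    show "(s2 * e * b1) * cnj (s2 * e * b2) + ((s2 * e * b1) * cnj (k * c2) + (k * c1) * cnj (s2 * e * b2)) * E
      + ((s2 * e * b1) * cnj (s2 * e * a2) + (k * c1) * cnj (k * c2) + (s2 * e * a1) * cnj (s2 * e * b2)) * E^2
      + ((s2 * e * a1) * cnj (k * c2) + (k * c1) * cnj (s2 * e * a2)) * E^3 + (s2 * e * a1) * cnj (s2 * e * a2) * E^4 = 2 * E^2"
      by (rule eq[unfolded expand[OF ES(1)[OF E]], symmetric])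
  qed
  then have ab: "b1 = 0 \<or> b2 = 0" "a1 = 0 \<or> a2 = 0" using s2 e by auto
  have 3: "a3 = 0" "b3 = 0" using r0 s2 e by auto
  have kk: "k * cnj k = 1"
  proof -
    have "k * cnj k = inverse ((cnj e * e)^2)" by (simp add: k_def power_mult_distrib)
    then show ?thesis using e by simp
  qed
  have "(k * cnj k) * (c3 * cnj c3) = 1" using r0 3 by (simp add: mult_ac)
  then have "c3 * cnj c3 = 1" using kk by simp
  then have "complex_of_real ((cmod c3)^2) = 1" by (simp only: complex_norm_square)
  then have c3: "cmod c3 = 1" by (metis of_real_eq_1_iff norm_ge_zero power2_eq_1_iff abs_norm_cancel abs_1 abs_minus_cancel)
  have Gexp: "G *v vec_p = a1 *s vec_p + a2 *s vec_q + a3 *s vec_r" "G *v vec_q = b1 *s vec_p + b2 *s vec_q + b3 *s vec_r"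
     "G *v vec_r = c1 *s vec_p + c2 *s vec_q + c3 *s vec_r"
    unfolding defs by (rule null_expand)+
  note rel = pq[unfolded 3] pr[unfolded 3] qr[unfolded 3]
  show ?thesis
  proof (cases "a1 = 0")
    case True
    then have 1: "cnj a2 * b1 = 1" "cnj a2 * c1 = 0" using rel by simp_all
    then have nz: "a2 \<noteq> 0" "b1 \<noteq> 0" by auto
    then have "c1 = 0" "b2 = 0" using 1 ab by auto
    then have "c2 = 0" using rel nz by simp
    have a2: "a2 = inverse (cnj b1)"
    proof -
      have "cnj (cnj a2 * b1) = 1" using 1(1) by simp
      then show ?thesis using nz by (simp add: field_simps)
    qed
    show ?thesis
      by (rule that[of b1 c3]) (use nz c3 in \<open>simp_all add: Gexp 3 True \<open>c1 = 0\<close> \<open>b2 = 0\<close> \<open>c2 = 0\<close> a2\<close>)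
  next
    case False
    then have "a2 = 0" using ab by simp
    then have 1: "cnj a1 * b2 = 1" "cnj a1 * c2 = 0" using rel by simp_all
    then have nz: "b2 \<noteq> 0" by auto
    then have "c2 = 0" "b1 = 0" using 1 ab False by auto
    then have "c1 = 0" using rel nz by simp
    have b2: "b2 = inverse (cnj a1)" using 1 False by (simp add: field_simps)
    show ?thesis
      by (rule that[of a1 c3]) (use False c3 in \<open>simp_all add: Gexp 3 \<open>a2 = 0\<close> \<open>c1 = 0\<close> \<open>b1 = 0\<close> \<open>c2 = 0\<close> b2\<close>)
  qed
qed

text \<open>A diagonal isometry multiplies the two exponentials of the model by constants of equal argument and inverse
  moduli, which is a translation of $z=v+3iu$ up to a common unimodular factor $c$; exchanging $P$ and $Q$ in addition replaces
  $v$ by $-v$, i.e. $z$ by $-\bar z$.\<close>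

lemma model_stabilizer:
  assumes G: "unitary12 G" and O: "open Om" "Om \<noteq> {}"
    and img: "\<And>z. z \<in> Om \<Longrightarrow> \<exists>z'. hopf (G *v model z) = hopf (model z')"
  shows "\<exists>d. (\<forall>z. hopf (G *v model z) = hopf (model (z + d))) \<or> (\<forall>z. hopf (G *v model z) = hopf (model (- cnj z + d)))"
proof -
  obtain \<alpha> \<gamma> where ag: "\<alpha> \<noteq> 0" "cmod \<gamma> = 1" "G *v vec_r = \<gamma> *s vec_r"
     "(G *v vec_p = \<alpha> *s vec_p \<and> G *v vec_q = inverse (cnj \<alpha>) *s vec_q) \<or> (G *v vec_q = \<alpha> *s vec_p \<and> G *v vec_p = inverse (cnj \<alpha>) *s vec_q)"
    using model_monomial[OF assms] by metis
  define \<nu> where "\<nu> = ln (cmod \<alpha>)"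
  define \<phi> where "\<phi> = Arg \<alpha>"
  define \<rho> where "\<rho> = Arg \<gamma>"
  define d where "d = Complex \<nu> (\<phi> - \<rho>)"
  have \<alpha>: "\<alpha> = of_real (exp \<nu>) * exp (\<i> * of_real \<phi>)"
    using ag(1) Arg_eq[of \<alpha>] by (simp add: \<nu>_def \<phi>_def)
  have \<gamma>: "\<gamma> = exp (\<i> * of_real \<rho>)"
  proof -
    have "\<gamma> \<noteq> 0" using ag(2) by auto
    then show ?thesis using ag(2) Arg_eq[of \<gamma>] by (simp add: \<rho>_def)
  qed
  have \<alpha>': "inverse (cnj \<alpha>) = of_real (exp (- \<nu>)) * exp (\<i> * of_real \<phi>)"
    unfolding \<alpha> by (simp add: exp_cnj exp_minus)
  \<comment> \<open>The phase that is left when the translation of $u$ by $(\phi-\rho)/3$ has been taken out.\<close>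
  define c where "c = exp (\<i> * of_real (\<phi> - (\<phi> - \<rho>) / 3))"
  have c: "c \<noteq> 0" by (simp add: c_def)
  have Md: "c *s model w = (of_real (sqrt 2) * exp (\<i> * of_real \<phi> + \<i> * of_real (Im w / 3 - Im d / 3) + of_real (Re w))) *s vec_p
     + (of_real (sqrt 2) * exp (\<i> * of_real \<phi> + \<i> * of_real (Im w / 3 - Im d / 3) - of_real (Re w))) *s vec_q
     + exp (\<i> * of_real \<rho> - 2 * \<i> * of_real (Im w / 3 - Im d / 3)) *s vec_r" for w
  proof -
    have 1: "exp (\<i> * of_real \<phi> + \<i> * of_real (Im w / 3 - Im d / 3) + x) = c * exp (\<i> * of_real (Im w / 3)) * exp x" for x
      unfolding c_def exp_add[symmetric] d_def by (rule arg_cong[of _ _ exp]) (simp add: algebra_simps diff_divide_distrib)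
    have 2: "exp (\<i> * of_real \<rho> - 2 * \<i> * of_real (Im w / 3 - Im d / 3)) = c * inverse (exp (\<i> * of_real (Im w / 3)) ^ 2)"
      unfolding c_def exp_of_nat_mult[symmetric] exp_minus[symmetric] exp_add[symmetric] d_def
      by (rule arg_cong[of _ _ exp]) (simp add: algebra_simps diff_divide_distrib)
    have 3: "exp (- complex_of_real (Re w)) = inverse (of_real (exp (Re w)))"
      by (simp add: exp_minus exp_of_real)
    show ?thesis unfolding 2 unfolding 1 diff_conv_add_uminus[of _ "complex_of_real (Re w)"] 3
      by (simp add: model_def model_vec_def vec_eq_iff algebra_simps exp_of_real)
  qed
  have GM: "G *v model z = (of_real (sqrt 2) * exp (\<i> * of_real (Im z / 3) + of_real (Re z))) *s (G *v vec_p)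
     + (of_real (sqrt 2) * exp (\<i> * of_real (Im z / 3) - of_real (Re z))) *s (G *v vec_q)
     + exp (- 2 * \<i> * of_real (Im z / 3)) *s (G *v vec_r)" for z
  proof -
    have 2: "exp (- 2 * \<i> * of_real (Im z / 3)) = inverse (exp (\<i> * of_real (Im z / 3)) ^ 2)"
      unfolding exp_of_nat_mult[symmetric] exp_minus[symmetric] by (rule arg_cong[of _ _ exp]) simp
    have 3: "exp (\<i> * of_real (Im z / 3) + of_real (Re z)) = exp (\<i> * of_real (Im z / 3)) * of_real (exp (Re z))"
      "exp (\<i> * of_real (Im z / 3) - of_real (Re z)) = exp (\<i> * of_real (Im z / 3)) * inverse (of_real (exp (Re z)))"
      by (simp_all only: exp_add exp_diff exp_of_real divide_inverse)
    show ?thesis unfolding 2 unfolding 3 model_def model_vec_def matrix_vector_right_distrib vector_scalar_commute mult.assoc ..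
  qed
  have exps: "exp x * (of_real (exp t) * exp y) = exp (x + of_real t + y)" for x y :: complex and t :: real
    by (simp only: exp_add exp_of_real mult.assoc)
  from ag(4) show ?thesis
  proof
    assume G1: "G *v vec_p = \<alpha> *s vec_p \<and> G *v vec_q = inverse (cnj \<alpha>) *s vec_q"
    have "G *v model z = c *s model (z + d)" for z
      unfolding GM Md G1[THEN conjunct1] G1[THEN conjunct2] ag(3) \<alpha>' unfolding \<alpha> \<gamma> vector_smult_assoc mult.assoc exps exp_add[symmetric]
      by (simp add: d_def algebra_simps add_divide_distrib diff_divide_distrib)
    then have "hopf (G *v model z) = hopf (model (z + d))" for z using c by (simp add: hopf_smult)
    then show ?thesis by blast
  next
    assume G2: "G *v vec_q = \<alpha> *s vec_p \<and> G *v vec_p = inverse (cnj \<alpha>) *s vec_q"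
    have "G *v model z = c *s model (- cnj z + d)" for z
      unfolding GM Md G2[THEN conjunct1] G2[THEN conjunct2] ag(3) \<alpha>' unfolding \<alpha> \<gamma> vector_smult_assoc mult.assoc exps exp_add[symmetric]
      by (simp add: d_def algebra_simps add_divide_distrib diff_divide_distrib)
    then have "hopf (G *v model z) = hopf (model (- cnj z + d))" for z using c by (simp add: hopf_smult)
    then show ?thesis by blast
  qed
qed

section \<open>From local normal forms to congruence\<close>

text \<open>A restriction of a chart, followed by a diffeomorphism, is a compatible chart; every transition map factors through
  the given chart.\<close>

lemma smooth_surface_insert_chart:
  assumes A: "smooth_surface \<A>" and V: "(V, \<phi>) \<in> \<A>" and W: "open W" "W \<subseteq> V"
    and V': "open V'" and hom: "homeomorphism (\<phi> ` W) V' \<Phi> g" and sm: "smooth_on (\<phi> ` W) \<Phi>" "smooth_on V' g"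
  shows "smooth_surface (insert (W, \<Phi> \<circ> \<phi>) \<A>)"
proof -
  have cov: "(\<Union>(V, \<phi>)\<in>\<A>. V) = UNIV"
    and ch: "\<And>X \<xi>. (X, \<xi>) \<in> \<A> \<Longrightarrow> open X \<and> open (\<xi> ` X) \<and> (\<exists>\<xi>'. homeomorphism X (\<xi> ` X) \<xi> \<xi>')"
    and tr: "\<And>X \<xi> X' \<xi>'. (X, \<xi>) \<in> \<A> \<Longrightarrow> (X', \<xi>') \<in> \<A> \<Longrightarrow> smooth_on (\<xi> ` (X \<inter> X')) (\<xi>' \<circ> inv_into X \<xi>)"
    using A unfolding smooth_surface_def by fast+
  have inj: "inj_on \<xi> X" if "(X, \<xi>) \<in> \<A>" for X \<xi>
    using ch[OF that] by (auto simp: homeomorphism_def inj_on_def) metis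
  have op: "open (\<xi> ` O')" if X: "(X, \<xi>) \<in> \<A>" and O': "open O'" "O' \<subseteq> X" for X \<xi> O'
  proof -
    obtain \<xi>' where \<xi>': "homeomorphism X (\<xi> ` X) \<xi> \<xi>'" using ch[OF X] by blast
    have "openin (top_of_set X) O'" using O' by (metis inf.absorb_iff2 openin_open)
    then have "openin (top_of_set (\<xi> ` X)) (\<xi> ` O')" using homeomorphism_imp_open_map[OF \<xi>'] by blast
    then show ?thesis using ch[OF X] openin_open_trans by blast
  qed
  have openW: "open (\<phi> ` W)" using op[OF V W] .
  have injW: "inj_on \<phi> W" using inj[OF V] W inj_on_subset by blast
  have gP: "g (\<Phi> (\<phi> q)) = \<phi> q" if "q \<in> W" for q
    using hom that by (simp add: homeomorphism_def)
  have img: "(\<Phi> \<circ> \<phi>) ` W = V'" using hom by (simp add: homeomorphism_def image_image o_def)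
  have injC: "inj_on (\<Phi> \<circ> \<phi>) W"
    using gP injW by (auto simp: inj_on_def) metis
  have invC: "inv_into W (\<Phi> \<circ> \<phi>) ((\<Phi> \<circ> \<phi>) q) = q" if "q \<in> W" for q
    using inv_into_f_f[OF injC that] .
  have invX: "inv_into X \<xi> (\<xi> q) = q" if "(X, \<xi>) \<in> \<A>" "q \<in> X" for X \<xi> q
    using inv_into_f_f[OF inj[OF that(1)] that(2)] .
  have openC: "open ((\<Phi> \<circ> \<phi>) ` O')" if O': "open O'" "O' \<subseteq> W" for O'
  proof -
    have "open (\<phi> ` O')" using op[OF V] O' W by blast
    then have "openin (top_of_set (\<phi> ` W)) (\<phi> ` O')" using O' openW by (simp add: openin_open_eq image_mono)
    then have "openin (top_of_set V') (\<Phi> ` \<phi> ` O')" using homeomorphism_imp_open_map[OF hom] by blast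
    then show ?thesis using V' openin_open_trans by (metis image_comp)
  qed
  have homC: "\<exists>\<psi>'. homeomorphism W ((\<Phi> \<circ> \<phi>) ` W) (\<Phi> \<circ> \<phi>) \<psi>'"
  proof -
    obtain \<phi>' where \<phi>': "homeomorphism V (\<phi> ` V) \<phi> \<phi>'" using ch[OF V] by blast
    have "homeomorphism W (\<phi> ` W) \<phi> \<phi>'"
      by (rule homeomorphism_of_subsets[OF \<phi>' W(2)]) (use W(2) in auto)
    from homeomorphism_compose[OF this hom] show ?thesis unfolding img by blast
  qed
  have t1: "smooth_on ((\<Phi> \<circ> \<phi>) ` (W \<inter> X)) (\<xi> \<circ> inv_into W (\<Phi> \<circ> \<phi>))" if X: "(X, \<xi>) \<in> \<A>" for X \<xi>
  proof -
    have o: "open ((\<Phi> \<circ> \<phi>) ` (W \<inter> X))" by (rule openC) (use ch[OF X] W in auto)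
    have "smooth_on ((\<Phi> \<circ> \<phi>) ` (W \<inter> X)) (\<lambda>y. (\<xi> \<circ> inv_into V \<phi>) (g y))"
    proof (rule smooth_on_compose[OF o _ _ tr[OF V X]])
      show "g ` (\<Phi> \<circ> \<phi>) ` (W \<inter> X) \<subseteq> \<phi> ` (V \<inter> X)" using gP W(2) by auto
      show "smooth_on ((\<Phi> \<circ> \<phi>) ` (W \<inter> X)) g"
        by (rule smooth_on_subset[OF sm(2)]) (use img in blast)
    qed
    then show ?thesis
    proof (rule smooth_on_cong[OF o, rotated])
      fix y assume "y \<in> (\<Phi> \<circ> \<phi>) ` (W \<inter> X)"
      then obtain q where q: "q \<in> W" "y = (\<Phi> \<circ> \<phi>) q" by blast
      then show "(\<xi> \<circ> inv_into V \<phi>) (g y) = (\<xi> \<circ> inv_into W (\<Phi> \<circ> \<phi>)) y"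
        using invC[OF q(1)] gP[OF q(1)] invX[OF V] W(2) by auto
    qed
  qed
  have t2: "smooth_on (\<xi> ` (X \<inter> W)) ((\<Phi> \<circ> \<phi>) \<circ> inv_into X \<xi>)" if X: "(X, \<xi>) \<in> \<A>" for X \<xi>
  proof -
    have o: "open (\<xi> ` (X \<inter> W))" by (rule op[OF X]) (use ch[OF X] W in auto)
    have "smooth_on (\<xi> ` (X \<inter> W)) (\<lambda>y. \<Phi> ((\<phi> \<circ> inv_into X \<xi>) y))"
    proof (rule smooth_on_compose[OF o _ _ sm(1)])
      show "(\<phi> \<circ> inv_into X \<xi>) ` \<xi> ` (X \<inter> W) \<subseteq> \<phi> ` W" using invX[OF X] by auto
      show "smooth_on (\<xi> ` (X \<inter> W)) (\<phi> \<circ> inv_into X \<xi>)"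
        by (rule smooth_on_subset[OF tr[OF X V]]) (use W(2) in blast)
    qed
    then show ?thesis by (simp add: o_def)
  qed
  have t3: "smooth_on ((\<Phi> \<circ> \<phi>) ` (W \<inter> W)) ((\<Phi> \<circ> \<phi>) \<circ> inv_into W (\<Phi> \<circ> \<phi>))"
  proof -
    have "smooth_on V' (\<lambda>y. y)" by (rule smooth_on_bounded_linear[OF bounded_linear_ident V'])
    then have "smooth_on V' ((\<Phi> \<circ> \<phi>) \<circ> inv_into W (\<Phi> \<circ> \<phi>))"
      by (rule smooth_on_cong[OF V', rotated]) (use img f_inv_into_f[of _ "\<Phi> \<circ> \<phi>" W] in auto)
    then show ?thesis using img by simp
  qed
  show ?thesis unfolding smooth_surface_def
  proof (intro conjI)
    show "(\<Union>(V, \<phi>)\<in>insert (W, \<Phi> \<circ> \<phi>) \<A>. V) = UNIV" using cov by auto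
    show "\<forall>(X, \<xi>)\<in>insert (W, \<Phi> \<circ> \<phi>) \<A>. open X \<and> open (\<xi> ` X) \<and> (\<exists>\<xi>'. homeomorphism X (\<xi> ` X) \<xi> \<xi>')"
    proof (intro ballI, clarify)
      fix X \<xi> assume "(X, \<xi>) \<in> insert (W, \<Phi> \<circ> \<phi>) \<A>"
      then consider "X = W" "\<xi> = \<Phi> \<circ> \<phi>" | "(X, \<xi>) \<in> \<A>" by auto
      then show "open X \<and> open (\<xi> ` X) \<and> (\<exists>\<xi>'. homeomorphism X (\<xi> ` X) \<xi> \<xi>')"
        using ch homC W(1) openC[OF W(1) subset_refl] by cases auto
    qed
    show "\<forall>(X, \<xi>)\<in>insert (W, \<Phi> \<circ> \<phi>) \<A>. \<forall>(X', \<xi>')\<in>insert (W, \<Phi> \<circ> \<phi>) \<A>. smooth_on (\<xi> ` (X \<inter> X')) (\<xi>' \<circ> inv_into X \<xi>)"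
    proof (intro ballI, clarify)
      fix X \<xi> X' \<xi>' assume "(X, \<xi>) \<in> insert (W, \<Phi> \<circ> \<phi>) \<A>" "(X', \<xi>') \<in> insert (W, \<Phi> \<circ> \<phi>) \<A>"
      then consider "X = W" "\<xi> = \<Phi> \<circ> \<phi>" "X' = W" "\<xi>' = \<Phi> \<circ> \<phi>" | "X = W" "\<xi> = \<Phi> \<circ> \<phi>" "(X', \<xi>') \<in> \<A>"
        | "(X, \<xi>) \<in> \<A>" "X' = W" "\<xi>' = \<Phi> \<circ> \<phi>" | "(X, \<xi>) \<in> \<A>" "(X', \<xi>') \<in> \<A>" by blast
      then show "smooth_on (\<xi> ` (X \<inter> X')) (\<xi>' \<circ> inv_into X \<xi>)"
      proof cases
        case 1 then show ?thesis using t3 by simp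
      next
        case 2 then show ?thesis using t1 by simp
      next
        case 3 then show ?thesis using t2 by simp
      next
        case 4 then show ?thesis using tr by simp
      qed
    qed
  qed
qed

lemma smooth_surface_subset:
  assumes "smooth_surface \<B>" "\<A> \<subseteq> \<B>" "(\<Union>(V, \<phi>)\<in>\<A>. V) = UNIV"
  shows "smooth_surface \<A>"
  unfolding smooth_surface_def
proof (intro conjI)
  show "(\<Union>(V, \<phi>)\<in>\<A>. V) = UNIV" by (rule assms(3))
  have "\<forall>x\<in>\<B>. case x of (V, \<phi>) \<Rightarrow> open V \<and> open (\<phi> ` V) \<and> (\<exists>\<phi>'. homeomorphism V (\<phi> ` V) \<phi> \<phi>')"
    and "\<forall>x\<in>\<B>. case x of (V, \<phi>) \<Rightarrow> \<forall>y\<in>\<B>. case y of (W, \<psi>) \<Rightarrow> smooth_on (\<phi> ` (V \<inter> W)) (\<psi> \<circ> inv_into V \<phi>)"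
    using assms(1) unfolding smooth_surface_def by simp_all
  then show "\<forall>x\<in>\<A>. case x of (V, \<phi>) \<Rightarrow> open V \<and> open (\<phi> ` V) \<and> (\<exists>\<phi>'. homeomorphism V (\<phi> ` V) \<phi> \<phi>')"
    and "\<forall>x\<in>\<A>. case x of (V, \<phi>) \<Rightarrow> \<forall>y\<in>\<A>. case y of (W, \<psi>) \<Rightarrow> smooth_on (\<phi> ` (V \<inter> W)) (\<psi> \<circ> inv_into V \<phi>)"
    using assms(2) by fast+
qed

lemma charts_cover: "smooth_surface \<A> \<Longrightarrow> (\<Union>(V, \<phi>)\<in>\<A>. V) = UNIV"
  by (simp only: smooth_surface_def)

lemma chart_cover: "smooth_surface \<A> \<Longrightarrow> \<exists>V \<phi>. (V, \<phi>) \<in> \<A> \<and> p \<in> V"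
proof -
  assume "smooth_surface \<A>"
  then have "p \<in> (\<Union>(V, \<phi>)\<in>\<A>. V)" by (simp only: charts_cover UNIV_I)
  then show ?thesis by blast
qed

lemma smooth_surface_reparametrize:
  assumes W: "smooth_surface (insert (W, \<psi>) \<A>)" and cov: "(\<Union>(V, \<phi>)\<in>\<A>. V) = UNIV"
    and \<tau>: "smooth_on UNIV \<tau>" "smooth_on UNIV \<tau>'" "\<And>s. \<tau>' (\<tau> s) = s" "\<And>s. \<tau> (\<tau>' s) = s"
  shows "smooth_surface (insert (W, \<tau> \<circ> \<psi>) \<A>)"
proof -
  have o: "open W" "open (\<psi> ` W)" using W unfolding smooth_surface_def by auto
  have "\<tau> ` \<psi> ` W = \<tau>' -` (\<psi> ` W)" using \<tau>(3,4) by (auto simp: image_iff) metis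
  then have o': "open (\<tau> ` \<psi> ` W)"
    using open_vimage[OF o(2), of \<tau>'] smooth_on_continuous_on[OF \<tau>(2)] by simp
  have "smooth_surface (insert (W, \<tau> \<circ> \<psi>) (insert (W, \<psi>) \<A>))"
  proof (rule smooth_surface_insert_chart[OF W _ o(1) _ o'])
    show "homeomorphism (\<psi> ` W) (\<tau> ` \<psi> ` W) \<tau> \<tau>'"
      using \<tau>(3) by (auto simp: homeomorphism_def image_image intro: continuous_on_subset[OF smooth_on_continuous_on[OF \<tau>(1)]]
          continuous_on_subset[OF smooth_on_continuous_on[OF \<tau>(2)]])
  qed (auto intro: smooth_on_subset[OF \<tau>(1)] smooth_on_subset[OF \<tau>(2)])
  then show ?thesis by (rule smooth_surface_subset) (use cov in auto)
qed

text \<open>The inverse of \<open>log_coords\<close>.\<close>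

definition exp_coords :: "real^2 \<Rightarrow> complex" where
  "exp_coords s = Complex (sqrt 3 / 2 * (s$1 + s$2)) (3 / 2 * (s$1 - s$2))"

lemma log_exp_coords [simp]: "log_coords (exp_coords s) = s" "exp_coords (log_coords z) = z"
  by (simp_all add: log_coords_def exp_coords_def vec_eq_iff forall_2 complex_eq_iff field_simps)

lemma bounded_linear_exp_coords: "bounded_linear exp_coords"
  unfolding linear_conv_bounded_linear[symmetric] linear_iff
  by (simp add: exp_coords_def complex_eq_iff algebra_simps)

lemma hopf_L_tilde: "hopf (L_tilde 1 (log_coords z)) = hopf (model z)"
  unfolding L_tilde_model by (rule hopf_smult) simp

text \<open>Near $p$ the surface is the image under $T$ of the model, in a compatible chart.\<close>

definition has_model_chart ::
  "'m::topological_space surface_atlas \<Rightarrow> ('m \<Rightarrow> (complex^3) set) \<Rightarrow> complex^3^3 \<Rightarrow> 'm \<Rightarrow> bool" where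
  "has_model_chart \<A> L T p \<longleftrightarrow> (\<exists>W \<psi>. p \<in> W \<and> smooth_surface (insert (W, \<psi>) \<A>) \<and>
      (\<forall>q\<in>W. L q = act T (hopf (L_tilde 1 (\<psi> q)))))"

text \<open>The isometry relating the two normal forms at $p$ stabilises the model, so it may be absorbed into the parameters
  near any other point.\<close>

lemma has_model_chart_transfer:
  assumes A: "smooth_surface \<A>" and T: "unitary12 T" and T': "unitary12 T'"
    and p: "has_model_chart \<A> L T p" "has_model_chart \<A> L T' p" and q: "has_model_chart \<A> L T q"
  shows "has_model_chart \<A> L T' q"
proof -
  note cov = charts_cover[OF A]
  obtain W \<psi> where W: "p \<in> W" "smooth_surface (insert (W, \<psi>) \<A>)" "\<And>q. q \<in> W \<Longrightarrow> L q = act T (hopf (L_tilde 1 (\<psi> q)))"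
    using p(1) unfolding has_model_chart_def by blast
  obtain X \<xi> where X: "p \<in> X" "smooth_surface (insert (X, \<xi>) \<A>)" "\<And>q. q \<in> X \<Longrightarrow> L q = act T' (hopf (L_tilde 1 (\<xi> q)))"
    using p(2) unfolding has_model_chart_def by blast
  obtain S where S: "unitary12 S" "\<And>z. S *v (T' *v z) = z" "\<And>z. T' *v (S *v z) = z"
    using unitary12_inverse[OF T'] by blast
  define G where "G = S ** T"
  have G: "unitary12 G" unfolding G_def by (rule unitary12_mult[OF S(1) T])
  have GT: "T' *v (G *v z) = T *v z" for z by (simp add: G_def matrix_vector_mul_assoc[symmetric] S)
  have oW: "open W" "open (\<psi> ` W)" "\<exists>\<psi>'. homeomorphism W (\<psi> ` W) \<psi> \<psi>'" and oX: "open X"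
    using W(2) X(2) unfolding smooth_surface_def by auto
  obtain \<psi>' where \<psi>': "homeomorphism W (\<psi> ` W) \<psi> \<psi>'" using oW(3) by blast
  have "openin (top_of_set W) (W \<inter> X)" using oX by (simp add: openin_open_Int)
  then have "openin (top_of_set (\<psi> ` W)) (\<psi> ` (W \<inter> X))" using homeomorphism_imp_open_map[OF \<psi>'] by blast
  then have oWX: "open (\<psi> ` (W \<inter> X))" using oW(2) openin_open_trans by blast
  define Om where "Om = log_coords -` (\<psi> ` (W \<inter> X))"
  have "open Om" unfolding Om_def
    by (rule open_vimage[OF oWX linear_continuous_on[OF bounded_linear_log_coords]])
  moreover have "exp_coords (\<psi> p) \<in> Om" using W(1) X(1) by (auto simp: Om_def)
  moreover have "\<exists>z'. hopf (G *v model z) = hopf (model z')" if "z \<in> Om" for z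
  proof -
    obtain q where q: "q \<in> W" "q \<in> X" "log_coords z = \<psi> q" using \<open>z \<in> Om\<close> by (auto simp: Om_def)
    have "hopf (T *v model z) = L q"
      unfolding W(3)[OF q(1)] q(3)[symmetric] hopf_L_tilde act_hopf ..
    also have "\<dots> = hopf (T' *v model (exp_coords (\<xi> q)))"
      unfolding X(3)[OF q(2)] using hopf_L_tilde[of "exp_coords (\<xi> q)"] by (simp add: act_hopf[symmetric])
    finally have "act S (hopf (T *v model z)) = act S (hopf (T' *v model (exp_coords (\<xi> q))))" by simp
    then have "hopf (G *v model z) = hopf (model (exp_coords (\<xi> q)))"
      unfolding act_hopf by (simp only: S G_def matrix_vector_mul_assoc[symmetric])
    then show ?thesis by blast
  qed
  ultimately obtain d where d: "(\<forall>z. hopf (G *v model z) = hopf (model (z + d))) \<or> (\<forall>z. hopf (G *v model z) = hopf (model (- cnj z + d)))"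
    using model_stabilizer[OF G, of Om] by blast
  have bl: "bounded_linear (\<lambda>s. log_coords (exp_coords s))" "bounded_linear (\<lambda>s. log_coords (- cnj (exp_coords s)))"
    by (intro bounded_linear_compose[OF bounded_linear_log_coords] bounded_linear_minus
        bounded_linear_compose[OF bounded_linear_cnj] bounded_linear_exp_coords)+
  have addlog: "log_coords (x + y) = log_coords x + log_coords y" for x y
    using bounded_linear_log_coords by (simp add: bounded_linear.linear linear_add)
  have smooth_affine: "smooth_on UNIV (\<lambda>s. log_coords (exp_coords s + c))" "smooth_on UNIV (\<lambda>s. log_coords (- cnj (exp_coords s) + c))" for c
    unfolding addlog by (intro smooth_on_add open_UNIV smooth_on_const smooth_on_bounded_linear bl)+
  have "\<exists>\<tau> \<tau>'. smooth_on UNIV \<tau> \<and> smooth_on UNIV \<tau>' \<and> (\<forall>s. \<tau>' (\<tau> s) = s) \<and> (\<forall>s. \<tau> (\<tau>' s) = s) \<and>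
     (\<forall>s. hopf (G *v model (exp_coords s)) = hopf (model (exp_coords (\<tau> s))))"
    using d
  proof
    assume "\<forall>z. hopf (G *v model z) = hopf (model (z + d))"
    then show ?thesis
      by (intro exI[of _ "\<lambda>s. log_coords (exp_coords s + d)"] exI[of _ "\<lambda>s. log_coords (exp_coords s + - d)"] conjI smooth_affine) auto
  next
    assume "\<forall>z. hopf (G *v model z) = hopf (model (- cnj z + d))"
    then show ?thesis
      by (intro exI[of _ "\<lambda>s. log_coords (- cnj (exp_coords s) + d)"] exI[of _ "\<lambda>s. log_coords (- cnj (exp_coords s) + cnj d)"] conjI smooth_affine) auto
  qed
  then obtain \<tau> \<tau>' where \<tau>: "smooth_on UNIV \<tau>" "smooth_on UNIV \<tau>'" "\<And>s. \<tau>' (\<tau> s) = s" "\<And>s. \<tau> (\<tau>' s) = s"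
     "\<And>s. hopf (G *v model (exp_coords s)) = hopf (model (exp_coords (\<tau> s)))" by blast
  obtain B \<eta> where B: "q \<in> B" "smooth_surface (insert (B, \<eta>) \<A>)" "\<And>r. r \<in> B \<Longrightarrow> L r = act T (hopf (L_tilde 1 (\<eta> r)))"
    using q unfolding has_model_chart_def by blast
  have L_tilde_eq: "hopf (L_tilde 1 s) = hopf (model (exp_coords s))" for s
    using hopf_L_tilde[of "exp_coords s"] by simp
  have "L r = act T' (hopf (L_tilde 1 ((\<tau> \<circ> \<eta>) r)))" if "r \<in> B" for r
  proof -
    have "L r = hopf (T' *v (G *v model (exp_coords (\<eta> r))))" unfolding B(3)[OF that] L_tilde_eq act_hopf GT ..
    also have "\<dots> = act T' (hopf (G *v model (exp_coords (\<eta> r))))" by (simp only: act_hopf)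
    also have "\<dots> = act T' (hopf (model (exp_coords (\<tau> (\<eta> r)))))" by (simp only: \<tau>(5))
    finally show ?thesis by (simp add: L_tilde_eq)
  qed
  moreover have "smooth_surface (insert (B, \<tau> \<circ> \<eta>) \<A>)"
    by (rule smooth_surface_reparametrize[OF B(2) cov \<tau>(1-4)])
  ultimately show ?thesis unfolding has_model_chart_def using B(1) by blast
qed

lemma open_has_model_chart: "open {p. has_model_chart \<A> L T p}"
proof (subst open_subopen, intro ballI, clarify)
  fix p assume "has_model_chart \<A> L T p"
  then obtain W \<psi> where W: "p \<in> W" "smooth_surface (insert (W, \<psi>) \<A>)" "\<forall>q\<in>W. L q = act T (hopf (L_tilde 1 (\<psi> q)))"
    unfolding has_model_chart_def by blast
  then have "open W" unfolding smooth_surface_def by auto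
  then show "\<exists>S. open S \<and> p \<in> S \<and> S \<subseteq> {p. has_model_chart \<A> L T p}"
    using W unfolding has_model_chart_def by blast
qed

text \<open>By the transfer lemma the sets \<open>{p. has_model_chart \<A> L T p}\<close> are equal or disjoint. They are open and cover the connected surface.\<close>

lemma has_model_chart_global:
  fixes \<A> :: "'m::topological_space surface_atlas"
  assumes A: "smooth_surface \<A>" and conn: "connected (UNIV :: 'm set)"
    and loc: "\<And>p. \<exists>T. unitary12 T \<and> has_model_chart \<A> L T p"
  obtains T where "unitary12 T" "\<And>p. has_model_chart \<A> L T p"
proof -
  obtain p0 :: 'm and T where T: "unitary12 T" "has_model_chart \<A> L T p0" using loc by blast
  define B where "B = (\<Union>T'\<in>{T'. unitary12 T' \<and> \<not> (\<exists>p. has_model_chart \<A> L T p \<and> has_model_chart \<A> L T' p)}. {p. has_model_chart \<A> L T' p})"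
  have "open B" unfolding B_def using open_has_model_chart by blast
  moreover have "UNIV \<subseteq> {p. has_model_chart \<A> L T p} \<union> B"
  proof
    fix p :: 'm
    obtain T' where T': "unitary12 T'" "has_model_chart \<A> L T' p" using loc by blast
    show "p \<in> {p. has_model_chart \<A> L T p} \<union> B"
    proof (cases "\<exists>q. has_model_chart \<A> L T q \<and> has_model_chart \<A> L T' q")
      case True
      then have "has_model_chart \<A> L T p" using has_model_chart_transfer[OF A T'(1) T(1)] T'(2) by blast
      then show ?thesis by blast
    next
      case False
      then show ?thesis using T' unfolding B_def by blast
    qed
  qed
  moreover have "{p. has_model_chart \<A> L T p} \<inter> B = {}" unfolding B_def by blast
  ultimately have "B = {}"
    using connectedD[OF conn open_has_model_chart[of \<A> L T], of B] T(2) by blast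
  then have "has_model_chart \<A> L T p" for p
    using \<open>UNIV \<subseteq> {p. has_model_chart \<A> L T p} \<union> B\<close> by blast
  then show ?thesis using that T(1) by blast
qed

theorem theorem6p1:
  fixes \<A> :: "'m::{t2_space, second_countable_topology} surface_atlas"
    and L :: "'m \<Rightarrow> (complex^3) set"
  assumes "smooth_surface \<A>"
    and "connected (UNIV :: 'm set)"
    and "cp_immersion \<A> L"
    and "lorentzian \<A> L"
    and "minimal_immersion \<A> L"
    and "flat_immersion \<A> L"
    and "slant \<A> L"
  shows "lagrangian \<A> L \<and> (\<exists>a::real. a \<noteq> 0 \<and> congruent_to \<A> L (hopf \<circ> L_tilde a))"
proof -
  \<comment> \<open>coordinate representations of $L$ and their domains, as in the definition of the geometric properties\<close>
  define F where "F k V \<phi> = cp_chart k \<circ> L \<circ> inv_into V \<phi>" for k :: 3 and V and \<phi> :: "'m \<Rightarrow> real^2"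
  define D where "D k V \<phi> = \<phi> ` {p \<in> V. L p \<in> cp_domain k}" for k :: 3 and V and \<phi> :: "'m \<Rightarrow> real^2"
  note coords = in_coords_def F_def[symmetric] D_def[symmetric]
  obtain \<theta> where slant: "\<forall>(V, \<phi>)\<in>\<A>. \<forall>k. \<forall>x\<in>D k V \<phi>. \<exists>U e1 e2. open U \<and> x \<in> U \<and> U \<subseteq> D k V \<phi> \<and>
     null_frame_on U (pullback_metric (cp_metric k) (F k V \<phi>)) e1 e2 \<and>
     wirtinger_angle_on U (cp_metric k) (F k V \<phi>) e1 e2 (\<lambda>_. \<theta>)"
    using assms(7) unfolding slant_def coords by blast
  have chart: "open V" "continuous_on V \<phi>" "inj_on \<phi> V" if "(V, \<phi>) \<in> \<A>" for V \<phi>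
  proof -
    from assms(1) that obtain \<phi>' where "open V" "homeomorphism V (\<phi> ` V) \<phi> \<phi>'"
      unfolding smooth_surface_def by fast
    then show "open V" "continuous_on V \<phi>" "inj_on \<phi> V" by (auto simp: homeomorphism_def intro: inj_on_inverseI)
  qed
  have lift: "pos (homog k (F k V \<phi> (\<phi> q)))" "L q = hopf (homog k (F k V \<phi> (\<phi> q)))"
    if "(V, \<phi>) \<in> \<A>" "q \<in> V" "L q \<in> cp_domain k" for V \<phi> k q
    using that(3) inv_into_f_f[OF chart(3)[OF that(1)] that(2)] by (auto simp: F_def elim!: cp_domain_cases)
  have patch: "\<exists>U e1 e2. x \<in> U \<and> U \<subseteq> D k V \<phi> \<and> minimal_flat_slant_patch k (F k V \<phi>) U e1 e2 (Complex (-1) (- sinh \<theta>))"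
    if V: "(V, \<phi>) \<in> \<A>" and x: "x \<in> D k V \<phi>" for V \<phi> k x
  proof -
    obtain U e1 e2 where U: "open U" "x \<in> U" "U \<subseteq> D k V \<phi>"
       "null_frame_on U (pullback_metric (cp_metric k) (F k V \<phi>)) e1 e2"
       "wirtinger_angle_on U (cp_metric k) (F k V \<phi>) e1 e2 (\<lambda>_. \<theta>)"
      using bspec[OF slant V, unfolded prod.case, THEN spec[of _ k], THEN bspec, OF x] by blast
    have at_chart: "Q k V \<phi>" if "\<forall>(V, \<phi>)\<in>\<A>. \<forall>k. Q k V \<phi>" for Q :: "3 \<Rightarrow> 'm set \<Rightarrow> ('m \<Rightarrow> real^2) \<Rightarrow> bool"
      using bspec[OF that V] by simp
    have "smooth_on (D k V \<phi>) (F k V \<phi>)"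
      using at_chart[OF conjunct2[OF assms(3)[unfolded cp_immersion_def coords]]] by simp
    then have "smooth_on U (F k V \<phi>)" using U(3) smooth_on_subset by blast
    moreover have "pos (homog k (F k V \<phi> y))" if "y \<in> U" for y
      using that U(3) lift(1)[OF V] by (auto simp: D_def)
    ultimately interpret framed_surface k "F k V \<phi>" U e1 e2
      using U by unfold_locales auto
    have "minimal_flat_slant_patch k (F k V \<phi>) U e1 e2 (Complex (-1) (- sinh \<theta>))"
    proof
      show "mean_curvature (cp_metric k) (F k V \<phi>) y = 0" if "y \<in> U" for y
        using at_chart[OF assms(5)[unfolded minimal_immersion_def coords]] U(3) that by blast
      show "riemann_curvature (pullback_metric (cp_metric k) (F k V \<phi>)) y u v w = 0" if "y \<in> U" for y u v w
        using at_chart[OF assms(6)[unfolded flat_immersion_def coords]] U(3) that by blast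
      show "b_form (H1 y) (H2 y) = Complex (-1) (- sinh \<theta>)" if "y \<in> U" for y
        by (rule wirtinger_gram[OF that U(5)])
      show "U \<noteq> {}" using U(2) by blast
    qed
    then show ?thesis using U by blast
  qed
  have "lagrangian \<A> L"
    unfolding lagrangian_def coords
  proof (intro ballI, clarify)
    fix V \<phi> k x u v assume V: "(V, \<phi>) \<in> \<A>" and x: "x \<in> D k V \<phi>"
    from patch[OF V x] obtain U e1 e2 where "x \<in> U"
      and p: "minimal_flat_slant_patch k (F k V \<phi>) U e1 e2 (Complex (-1) (- sinh \<theta>))" by blast
    then show "cp_metric k (F k V \<phi> x) (\<i> *s frechet_derivative (F k V \<phi>) (at x) u) (frechet_derivative (F k V \<phi>) (at x) v) = 0"
      by (intro minimal_flat_slant_patch.lagrangian_patch[OF p])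
  qed
  moreover
  have "\<exists>T. unitary12 T \<and> has_model_chart \<A> L T p" for p
  proof -
    obtain V \<phi> where V: "(V, \<phi>) \<in> \<A>" "p \<in> V" using chart_cover[OF assms(1)] by blast
    obtain z where z: "pos z" "L p = hopf z" using assms(3) unfolding cp_immersion_def CP21_eq by blast
    then have "z \<noteq> 0" by (auto simp: pos_def)
    then obtain k where "z $ k \<noteq> 0" by (auto simp: vec_eq_iff)
    with z have "L p \<in> cp_domain k" by (simp add: hopf_in_cp_domain)
    then have x: "\<phi> p \<in> D k V \<phi>" using V by (auto simp: D_def)
    from patch[OF V(1) x] obtain U e1 e2 where U: "\<phi> p \<in> U" "U \<subseteq> D k V \<phi>"
      and pa: "minimal_flat_slant_patch k (F k V \<phi>) U e1 e2 (Complex (-1) (- sinh \<theta>))" by blast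
    obtain T U' V' \<Psi> g where nf: "unitary12 T" "open U'" "\<phi> p \<in> U'" "U' \<subseteq> U" "open V'" "homeomorphism U' V' \<Psi> g"
      "smooth_on U' \<Psi>" "smooth_on V' g" "\<forall>x\<in>U'. hopf (homog k (F k V \<phi> x)) = act T (hopf (L_tilde 1 (\<Psi> x)))"
      using minimal_flat_slant_patch.normal_form_at[OF pa U(1)] by blast
    define W where "W = V \<inter> \<phi> -` U'"
    have "open W" unfolding W_def by (rule continuous_open_preimage[OF chart(2,1)[OF V(1)] nf(2)])
    have U'D: "U' \<subseteq> D k V \<phi>" using U(2) nf(4) by blast
    then have im: "\<phi> ` W = U'" by (auto simp: W_def D_def)
    have "smooth_surface (insert (W, \<Psi> \<circ> \<phi>) \<A>)"
      by (rule smooth_surface_insert_chart[OF assms(1) V(1) \<open>open W\<close> _ nf(5)]) (use nf im in \<open>auto simp: W_def\<close>)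
    moreover have "L q = act T (hopf (L_tilde 1 ((\<Psi> \<circ> \<phi>) q)))" if q: "q \<in> W" for q
    proof -
      have "\<phi> q \<in> D k V \<phi>" "q \<in> V" using q U'D by (auto simp: W_def)
      then have "L q \<in> cp_domain k" using inj_onD[OF chart(3)[OF V(1)]] by (auto simp: D_def)
      from lift(2)[OF V(1) \<open>q \<in> V\<close> this] show ?thesis using nf(9) q by (auto simp: W_def)
    qed
    moreover have "p \<in> W" using V nf by (simp add: W_def)
    ultimately show ?thesis unfolding has_model_chart_def using nf(1) by blast
  qed
  then obtain T where T: "unitary12 T" "\<And>p. has_model_chart \<A> L T p"
    using has_model_chart_global[OF assms(1,2)] by blast
  have "congruent_to \<A> L (hopf \<circ> L_tilde 1)"
    unfolding congruent_to_def
  proof (intro exI[of _ "act T"] conjI allI)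
    show "holomorphic_isometry (act T)" by (rule holomorphic_isometry_act[OF T(1)])
    show "\<exists>W \<psi>. p \<in> W \<and> smooth_surface (insert (W, \<psi>) \<A>) \<and> (\<forall>q\<in>W. L q = act T ((hopf \<circ> L_tilde 1) (\<psi> q)))" for p
      using T(2)[of p] unfolding has_model_chart_def by simp
  qed
  ultimately show ?thesis by (intro conjI exI[of _ 1]) auto
qed

end
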